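(* Let the eigenvalues $\lambda_\ell(z)$, $\ell=1,\dots,L$, of the matrix-symbol $\mathcal{F}(z)$ of the matrix-valued operator $\mathcal{F}(A)$ in the problem $$D_*^{\mathcal{B}}\mathcal{U}(t)=\mathcal{F}(A)\,\mathcal{U}(t)+\mathcal{H}(t),\quad t>0,\qquad \mathcal{U}(0)=\Phi,$$ have respective multiplicities $m_\ell$, $\ell=1,\dots,L$, where $m_1+\dots+m_L=m$. Then the solution to this problem has the representation $$\mathcal{U}(t)=\mathcal{S}(t,A)\Phi+\int_0^t\mathcal{S}(t-\tau,A)\,D_+^{1-\mathcal{B}}\mathcal{H}(\tau)\,d\tau,$$ where $\mathcal{S}(t,A)$ is the matrix-valued solution operator with the matrix-symbol $\mathcal{S}(t,z)$ defined as follows. (a) If $\mathcal{B}=(\beta,\dots,\beta)$ with equal components $\beta\in(0,1]$, then $$\mathcal{S}(t,z)=E_{\mathcal{B}}(It^{\mathcal{B}}\mathcal{F}(z))=M(z)\,\mathbb{E}_{\mathcal{B}}\big(t^\beta(\Lambda(z)+N)\big)\,M^{-1}(z),\quad t>0,\ z\in G.$$ (b) If $\mathcal{B}=(\beta_1,\dots,\beta_m)$ with rational components $\beta_j=q_j/p_j\in(0,1]$, then $\mathcal{S}(t,z)$ has the entries $$s_{jk}(t,z)=\sum_{\ell=1}^{\hat L}\sum_{\nu=1}^{\mu_\ell}\frac{C^{jk}_{\ell\nu}(z)\,t^{\frac{\nu}{p}-\beta_k}}{(\nu-1)!}\,E^{(\nu-1)}_{\frac1p,\,\frac1p-\beta_k+1}\big(t^{\frac1p}\hat\lambda_\ell(z)\big),\quad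 j,k=1,\dots,m,$$ with $p$, $\hat L$, $\hat\lambda_\ell$, $\mu_\ell$, $C^{jk}_{\ell\nu}$ as defined in the context.
   Context: Operators and spaces. $X$ is a reflexive Banach space and $A$ is a closed linear operator in $X$ with dense domain $\mathcal{D}(A)$ and nonempty spectrum. For $\lambda\in\mathbb{C}$ put $A_\lambda=A-\lambda I$. For $\mu>0$ let $X_\mu(A_\lambda)$ be the set of $x\in\bigcap_{k\ge1}\mathcal{D}(A_\lambda^k)$ for which there is $C>0$, independent of $k$, with $\|A_\lambda^kx\|\le C\mu^k\|x\|$, $k=1,2,\dots$; convergence in it is norm convergence. $X_{A_\lambda,r}=\bigcup_{0<\mu<r}X_\mu(A_\lambda)$ with the inductive limit topology. For an open set $G\subset\mathbb{C}$, $X_{A,G}$ is the space of finite sums $u=\sum_{\lambda}u_\lambda$, where $\lambda\in G$, $u_\lambda\in X_{A_\lambda,r}$, $r<\mathrm{dist}(\lambda,\partial G)$, with the corresponding topology. For $f$ analytic in $G$, $f(A)u=\sum_\lambda\sum_{n=0}^\infty\frac{f^{(n)}(\lambda)}{n!}A_\lambda^nu_\lambda$. $\mathcal{X}_{A,G}$ is the direct product of $m$ copies of $X_{A,G}$. The $m\times m$ matrix-symbol $\mathcal{F}(z)=\{f_{jk}(z)\}$ is analytic in $G$ and defines $\mathcal{F}(A)=\{f_{jk}(A)\}$; $\Phi=(\varphi_1,\dots,\varphi_m)\in\mathcal{X}_{A,G}$, and $\mathcal{H}(t)$ is a given vector-function. It is assumed that $G\cap Q_0=\emptyset$, where $Q_0=\{z\in\mathbb{C}:\det(Is^{\mathcal{B}}-\mathcal{F}(z))=0\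 \text{for all } s>0\}$, $Is^{\mathcal{B}}=\mathrm{diag}(s^{\beta_1},\dots,s^{\beta_m})$. The theorem is presented in the paper as giving formal representations (solution at the level of symbols, with $A$ then substituted for $z$). Fractional operators. For $0<\beta<1$, $D_+^\beta f(t)=\frac{1}{\Gamma(1-\beta)}\frac{d}{dt}\int_0^t\frac{f(\tau)}{(t-\tau)^\beta}d\tau$ (Riemann–Liouville), $D_*^\beta f(t)=\frac1{\Gamma(1-\beta)}\int_0^t\frac{f'(\tau)}{(t-\tau)^\beta}d\tau$ (Caputo); $D_+^0=I$, and order $1$ is the ordinary derivative. For vectors: $D_*^{\mathcal{B}}\mathcal{U}=(D_*^{\beta_1}u_1,\dots,D_*^{\beta_m}u_m)$, $D_+^{1-\mathcal{B}}\mathcal{H}=(D_+^{1-\beta_1}h_1,\dots,D_+^{1-\beta_m}h_m)$. $E_{\beta,\nu}(z)=\sum_{n\ge0}\frac{z^n}{\Gamma(\beta n+\nu)}$, $E_\beta=E_{\beta,1}$, and superscript $(k)$ denotes the $k$-th derivative in $z$. Notation for (a). $\mathcal{F}(z)=M(z)(\Lambda(z)+N)M^{-1}(z)$ is the Jordan decomposition, $M(z)$ invertible for each $z\in G$, with Jordan blocks $\mathbb{J}_\ell(z)$ of size $m_\ell$ corresponding to $\lambda_\ell(z)$. $E_{\mathcal{B}}(It^{\mathcal{B}}\mathcal{F}(z))=\sum_{n\ge0}\frac{t^{n\beta}\mathcal{F}(z)^n}{\Gamma(n\beta+1)}$, and $\mathbb{E}_{\mathcal{B}}(t^\beta(\Lambda(z)+N))$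 is block-diagonal with blocks $\mathbb{E}_\beta(t^\beta\mathbb{J}_\ell(z))$, the upper triangular $m_\ell\times m_\ell$ matrices with $(i,i+q)$ entries $\frac{t^{q\beta}}{q!}E_\beta^{(q)}(\lambda_\ell(z)t^\beta)$, $q\ge0$. Notation for (b). $p_j,q_j$ are coprime positive integers, $p$ is the least common multiple of $p_1,\dots,p_m$, $n_j=q_jp/p_j$ (so $\beta_j=n_j/p$), $N_0=n_1+\dots+n_m$. $\hat\lambda_1(z),\dots,\hat\lambda_{\hat L}(z)$, with multiplicities $\mu_1,\dots,\mu_{\hat L}$, are the distinct roots of the polynomial of degree $N_0$ in $\lambda$, $P_{N_0}(\lambda,z)=\det(\mathrm{diag}(\lambda^{n_1},\dots,\lambda^{n_m})-\mathcal{F}(z))=\prod_{\ell=1}^{\hat L}(\lambda-\hat\lambda_\ell(z))^{\mu_\ell}$; equivalently the eigenvalues of the $N_0\times N_0$ matrix of the equivalent system of $N_0$ equations of order $1/p$. If $\mathcal{F}_j(s,z)$ is the matrix obtained from $Is^{\mathcal{B}}-\mathcal{F}(z)$ by replacing its $j$-th column with $(s^{\beta_1-1}\varphi_1,\dots,s^{\beta_m-1}\varphi_m)^T$, the polynomials $P_{jk}(\lambda,z)$ in $\lambda$ are defined by $\det\mathcal{F}_j(s,z)=\sum_{k=1}^mP_{jk}(s^{1/p},z)s^{\beta_k-1}\varphi_k$. The coefficients $C^{jk}_{\ell\nu}(z)$ are those of the partial fraction decomposition $\frac{P_{jk}(\lambda,z)}{\prod_\ell(\lambda-\hat\lambda_\ell(z))^{\mu_\ell}}=\sum_{\ell=1}^{\hat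 L}\sum_{\nu=1}^{\mu_\ell}\frac{C^{jk}_{\ell\nu}(z)}{(\lambda-\hat\lambda_\ell(z))^\nu}$.
   Formalization: Assumes f(A)u does not depend on the decomposition of u; X_mu(A_lambda) carries the norm sup_k ||A_lambda^k x||/mu^k, not that of X; H is continuous, D_+^{1-B}H and U' are stepwise continuous into X_{A,G} for t>0 and integrable at 0. *)

theory Defs
  imports
    "HOL-Complex_Analysis.Complex_Analysis"
    "Jordan_Normal_Form.Jordan_Normal_Form"
begin

section \<open>Complex Banach spaces and closed operators\<close>

class complex_banach = banach +
  fixes scaleC :: "complex \<Rightarrow> 'a \<Rightarrow> 'a" (infixr "*\<^sub>C" 75)
  assumes scaleC_add_right: "c *\<^sub>C (x + y) = c *\<^sub>C x + c *\<^sub>C y"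
    and scaleC_add_left: "(c + d) *\<^sub>C x = c *\<^sub>C x + d *\<^sub>C x"
    and scaleC_scaleC: "c *\<^sub>C d *\<^sub>C x = (c * d) *\<^sub>C x"
    and scaleC_one: "1 *\<^sub>C x = x"
    and scaleR_scaleC: "r *\<^sub>R x = complex_of_real r *\<^sub>C x"
    and norm_scaleC: "norm (c *\<^sub>C x) = cmod c * norm x"

text \<open>The complex dual is the set of complex-linear elements of \<open>'a \<Rightarrow>\<^sub>L complex\<close>;
  reflexivity is surjectivity of the evaluation map onto its (complex) dual.\<close>

definition dual_space :: "('a::complex_banach \<Rightarrow>\<^sub>L complex) set" where
  "dual_space = {f. \<forall>c x. blinfun_apply f (c *\<^sub>C x) = c * blinfun_apply f x}"

definition reflexive_space :: "'a::complex_banach itself \<Rightarrow> bool" where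
  "reflexive_space _ \<longleftrightarrow>
     (\<forall>\<psi> :: ('a \<Rightarrow>\<^sub>L complex) \<Rightarrow> complex.
        (\<forall>f\<in>dual_space. \<forall>g\<in>dual_space. \<psi> (f + g) = \<psi> f + \<psi> g) \<and>
        (\<forall>f\<in>dual_space. \<forall>g\<in>dual_space. \<forall>c.
            (\<forall>x. blinfun_apply g x = c * blinfun_apply f x) \<longrightarrow> \<psi> g = c * \<psi> f) \<and>
        (\<exists>K. \<forall>f\<in>dual_space. cmod (\<psi> f) \<le> K * norm f)
        \<longrightarrow> (\<exists>x. \<forall>f\<in>dual_space. \<psi> f = blinfun_apply f x))"

text \<open>An operator is a function \<open>A\<close> together with its domain \<open>D\<close>; values of \<open>A\<close> outside
  \<open>D\<close> are never used.\<close>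

definition closed_dense_operator :: "('a::complex_banach \<Rightarrow> 'a) \<Rightarrow> 'a set \<Rightarrow> bool" where
  "closed_dense_operator A D \<longleftrightarrow>
     0 \<in> D \<and> (\<forall>x\<in>D. \<forall>y\<in>D. x + y \<in> D \<and> A (x + y) = A x + A y) \<and>
     (\<forall>c. \<forall>x\<in>D. c *\<^sub>C x \<in> D \<and> A (c *\<^sub>C x) = c *\<^sub>C A x) \<and>
     closed ((\<lambda>x. (x, A x)) ` D) \<and> closure D = UNIV"

definition shift_op :: "('a::complex_banach \<Rightarrow> 'a) \<Rightarrow> complex \<Rightarrow> 'a \<Rightarrow> 'a" where
  "shift_op A l x = A x - l *\<^sub>C x"

definition op_spectrum :: "('a::complex_banach \<Rightarrow> 'a) \<Rightarrow> 'a set \<Rightarrow> complex set" where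
  "op_spectrum A D = {l. \<not> (\<exists>R. bounded_linear R \<and>
      (\<forall>y. R y \<in> D \<and> shift_op A l (R y) = y) \<and> (\<forall>x\<in>D. R (shift_op A l x) = x))}"

section \<open>Exponential vectors and the functional calculus\<close>

definition pow_domain :: "('a::complex_banach \<Rightarrow> 'a) \<Rightarrow> 'a set \<Rightarrow> complex \<Rightarrow> nat \<Rightarrow> 'a set" where
  "pow_domain A D l k = {x. \<forall>i<k. (shift_op A l ^^ i) x \<in> D}"

definition X_mu :: "('a::complex_banach \<Rightarrow> 'a) \<Rightarrow> 'a set \<Rightarrow> complex \<Rightarrow> real \<Rightarrow> 'a set" where
  "X_mu A D l \<mu> = {x. (\<forall>k\<ge>1. x \<in> pow_domain A D l k) \<and>
      (\<exists>C>0. \<forall>k\<ge>1. norm ((shift_op A l ^^ k) x) \<le> C * \<mu> ^ k * norm x)}"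

text \<open>The norm of \<open>X_mu A D l \<mu>\<close>. On this space the constant \<open>C\<close> above depends on the vector, and
  the norm of the ambient space alone does not control the powers of the operator.\<close>

definition exp_norm :: "('a::complex_banach \<Rightarrow> 'a) \<Rightarrow> complex \<Rightarrow> real \<Rightarrow> 'a \<Rightarrow> real" where
  "exp_norm A l \<mu> x = (SUP k. norm ((shift_op A l ^^ k) x) / \<mu> ^ k)"

definition X_r :: "('a::complex_banach \<Rightarrow> 'a) \<Rightarrow> 'a set \<Rightarrow> complex \<Rightarrow> real \<Rightarrow> 'a set" where
  "X_r A D l r = (\<Union>\<mu>\<in>{0<..<r}. X_mu A D l \<mu>)"

text \<open>Extended-real valued, so that the distance to an empty boundary is infinite.\<close>

definition bdist :: "complex set \<Rightarrow> complex \<Rightarrow> ereal" where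
  "bdist G l = (INF z\<in>frontier G. ereal (dist l z))"

definition decomposition ::
  "('a::complex_banach \<Rightarrow> 'a) \<Rightarrow> 'a set \<Rightarrow> complex set \<Rightarrow> 'a \<Rightarrow> complex set \<Rightarrow> (complex \<Rightarrow> 'a) \<Rightarrow> bool"
where
  "decomposition A D G u \<Lambda> c \<longleftrightarrow> finite \<Lambda> \<and> \<Lambda> \<subseteq> G \<and>
     (\<forall>l\<in>\<Lambda>. \<exists>r. ereal r < bdist G l \<and> c l \<in> X_r A D l r) \<and> u = (\<Sum>l\<in>\<Lambda>. c l)"

definition X_AG :: "('a::complex_banach \<Rightarrow> 'a) \<Rightarrow> 'a set \<Rightarrow> complex set \<Rightarrow> 'a set" where
  "X_AG A D G = {u. \<exists>\<Lambda> c. decomposition A D G u \<Lambda> c}"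

definition op_fun_rel ::
  "('a::complex_banach \<Rightarrow> 'a) \<Rightarrow> 'a set \<Rightarrow> complex set \<Rightarrow> (complex \<Rightarrow> complex) \<Rightarrow> 'a \<Rightarrow> 'a \<Rightarrow> bool"
where
  "op_fun_rel A D G f u v \<longleftrightarrow> (\<exists>\<Lambda> c. decomposition A D G u \<Lambda> c \<and>
     v = (\<Sum>l\<in>\<Lambda>. \<Sum>n. ((deriv ^^ n) f l / fact n) *\<^sub>C (shift_op A l ^^ n) (c l)))"

text \<open>The value of \<open>f(A)u\<close> has to be independent of the chosen decomposition of \<open>u\<close>. This can fail
  when \<open>G\<close> has holes: for the backward shift on the square-summable sequences, an annulus \<open>G\<close> around
  \<open>0\<close> inside the unit disc and \<open>f(z) = 1/z\<close>, integrate the eigenvectors \<open>(1, z, z\<^sup>2, \<dots>)\<close> over short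
  arcs making up a circle in \<open>G\<close>; the arcs sum to \<open>0\<close>, their images under \<open>f(A)\<close> do not.\<close>

definition calculus_well_defined ::
  "('a::complex_banach \<Rightarrow> 'a) \<Rightarrow> 'a set \<Rightarrow> complex set \<Rightarrow> bool"
where
  "calculus_well_defined A D G \<longleftrightarrow>
     (\<forall>f u v w. f holomorphic_on G \<longrightarrow> op_fun_rel A D G f u v \<longrightarrow> op_fun_rel A D G f u w \<longrightarrow> v = w)"

definition op_fun ::
  "('a::complex_banach \<Rightarrow> 'a) \<Rightarrow> 'a set \<Rightarrow> complex set \<Rightarrow> (complex \<Rightarrow> complex) \<Rightarrow> 'a \<Rightarrow> 'a"
where
  "op_fun A D G f u = (THE v. op_fun_rel A D G f u v)"

text \<open>Functions on \<open>(0, \<infinity>)\<close> that are continuous into \<open>X_AG A D G\<close> and integrable at \<open>0\<close>. Continuity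
  for the inductive limit topology is taken stepwise: on each \<open>(0, T]\<close> the function is a finite sum
  of norm-continuous functions into spaces \<open>X_mu A D l (\<mu> l)\<close>.\<close>

definition XAG_L1_continuous ::
  "('a::complex_banach \<Rightarrow> 'a) \<Rightarrow> 'a set \<Rightarrow> complex set \<Rightarrow> (real \<Rightarrow> 'a) \<Rightarrow> bool"
where
  "XAG_L1_continuous A D G f \<longleftrightarrow> (\<forall>T>0. \<exists>\<Lambda> \<mu> c. finite \<Lambda> \<and> \<Lambda> \<subseteq> G \<and>
     (\<forall>t\<in>{0<..T}. f t = (\<Sum>l\<in>\<Lambda>. c l t)) \<and>
     (\<forall>l\<in>\<Lambda>. 0 < \<mu> l \<and> ereal (\<mu> l) < bdist G l \<and>
        (\<forall>t\<in>{0<..T}. c l t \<in> X_mu A D l (\<mu> l)) \<and>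
        (\<forall>s\<in>{0<..T}. ((\<lambda>t. exp_norm A l (\<mu> l) (c l t - c l s)) \<longlongrightarrow> 0) (at s within {0<..T})) \<and>
        (\<lambda>t. exp_norm A l (\<mu> l) (c l t)) integrable_on {0<..T}))"

section \<open>Fractional derivatives and the Cauchy problem\<close>

definition frac_kernel_integral :: "real \<Rightarrow> (real \<Rightarrow> 'a::banach) \<Rightarrow> real \<Rightarrow> 'a" where
  "frac_kernel_integral b f t =
     (1 / Gamma (1 - b)) *\<^sub>R integral {0..t} (\<lambda>\<tau>. (1 / (t - \<tau>) powr b) *\<^sub>R f \<tau>)"

definition RL_deriv :: "real \<Rightarrow> (real \<Rightarrow> 'a::banach) \<Rightarrow> real \<Rightarrow> 'a" where
  "RL_deriv b f t =
     (if b = 0 then f t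
      else if b = 1 then vector_derivative f (at t)
      else vector_derivative (frac_kernel_integral b f) (at t))"

definition caputo_deriv :: "real \<Rightarrow> (real \<Rightarrow> 'a::banach) \<Rightarrow> real \<Rightarrow> 'a" where
  "caputo_deriv b f t =
     (if b = 0 then f t
      else if b = 1 then vector_derivative f (at t)
      else frac_kernel_integral b (\<lambda>\<tau>. vector_derivative f (at \<tau>)) t)"

text \<open>Vectors with \<open>m\<close> components are functions on \<open>nat\<close> whose indices \<open>\<ge> m\<close> are ignored.\<close>

definition admissible_source ::
  "('a::complex_banach \<Rightarrow> 'a) \<Rightarrow> 'a set \<Rightarrow> complex set \<Rightarrow> nat \<Rightarrow> (nat \<Rightarrow> real) \<Rightarrow> (real \<Rightarrow> nat \<Rightarrow> 'a) \<Rightarrow> bool"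
where
  "admissible_source A D G m \<beta> H \<longleftrightarrow> (\<forall>j<m.
     (\<forall>t\<ge>0. H t j \<in> X_AG A D G) \<and> continuous_on {0..} (\<lambda>t. H t j) \<and>
     (\<beta> j < 1 \<longrightarrow> (\<forall>t>0. frac_kernel_integral (1 - \<beta> j) (\<lambda>s. H s j) differentiable (at t))) \<and>
     XAG_L1_continuous A D G (RL_deriv (1 - \<beta> j) (\<lambda>s. H s j)))"

definition is_solution ::
  "('a::complex_banach \<Rightarrow> 'a) \<Rightarrow> 'a set \<Rightarrow> complex set \<Rightarrow> nat \<Rightarrow> (nat \<Rightarrow> real) \<Rightarrow> (complex \<Rightarrow> complex mat)
    \<Rightarrow> (real \<Rightarrow> nat \<Rightarrow> 'a) \<Rightarrow> (nat \<Rightarrow> 'a) \<Rightarrow> (real \<Rightarrow> nat \<Rightarrow> 'a) \<Rightarrow> bool"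
where
  "is_solution A D G m \<beta> F H \<Phi> U \<longleftrightarrow> (\<forall>j<m.
     (\<forall>t\<ge>0. U t j \<in> X_AG A D G) \<and> continuous_on {0..} (\<lambda>t. U t j) \<and>
     (\<forall>t>0. (\<lambda>s. U s j) differentiable (at t)) \<and>
     XAG_L1_continuous A D G (\<lambda>t. vector_derivative (\<lambda>s. U s j) (at t)) \<and>
     U 0 j = \<Phi> j \<and>
     (\<forall>t>0. caputo_deriv (\<beta> j) (\<lambda>s. U s j) t =
        (\<Sum>k<m. op_fun A D G (\<lambda>z. F z $$ (j, k)) (U t k)) + H t j))"

definition duhamel_integrand ::
  "('a::complex_banach \<Rightarrow> 'a) \<Rightarrow> 'a set \<Rightarrow> complex set \<Rightarrow> nat \<Rightarrow> (nat \<Rightarrow> real)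
    \<Rightarrow> (real \<Rightarrow> complex \<Rightarrow> complex mat) \<Rightarrow> (real \<Rightarrow> nat \<Rightarrow> 'a) \<Rightarrow> real \<Rightarrow> nat \<Rightarrow> real \<Rightarrow> 'a"
where
  "duhamel_integrand A D G m \<beta> S H t j \<tau> =
     (\<Sum>k<m. op_fun A D G (\<lambda>z. S (t - \<tau>) z $$ (j, k)) (RL_deriv (1 - \<beta> k) (\<lambda>s. H s k) \<tau>))"

text \<open>The symbol \<open>S\<close> is analytic, so that \<open>S(t,A)\<close> makes sense, the Duhamel integral exists, and the
  Cauchy problem has exactly one solution, the one given by the representation formula.\<close>

definition solution_represented_by ::
  "('a::complex_banach \<Rightarrow> 'a) \<Rightarrow> 'a set \<Rightarrow> complex set \<Rightarrow> nat \<Rightarrow> (nat \<Rightarrow> real) \<Rightarrow> (complex \<Rightarrow> complex mat)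
    \<Rightarrow> (real \<Rightarrow> nat \<Rightarrow> 'a) \<Rightarrow> (nat \<Rightarrow> 'a) \<Rightarrow> (real \<Rightarrow> complex \<Rightarrow> complex mat) \<Rightarrow> bool"
where
  "solution_represented_by A D G m \<beta> F H \<Phi> S \<longleftrightarrow>
     (\<forall>t>0. \<forall>j<m. \<forall>k<m. (\<lambda>z. S t z $$ (j, k)) holomorphic_on G) \<and>
     (\<forall>t>0. \<forall>j<m. duhamel_integrand A D G m \<beta> S H t j integrable_on {0..t}) \<and>
     (\<forall>U. is_solution A D G m \<beta> F H \<Phi> U \<longleftrightarrow>
        (\<forall>j<m. U 0 j = \<Phi> j \<and>
          (\<forall>t>0. U t j = (\<Sum>k<m. op_fun A D G (\<lambda>z. S t z $$ (j, k)) (\<Phi> k)) +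
             integral {0..t} (duhamel_integrand A D G m \<beta> S H t j))))"

section \<open>Symbols\<close>

definition mittag_leffler :: "real \<Rightarrow> real \<Rightarrow> complex \<Rightarrow> complex" where
  "mittag_leffler b \<nu> z = (\<Sum>n. z ^ n / complex_of_real (Gamma (b * real n + \<nu>)))"

definition pencil :: "nat \<Rightarrow> (nat \<Rightarrow> real) \<Rightarrow> (complex \<Rightarrow> complex mat) \<Rightarrow> real \<Rightarrow> complex \<Rightarrow> complex mat" where
  "pencil m \<beta> F s z = Matrix.mat m m (\<lambda>(i, j).
     (if i = j then complex_of_real (s powr \<beta> i) else 0) - F z $$ (i, j))"

definition Q0 :: "nat \<Rightarrow> (nat \<Rightarrow> real) \<Rightarrow> (complex \<Rightarrow> complex mat) \<Rightarrow> complex set" where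
  "Q0 m \<beta> F = {z. \<forall>s>0. Determinant.det (pencil m \<beta> F s z) = 0}"

definition ml_matrix :: "nat \<Rightarrow> real \<Rightarrow> (complex \<Rightarrow> complex mat) \<Rightarrow> real \<Rightarrow> complex \<Rightarrow> complex mat" where
  "ml_matrix m b F t z = Matrix.mat m m (\<lambda>(i, j).
     \<Sum>n. complex_of_real (t powr (real n * b) / Gamma (real n * b + 1)) * (F z ^\<^sub>m n) $$ (i, j))"

definition ml_block :: "real \<Rightarrow> real \<Rightarrow> nat \<Rightarrow> complex \<Rightarrow> complex mat" where
  "ml_block b t d a = Matrix.mat d d (\<lambda>(i, j).
     if i \<le> j then complex_of_real (t powr (real (j - i) * b)) / fact (j - i) *
       (deriv ^^ (j - i)) (mittag_leffler b 1) (a * complex_of_real (t powr b))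
     else 0)"

definition ml_jordan_matrix :: "real \<Rightarrow> real \<Rightarrow> (nat \<times> complex) list \<Rightarrow> complex mat" where
  "ml_jordan_matrix b t bs = diag_block_mat (map (\<lambda>(d, a). ml_block b t d a) bs)"

definition cramer_matrix ::
  "nat \<Rightarrow> (nat \<Rightarrow> real) \<Rightarrow> (complex \<Rightarrow> complex mat) \<Rightarrow> (nat \<Rightarrow> complex) \<Rightarrow> nat \<Rightarrow> real \<Rightarrow> complex \<Rightarrow> complex mat"
where
  "cramer_matrix m \<beta> F \<phi> j s z = Matrix.mat m m (\<lambda>(i, k).
     if k = j then complex_of_real (s powr (\<beta> i - 1)) * \<phi> i else pencil m \<beta> F s z $$ (i, k))"

definition P_N0 :: "nat \<Rightarrow> (nat \<Rightarrow> nat) \<Rightarrow> (complex \<Rightarrow> complex mat) \<Rightarrow> complex \<Rightarrow> complex poly" where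
  "P_N0 m n F z = Determinant.det (Matrix.mat m m (\<lambda>(i, j).
     (if i = j then monom 1 (n i) else 0) - [:F z $$ (i, j):]))"

definition partial_fraction_symbol ::
  "nat \<Rightarrow> (nat \<Rightarrow> real) \<Rightarrow> nat \<Rightarrow> nat \<Rightarrow> (nat \<Rightarrow> complex \<Rightarrow> complex) \<Rightarrow> (nat \<Rightarrow> nat)
    \<Rightarrow> (nat \<Rightarrow> nat \<Rightarrow> nat \<Rightarrow> nat \<Rightarrow> complex \<Rightarrow> complex) \<Rightarrow> real \<Rightarrow> complex \<Rightarrow> complex mat"
where
  "partial_fraction_symbol m \<beta> p Lh lamh mu C t z = Matrix.mat m m (\<lambda>(j, k).
     \<Sum>l<Lh. \<Sum>\<nu>=1..mu l.
       C j k l \<nu> z * complex_of_real (t powr (real \<nu> / real p - \<beta> k)) / fact (\<nu> - 1) *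
       (deriv ^^ (\<nu> - 1)) (mittag_leffler (1 / real p) (1 / real p - \<beta> k + 1))
         (complex_of_real (t powr (1 / real p)) * lamh l z))"

end

theory Submission
  imports Defs
begin

text \<open>Write the orders as \<open>\<beta> j = n j * h\<close>. In both cases the symbol is the power series in \<open>t powr h\<close>
  obtained by Picard iteration of \<open>s = I + J\<^bsup>\<B>\<^esup> F s\<close>, where \<open>J\<close> is the fractional integral: for equal orders
  this is the Mittag-Leffler series, and for rational orders the coefficients are read off from the
  expansion at infinity of the partial fractions of \<open>(diag(x ^ n j) - F)\<^sup>-\<^sup>1\<close>.

  A vector \<open>x\<close> of exponential type at \<open>l\<close> is replaced by the bounded sequence \<open>(A - l)\<^sup>k x / \<mu>\<^sup>k\<close>, on which the
  functional calculus acts by bounded operators, multiplicatively in the symbol. Hence the series of operators applied to the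
  data converges in norm and can be integrated term by term; it solves the Cauchy problem by the semigroup law of
  fractional integrals. Conversely, the difference of two solutions is reproduced by every power of
  the Volterra operator \<open>J\<^bsup>\<B>\<^esup> F(A)\<close>, although its decomposition into exponential vectors is not unique;
  these powers tend to \<open>0\<close>.\<close>

text \<open>The derivative of a solution may blow up at 0 like
  \<open>t powr (\<beta> j - 1)\<close>, so functions of time are taken from the class
  \<open>L1c\<close>: continuous for positive times, with norm integrable up to 0. The unknown is
  therefore built through its derivative \<open>v\<close>, with \<open>W = \<phi> + J v\<close>; the
  index shift in the recursion then gives the differential equation for order 1 and the Caputo
  equation otherwise. Integrals are gauge integrals of Banach-space-valued functions. The law
  \<open>J^a J^b = J^(a+b)\<close> is reached without Fubini: it is the Beta integral on
  polynomials, passes to continuous functions by uniform approximation, and to \<open>L1c\<close> by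
  cutting off near 0. The sequences make \<open>f(A)\<close> bounded because the radius \<mu> is
  strictly below the distance from \<open>l\<close> to the boundary of \<open>G\<close>: by Cauchy's
  inequality the Taylor coefficients of a symbol at \<open>l\<close>, weighted by
  \<open>\<mu>^i\<close>, are absolutely summable. Finitely many data on one time interval can be
  put over common points and radii, so the problem splits into one bounded system per point
  \<open>l\<close>.\<close>

section \<open>Integrability from continuity off the endpoints and an integrable norm\<close>

text \<open>The integral comes from the fundamental theorem of calculus. Increments of the tail
  integral \<open>F\<close> are bounded by those of the indefinite integral \<open>N\<close> of the
  norm, so \<open>F\<close> is uniformly continuous and extends to \<open>a\<close>; the extension
  is a primitive of \<open>- f\<close> in the interior.\<close>

lemma integrable_continuous_norm_left:
  fixes f :: "real \<Rightarrow> 'b::banach"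
  assumes cont: "continuous_on {a<..b} f" and int: "(\<lambda>x. norm (f x)) integrable_on {a..b}"
  shows "f integrable_on {a..b}"
proof (cases "a < b")
  case True
  define N where "N x = integral {a..x} (\<lambda>x. norm (f x))" for x
  define F where "F x = integral {x..b} f" for x
  have contI: "continuous_on {x..y} f" if "a < x" "y \<le> b" for x y
    using cont by (rule continuous_on_subset) (use that in auto)
  have fint: "f integrable_on {x..y}" if "a < x" "y \<le> b" for x y
    using contI[OF that] integrable_continuous_real by blast
  have nint: "(\<lambda>x. norm (f x)) integrable_on {x..y}" if "a \<le> x" "y \<le> b" for x y
    using int by (rule integrable_on_subinterval) (use that in auto)
  have diff: "norm (F x - F y) \<le> N y - N x" if "a < x" "x \<le> y" "y \<le> b" for x y
  proof -
    have "F x = integral {x..y} f + F y"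
      unfolding F_def by (rule Henstock_Kurzweil_Integration.integral_combine[symmetric])
        (use that fint in auto)
    moreover have "N y = N x + integral {x..y} (\<lambda>x. norm (f x))"
      unfolding N_def by (rule Henstock_Kurzweil_Integration.integral_combine[symmetric])
        (use that nint in auto)
    moreover have "norm (integral {x..y} f) \<le> integral {x..y} (\<lambda>x. norm (f x))"
      by (rule integral_norm_bound_integral) (use that fint nint in auto)
    ultimately show ?thesis by simp
  qed
  have diff': "dist (F x) (F y) \<le> dist (N x) (N y)" if "x \<in> {a<..b}" "y \<in> {a<..b}" for x y
  proof (cases "x \<le> y")
    case True
    then show ?thesis using diff[of x y] that by (simp add: dist_norm)
  next
    case False
    then show ?thesis using diff[of y x] that by (simp add: dist_norm norm_minus_commute)
  qed
  have "continuous_on {a..b} N"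
    unfolding N_def by (rule indefinite_integral_continuous_1[OF int])
  then have N: "uniformly_continuous_on {a..b} N"
    by (rule compact_uniformly_continuous) simp
  have "uniformly_continuous_on {a<..b} F"
    unfolding uniformly_continuous_on_def
  proof (intro allI impI)
    fix e :: real assume "e > 0"
    then obtain d where d: "d > 0"
      "\<And>x y. x \<in> {a..b} \<Longrightarrow> y \<in> {a..b} \<Longrightarrow> dist y x < d \<Longrightarrow> dist (N y) (N x) < e"
      using uniformly_continuous_onE[OF N \<open>e > 0\<close>] by blast
    have "dist (F y) (F x) < e" if "x \<in> {a<..b}" "y \<in> {a<..b}" "dist y x < d" for x y
      using diff'[OF that(2,1)] d(2)[of x y] that by auto
    then show "\<exists>d>0. \<forall>x\<in>{a<..b}. \<forall>x'\<in>{a<..b}. dist x' x < d \<longrightarrow> dist (F x') (F x) < e"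
      using d(1) by blast
  qed
  then obtain g where g: "uniformly_continuous_on (closure {a<..b}) g"
      "\<And>x. x \<in> {a<..b} \<Longrightarrow> F x = g x"
    using uniformly_continuous_on_extension_on_closure[of "{a<..b}" F] by metis
  have gc: "continuous_on {a..b} g"
    using uniformly_continuous_imp_continuous[OF g(1)] True by simp
  have der: "(g has_vector_derivative - f x) (at x)" if "x \<in> {a<..<b}" for x
  proof -
    define c where "c = (a + x) / 2"
    have c: "a < c" "c < x" using that by (auto simp: c_def)
    have "((\<lambda>u. integral {u..b} f) has_vector_derivative - f x) (at x within {c..b})"
      by (rule integral_has_vector_derivative') (use contI[of c b] c that in auto)
    then have "(F has_vector_derivative - f x) (at x within {c<..<b})"
      unfolding F_def[abs_def] by (rule has_vector_derivative_within_subset) auto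
    then have "(F has_vector_derivative - f x) (at x)"
      using c that by (subst (asm) at_within_open) auto
    then show ?thesis
      by (rule has_vector_derivative_transform_within_open[where S="{c<..<b}"])
        (use c that g(2) in auto)
  qed
  have "((\<lambda>x. - f x) has_integral (g b - g a)) {a..b}"
    by (rule fundamental_theorem_of_calculus_interior) (use True gc der in auto)
  then show ?thesis
    using has_integral_neg[of "\<lambda>x. - f x"] by (auto simp: integrable_on_def)
next
  case False
  then consider "b < a" | "a = b" by linarith
  then show ?thesis
    by cases (use integrable_on_refl[of f a] in auto)
qed

text \<open>The interval is cut at its midpoint; the right half becomes the previous situation under
  the reflection \<open>x \<mapsto> - x\<close>.\<close>

lemma integrable_continuous_norm:
  fixes f :: "real \<Rightarrow> 'b::banach"
  assumes cont: "continuous_on {a<..<b} f" and int: "(\<lambda>x. norm (f x)) integrable_on {a..b}"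
  shows "f integrable_on {a..b}"
proof (cases "a < b")
  case True
  define c where "c = (a + b) / 2"
  have c: "a < c" "c < b" using True by (auto simp: c_def)
  have nint: "(\<lambda>x. norm (f x)) integrable_on {x..y}" if "a \<le> x" "y \<le> b" for x y
    using int by (rule integrable_on_subinterval) (use that in auto)
  have 1: "f integrable_on {a..c}"
    by (rule integrable_continuous_norm_left)
      (use c nint in \<open>auto intro: continuous_on_subset[OF cont]\<close>)
  have "continuous_on {-b<..-c} (\<lambda>x. f (- x))"
    by (rule continuous_on_compose2[OF cont]) (use c in \<open>auto intro!: continuous_intros\<close>)
  moreover have "(\<lambda>x. norm (f (-x))) integrable_on {-b..-c}"
    by (rule has_integral_integrable[OF has_integral_reflect_lemma_real[OF integrable_integral]])
      (rule nint, use c in auto)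
  ultimately have "(\<lambda>x. f (-x)) integrable_on {-b..-c}"
    by (rule integrable_continuous_norm_left)
  then have "(\<lambda>x. f (- (-x))) integrable_on {- (-c)..- (-b)}"
    by (rule has_integral_integrable[OF has_integral_reflect_lemma_real[OF integrable_integral]])
  then have 2: "f integrable_on {c..b}" by simp
  show ?thesis
    by (rule Henstock_Kurzweil_Integration.integrable_combine[OF _ _ 1 2]) (use c in auto)
next
  case False
  then consider "b < a" | "a = b" by linarith
  then show ?thesis
    by cases (use integrable_on_refl[of f a] in auto)
qed

text \<open>Continuity makes the norm of \<open>f\<close> measurable, so real comparison yields its
  integrability; the previous lemma then transfers this to \<open>f\<close> itself, for which no
  domination theorem is invoked.\<close>

lemma integral_dominated:
  fixes f :: "real \<Rightarrow> 'b::banach"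
  assumes cont: "continuous_on {a<..<b} f" and int: "\<phi> integrable_on {a..b}"
    and le: "\<And>x. x \<in> {a<..<b} \<Longrightarrow> norm (f x) \<le> \<phi> x"
  shows "f integrable_on {a..b}" "norm (integral {a..b} f) \<le> integral {a..b} \<phi>"
    "(\<lambda>x. norm (f x)) integrable_on {a..b}"
proof -
  have intO: "\<phi> integrable_on {a<..<b}"
    using int by (simp add: integrable_on_Icc_iff_Ioo)
  have "(\<lambda>x. norm (f x)) \<in> borel_measurable (lebesgue_on {a<..<b})"
    by (intro continuous_imp_measurable_on_sets_lebesgue continuous_on_norm cont) auto
  then have "(\<lambda>x. norm (f x)) integrable_on {a<..<b}"
    by (rule measurable_bounded_by_integrable_imp_integrable_real) (use le intO in auto)
  then show n: "(\<lambda>x. norm (f x)) integrable_on {a..b}"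
    by (simp add: integrable_on_Icc_iff_Ioo)
  show f: "f integrable_on {a..b}"
    by (rule integrable_continuous_norm[OF cont n])
  have "norm (integral {a<..<b} f) \<le> integral {a<..<b} \<phi>"
    by (rule integral_norm_bound_integral) (use f intO le in \<open>auto simp: integrable_on_Icc_iff_Ioo\<close>)
  then show "norm (integral {a..b} f) \<le> integral {a..b} \<phi>"
    by (simp add: integral_open_interval_real)
qed


section \<open>Fractional integrals of vector-valued functions\<close>

text \<open>The Riemann-Liouville kernel, so \<open>fint a\<close> is the fractional integral of
  order \<open>a\<close>. Since \<open>0 powr x = 0\<close>, also \<open>kern 1 0 = 0\<close>,
  although \<open>kern 1\<close> is 1 at positive times; this is why endpoints are repeatedly
  discarded below.\<close>

definition kern :: "real \<Rightarrow> real \<Rightarrow> real" where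
  "kern a t = t powr (a - 1) / Gamma a"

definition fint :: "real \<Rightarrow> (real \<Rightarrow> 'b::banach) \<Rightarrow> real \<Rightarrow> 'b" where
  "fint a f t = integral {0..t} (\<lambda>\<tau>. kern a (t - \<tau>) *\<^sub>R f \<tau>)"

text \<open>Nothing is required of the value at 0. The class is stable under bounded operators and
  under fractional integration, and contains the singular kernels.\<close>

definition L1c :: "real \<Rightarrow> (real \<Rightarrow> 'b::banach) \<Rightarrow> bool" where
  "L1c T f \<longleftrightarrow> continuous_on {0<..T} f \<and> (\<lambda>t. norm (f t)) integrable_on {0..T}"

lemma kern_nonneg: "0 < a \<Longrightarrow> 0 \<le> kern a t"
  by (simp add: kern_def Gamma_real_nonneg)

lemma kern_0 [simp]: "kern a 0 = 0"
  by (simp add: kern_def)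

lemma kern_1: "0 < t \<Longrightarrow> kern 1 t = 1"
  by (simp add: kern_def)

lemma continuous_on_kern: "continuous_on {0<..} (kern a)"
  unfolding kern_def divide_inverse by (intro continuous_intros) auto

text \<open>Euler's Beta integral rescaled from \<open>{0..1}\<close> to \<open>{0..t}\<close>; the
  quotient of Gamma values in \<open>Beta c a\<close> normalises the result. This is the semigroup
  law at the level of kernels.\<close>

lemma has_integral_kern_kern:
  assumes "0 < a" "0 < c" "0 < t"
  shows "((\<lambda>\<tau>. kern a (t - \<tau>) * kern c \<tau>) has_integral kern (a + c) t) {0..t}"
proof -
  have "((\<lambda>x. (1/t * x) powr (c - 1) * (1 - 1/t * x) powr (a - 1)) has_integral
      (1 / \<bar>1/t\<bar>) *\<^sub>R Beta c a) ((\<lambda>x. x / (1/t)) ` {0..1})"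
    by (rule has_integral_stretch_real[OF has_integral_Beta_real]) (use assms in auto)
  moreover have "(\<lambda>x. x / (1/t)) ` {0..1} = {0..t}"
    using assms by (auto simp: image_iff field_simps intro!: bexI[of _ "_ / t"])
  ultimately have "((\<lambda>x. (1/t * x) powr (c - 1) * (1 - 1/t * x) powr (a - 1)) has_integral
      t * Beta c a) {0..t}"
    using assms by simp
  then have int: "((\<lambda>x. t powr (a + c - 2) / (Gamma a * Gamma c) *
      ((1/t * x) powr (c - 1) * (1 - 1/t * x) powr (a - 1))) has_integral
      t powr (a + c - 2) / (Gamma a * Gamma c) * (t * Beta c a)) {0..t}"
    by (rule has_integral_mult_right)
  have val: "t powr (a + c - 2) / (Gamma a * Gamma c) * (t * Beta c a) = kern (a + c) t"
  proof -
    have "t powr (a + c - 2) * t = t powr (a + c - 1)"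
      using assms powr_add[of t "a + c - 2" 1] by simp
    moreover have "Gamma a \<noteq> 0" "Gamma c \<noteq> 0"
      using Gamma_real_pos[of a] Gamma_real_pos[of c] assms(1,2) by linarith+
    ultimately show ?thesis
      by (simp add: Beta_def kern_def add.commute mult.commute)
  qed
  have eq: "t powr (a + c - 2) / (Gamma a * Gamma c) *
      ((1/t * x) powr (c - 1) * (1 - 1/t * x) powr (a - 1)) = kern a (t - x) * kern c x"
    if "x \<in> {0..t}" for x
  proof -
    have "1 - 1/t * x = (t - x) / t" using assms by (simp add: field_simps)
    then have *: "(1 - 1/t * x) powr (a - 1) = (t - x) powr (a - 1) / t powr (a - 1)"
      using that assms by (simp add: powr_divide)
    have **: "(1/t * x) powr (c - 1) = x powr (c - 1) / t powr (c - 1)"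
      using that assms by (simp add: powr_divide)
    have "t powr (a + c - 2) = t powr (a - 1) * t powr (c - 1)"
      using powr_add[of t "a - 1" "c - 1"] by (simp add: algebra_simps)
    moreover have "t powr (a - 1) \<noteq> 0" "t powr (c - 1) \<noteq> 0" using assms by auto
    moreover have "p * q / (g * g') * (u / q * (v / p)) = v / g * (u / g')"
      if "p \<noteq> 0" "q \<noteq> 0" for p q g g' u v :: real
      using that by simp
    ultimately show ?thesis
      unfolding * ** kern_def by presburger
  qed
  show ?thesis
    using has_integral_eq[OF eq int] unfolding val by simp
qed

lemma has_integral_kern:
  assumes "0 < a" "0 \<le> t"
  shows "((\<lambda>\<tau>. kern a (t - \<tau>)) has_integral kern (a + 1) t) {0..t}"
proof (cases "t = 0")
  case False
  then have "((\<lambda>\<tau>. kern a (t - \<tau>) * kern 1 \<tau>) has_integral kern (a + 1) t) {0..t}"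
    using has_integral_kern_kern[of a 1 t] assms by simp
  then show ?thesis
    by (rule has_integral_spike_finite[of "{0}", rotated 2]) (auto simp: kern_1)
qed (use assms has_integral_refl(2)[of "\<lambda>\<tau>. kern a (0 - \<tau>)" 0] in auto)

lemma L1c_subset: "L1c T f \<Longrightarrow> T' \<le> T \<Longrightarrow> L1c T' f"
  unfolding L1c_def
  by (auto intro: continuous_on_subset integrable_on_subinterval)

lemma L1cI:
  assumes "continuous_on {0<..T} f" "\<phi> integrable_on {0..T}"
    and "\<And>t. 0 < t \<Longrightarrow> t < T \<Longrightarrow> norm (f t) \<le> \<phi> t"
  shows "L1c T f"
  unfolding L1c_def
  using assms by (auto intro!: integral_dominated(3)[of 0 T f \<phi>] intro: continuous_on_subset)

lemma L1c_integrable: "L1c T f \<Longrightarrow> f integrable_on {0..T}"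
  unfolding L1c_def by (rule integrable_continuous_norm_left) auto

lemma L1c_norm: "L1c T f \<Longrightarrow> L1c T (\<lambda>t. norm (f t))"
  unfolding L1c_def by (auto intro: continuous_on_norm)

lemma L1c_cong:
  assumes "L1c T f" "\<And>t. 0 < t \<Longrightarrow> t \<le> T \<Longrightarrow> f t = g t"
  shows "L1c T g"
proof (rule L1cI)
  show "continuous_on {0<..T} g"
    using assms continuous_on_cong[of "{0<..T}" "{0<..T}" f g] by (auto simp: L1c_def)
  show "(\<lambda>t. norm (f t)) integrable_on {0..T}"
    using assms by (simp add: L1c_def)
qed (use assms in auto)

lemma L1c_0: "L1c T (\<lambda>t. 0)"
  using integrable_const_ivl[of "0::real" 0 T] by (simp add: L1c_def)

lemma L1c_add: "L1c T f \<Longrightarrow> L1c T g \<Longrightarrow> L1c T (\<lambda>t. f t + g t)"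
  by (rule L1cI[where \<phi>="\<lambda>t. norm (f t) + norm (g t)"])
    (auto simp: L1c_def intro!: continuous_intros integrable_add norm_triangle_ineq)

lemma L1c_sum: "(\<And>i. i \<in> I \<Longrightarrow> L1c T (f i)) \<Longrightarrow> L1c T (\<lambda>t. \<Sum>i\<in>I. f i t)"
  by (induction I rule: infinite_finite_induct) (auto simp: L1c_0 intro: L1c_add)

lemma L1c_bounded_linear:
  assumes "bounded_linear B" "L1c T f"
  shows "L1c T (\<lambda>t. B (f t))"
proof -
  obtain K where K: "\<And>x. norm (B x) \<le> norm x * K"
    using bounded_linear.bounded[OF assms(1)] by blast
  show ?thesis
    by (rule L1cI[where \<phi>="\<lambda>t. norm (f t) * K"])
      (use assms K in \<open>auto simp: L1c_def intro!: integrable_on_mult_left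
        bounded_linear.continuous_on[OF assms(1)]\<close>)
qed

lemma L1c_scaleR: "L1c T f \<Longrightarrow> L1c T (\<lambda>t. r *\<^sub>R f t)"
  by (rule L1c_bounded_linear[OF bounded_linear_scaleR_right])

lemma L1c_diff: "L1c T f \<Longrightarrow> L1c T g \<Longrightarrow> L1c T (\<lambda>t. f t - g t)"
  using L1c_add[of T f "\<lambda>t. (-1) *\<^sub>R g t"] L1c_scaleR[of T g "-1"] by simp

lemma L1c_continuous:
  assumes "continuous_on {0..T} f"
  shows "L1c T f"
  unfolding L1c_def
  by (intro conjI integrable_continuous_real continuous_on_norm assms continuous_on_subset[OF assms]) auto

lemma L1c_kern:
  assumes "0 < c"
  shows "L1c T (\<lambda>t. kern c t *\<^sub>R y)"
proof (cases "0 < T")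
  case True
  have "continuous_on {0<..T} (kern c)"
    by (rule continuous_on_subset[OF continuous_on_kern]) auto
  moreover have "kern c integrable_on {0..T}"
  proof -
    \<comment> \<open>The Beta integral with first order 1: the extra factor is 1 except at
      \<open>T\<close>.\<close>
    have "(\<lambda>\<tau>. kern 1 (T - \<tau>) * kern c \<tau>) integrable_on {0..T}"
      using has_integral_kern_kern[of 1 c T] assms True by auto
    then show ?thesis
      by (rule integrable_spike_finite[of "{T}", rotated 2]) (auto simp: kern_1)
  qed
  ultimately show ?thesis
    by (intro L1cI[where \<phi>="\<lambda>t. kern c t * norm y"])
      (auto intro!: continuous_intros integrable_on_mult_left simp: kern_nonneg assms)
next
  case False
  then show ?thesis
    using integrable_on_refl[of "\<lambda>t. norm (kern c t *\<^sub>R y)" 0] 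
    by (cases "T = 0") (auto simp: L1c_def)
qed

text \<open>The two factors are singular at opposite ends, the kernel at \<open>t\<close> and
  \<open>f\<close> at 0. On each half of the interval one of them is bounded and the other
  integrable.\<close>

lemma kern_weight_integrable:
  fixes f :: "real \<Rightarrow> 'b::banach"
  assumes f: "L1c T f" and "0 < a" "0 < t" "t \<le> T"
  shows "(\<lambda>\<tau>. kern a (t - \<tau>) * norm (f \<tau>)) integrable_on {0..t}"
proof -
  have fc: "continuous_on {0<..T} f" and fi: "(\<lambda>t. norm (f t)) integrable_on {0..T}"
    using f by (auto simp: L1c_def)
  have kc: "continuous_on {0..<t} (\<lambda>\<tau>. kern a (t - \<tau>))"
    by (rule continuous_on_compose2[OF continuous_on_kern]) (auto intro!: continuous_intros)
  have c: "continuous_on {0<..<t} (\<lambda>\<tau>. kern a (t - \<tau>) * norm (f \<tau>))"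
    by (intro continuous_intros continuous_on_subset[OF kc] continuous_on_subset[OF fc])
      (use assms in auto)
  have "compact ((\<lambda>\<tau>. kern a (t - \<tau>)) ` {0..t/2})"
    by (intro compact_continuous_image continuous_on_subset[OF kc]) (use assms in auto)
  then obtain C where C: "\<And>\<tau>. \<tau> \<in> {0..t/2} \<Longrightarrow> kern a (t - \<tau>) \<le> C"
    using bounded_imp_bdd_above[OF compact_imp_bounded] unfolding bdd_above_def by (metis imageI)
  have "compact ((\<lambda>\<tau>. norm (f \<tau>)) ` {t/2..t})"
    by (intro compact_continuous_image continuous_on_norm continuous_on_subset[OF fc])
      (use assms in auto)
  then obtain B where B: "\<And>\<tau>. \<tau> \<in> {t/2..t} \<Longrightarrow> norm (f \<tau>) \<le> B"
    using bounded_imp_bdd_above[OF compact_imp_bounded] unfolding bdd_above_def by (metis imageI)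
  have 1: "(\<lambda>\<tau>. kern a (t - \<tau>) * norm (f \<tau>)) integrable_on {0..t/2}"
  proof (rule integral_dominated(1)[where \<phi>="\<lambda>\<tau>. C * norm (f \<tau>)"])
    show "(\<lambda>\<tau>. C * norm (f \<tau>)) integrable_on {0..t/2}"
      by (intro integrable_on_mult_right integrable_on_subinterval[OF fi]) (use assms in auto)
  qed (use C assms in \<open>auto intro!: mult_right_mono continuous_on_subset[OF c] simp: kern_nonneg abs_mult\<close>)
  have 2: "(\<lambda>\<tau>. kern a (t - \<tau>) * norm (f \<tau>)) integrable_on {t/2..t}"
  proof (rule integral_dominated(1)[where \<phi>="\<lambda>\<tau>. kern a (t - \<tau>) * B"])
    have "(\<lambda>\<tau>. kern a (t - \<tau>)) integrable_on {t/2..t}"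
      by (rule integrable_on_subinterval[OF has_integral_integrable[OF has_integral_kern]])
        (use assms in auto)
    then show "(\<lambda>\<tau>. kern a (t - \<tau>) * B) integrable_on {t/2..t}"
      by (rule integrable_on_mult_left)
  qed (use B assms in \<open>auto intro!: mult_left_mono continuous_on_subset[OF c] simp: kern_nonneg abs_mult\<close>)
  show ?thesis
    by (rule Henstock_Kurzweil_Integration.integrable_combine[OF _ _ 1 2]) (use assms in auto)
qed

lemma
  fixes f :: "real \<Rightarrow> 'b::banach"
  assumes f: "L1c T f" and a: "0 < a" "0 < t" "t \<le> T"
  shows fint_integrable: "(\<lambda>\<tau>. kern a (t - \<tau>) *\<^sub>R f \<tau>) integrable_on {0..t}"
    and norm_fint_le: "norm (fint a f t) \<le> fint a (\<lambda>\<tau>. norm (f \<tau>)) t"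
proof -
  have kc: "continuous_on {0..<t} (\<lambda>\<tau>. kern a (t - \<tau>))"
    by (rule continuous_on_compose2[OF continuous_on_kern]) (auto intro!: continuous_intros)
  have fc: "continuous_on {0<..T} f" using f by (simp add: L1c_def)
  have c: "continuous_on {0<..<t} (\<lambda>\<tau>. kern a (t - \<tau>) *\<^sub>R f \<tau>)"
    by (intro continuous_intros continuous_on_subset[OF kc] continuous_on_subset[OF fc])
      (use assms in auto)
  note d = integral_dominated[OF c kern_weight_integrable[OF assms]]
  show "(\<lambda>\<tau>. kern a (t - \<tau>) *\<^sub>R f \<tau>) integrable_on {0..t}"
    by (rule d(1)) (use a in \<open>auto simp: kern_nonneg\<close>)
  show "norm (fint a f t) \<le> fint a (\<lambda>\<tau>. norm (f \<tau>)) t"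
    unfolding fint_def real_scaleR_def by (rule d(2)) (use a in \<open>auto simp: kern_nonneg\<close>)
qed

lemma fint_cong:
  assumes "\<And>\<tau>. 0 < \<tau> \<Longrightarrow> \<tau> < t \<Longrightarrow> f \<tau> = g \<tau>"
  shows "fint a f t = fint a g t"
  unfolding fint_def integral_open_interval_real
  by (rule Henstock_Kurzweil_Integration.integral_cong) (use assms in auto)

lemma fint_at_0 [simp]: "fint a f 0 = 0"
  by (simp add: fint_def)

lemma fint_bounded_linear:
  assumes "bounded_linear B" "L1c T f" "0 < a" "0 < t" "t \<le> T"
  shows "B (fint a f t) = fint a (\<lambda>\<tau>. B (f \<tau>)) t"
  using integral_linear[OF fint_integrable[OF assms(2-5)] assms(1)]
  by (simp add: fint_def o_def linear_scale[OF bounded_linear.linear[OF assms(1)]])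

lemma fint_add:
  assumes "L1c T f" "L1c T g" "0 < a" "0 < t" "t \<le> T"
  shows "fint a (\<lambda>\<tau>. f \<tau> + g \<tau>) t = fint a f t + fint a g t"
  unfolding fint_def scaleR_add_right
  by (intro Henstock_Kurzweil_Integration.integral_add fint_integrable[OF _ assms(3-5)] assms)

lemma fint_diff:
  assumes "L1c T f" "L1c T g" "0 < a" "0 < t" "t \<le> T"
  shows "fint a (\<lambda>\<tau>. f \<tau> - g \<tau>) t = fint a f t - fint a g t"
  unfolding fint_def scaleR_diff_right
  by (intro Henstock_Kurzweil_Integration.integral_diff fint_integrable[OF _ assms(3-5)] assms)

lemma fint_0: "fint a (\<lambda>\<tau>. 0) t = 0"
  by (simp add: fint_def)

lemma fint_sum:
  assumes "\<And>i. i \<in> I \<Longrightarrow> L1c T (f i)" "0 < a" "0 < t" "t \<le> T"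
  shows "fint a (\<lambda>\<tau>. \<Sum>i\<in>I. f i \<tau>) t = (\<Sum>i\<in>I. fint a (f i) t)"
  using assms(1)
  by (induction I rule: infinite_finite_induct)
    (simp_all add: fint_0 fint_add[OF _ _ assms(2-4)] L1c_sum)

lemma fint_mono:
  fixes f g :: "real \<Rightarrow> real"
  assumes "L1c T f" "L1c T g" "0 < a" "0 < t" "t \<le> T" "\<And>\<tau>. 0 < \<tau> \<Longrightarrow> \<tau> < t \<Longrightarrow> f \<tau> \<le> g \<tau>"
  shows "fint a f t \<le> fint a g t"
  unfolding fint_def integral_open_interval_real
  by (rule integral_le)
    (use assms fint_integrable[OF assms(1,3-5)] fint_integrable[OF assms(2-5)] in
      \<open>auto simp: integrable_on_Icc_iff_Ioo[symmetric] kern_nonneg intro!: mult_left_mono\<close>)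

lemma fint_kern:
  assumes "0 < a" "0 < c" "0 < t"
  shows "fint a (\<lambda>\<tau>. kern c \<tau> *\<^sub>R y) t = kern (a + c) t *\<^sub>R y"
  unfolding fint_def scaleR_scaleR
  by (intro integral_unique has_integral_scaleR_left has_integral_kern_kern assms)

lemma fint_const:
  assumes "0 < a" "0 \<le> t"
  shows "fint a (\<lambda>\<tau>. y) t = kern (a + 1) t *\<^sub>R y"
  unfolding fint_def
  by (intro integral_unique has_integral_scaleR_left has_integral_kern assms)

lemma norm_fint_le_fint:
  assumes "L1c T f" "L1c T \<phi>" "0 < a" "0 < t" "t \<le> T" "\<And>\<tau>. 0 < \<tau> \<Longrightarrow> \<tau> < t \<Longrightarrow> norm (f \<tau>) \<le> \<phi> \<tau>"
  shows "norm (fint a f t) \<le> fint a \<phi> t"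
  using norm_fint_le[OF assms(1,3-5)] fint_mono[OF L1c_norm[OF assms(1)] assms(2-6)] by simp

lemma norm_fint_le_const:
  assumes "L1c T f" "0 < a" "0 < t" "t \<le> T" "\<And>\<tau>. 0 < \<tau> \<Longrightarrow> \<tau> < t \<Longrightarrow> norm (f \<tau>) \<le> B"
  shows "norm (fint a f t) \<le> B * kern (a + 1) t"
  using norm_fint_le_fint[OF assms(1) L1c_continuous[of T "\<lambda>_. B"] assms(2-5)]
  by (simp add: fint_const assms(2) less_imp_le[OF assms(3)] mult.commute)

lemma kern_mono: "1 \<le> a \<Longrightarrow> 0 < s \<Longrightarrow> s \<le> t \<Longrightarrow> kern a s \<le> kern a t"
  unfolding kern_def by (intro divide_right_mono powr_mono2) (auto simp: Gamma_real_nonneg)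

lemma continuous_on_kern': "1 < a \<Longrightarrow> continuous_on {0..T} (kern a)"
  unfolding kern_def divide_inverse by (intro continuous_intros continuous_on_powr') auto

lemma power_eq_kern: "0 < t \<Longrightarrow> t ^ i = fact i * kern (real i + 1) t"
  by (simp add: kern_def powr_realpow Gamma_fact add.commute[of _ 1])

section \<open>Polynomial approximation and the semigroup law for continuous functions\<close>

text \<open>Weierstrass approximation with values in a Banach space, obtained from the scalar
  theorem for Bernstein polynomials. The result is written in kernels of integer order,
  \<open>t^i = i! * kern (i + 1) t\<close>, because fractional integrals of kernels are
  explicit.\<close>

lemma kern_sum_approx:
  fixes f :: "real \<Rightarrow> 'b::banach"
  assumes f: "continuous_on {0..T} f" and T: "0 < T" and e: "0 < e"
  obtains N :: nat and y where
    "\<And>t. 0 < t \<Longrightarrow> t \<le> T \<Longrightarrow> norm (f t - (\<Sum>i\<le>N. kern (real i + 1) t *\<^sub>R y i)) < e"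
proof -
  define g where "g x = f (T * x)" for x
  have g: "continuous_on {0..1} g"
    unfolding g_def by (rule continuous_on_compose2[OF f]) (use T in \<open>auto intro!: continuous_intros simp: mult_left_le\<close>)
  have "uniformly_continuous_on {0..1} g"
    by (rule compact_uniformly_continuous[OF g]) simp
  then obtain d where d: "d > 0"
    "\<And>x y. x \<in> {0..1} \<Longrightarrow> y \<in> {0..1} \<Longrightarrow> dist y x < d \<Longrightarrow> dist (g y) (g x) < e / 3"
    using uniformly_continuous_onE[of "{0..1}" g "e/3"] e by (metis divide_pos_pos zero_less_numeral)
  have "compact {0..1::real}" by simp
  then obtain X where X: "finite X" "X \<subseteq> {0..1::real}" "{0..1} \<subseteq> (\<Union>x\<in>X. ball x d)"
    by (rule compactE_image[where C="{0..1}" and f="\<lambda>x. ball x d"]) (use d in auto)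
  \<comment> \<open>The scalar theorem is applied to the distance of \<open>g\<close> from one of
    its values; only the finitely many centres in \<open>X\<close> are needed, which allows a common
    degree.\<close>
  have "\<exists>N. \<forall>n x. N \<le> n \<and> x \<in> {0..1} \<longrightarrow>
      \<bar>norm (g x - g c) - (\<Sum>k\<le>n. norm (g (k/n) - g c) * Bernstein n k x)\<bar> < e / 3" for c
    by (rule Bernstein_Weierstrass) (use e g in \<open>auto intro!: continuous_intros\<close>)
  then have "\<exists>Nf. \<forall>c n x. Nf c \<le> n \<and> x \<in> {0..1} \<longrightarrow>
      \<bar>norm (g x - g c) - (\<Sum>k\<le>n. norm (g (k/n) - g c) * Bernstein n k x)\<bar> < e / 3"
    by (intro choice allI)
  then obtain Nf where Nf: "\<And>c n x. Nf c \<le> n \<Longrightarrow> x \<in> {0..1} \<Longrightarrow>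
      \<bar>norm (g x - g c) - (\<Sum>k\<le>n. norm (g (k/n) - g c) * Bernstein n k x)\<bar> < e / 3"
    by blast
  define n where "n = Suc (\<Sum>c\<in>X. Nf c)"
  have n: "Nf c \<le> n" if "c \<in> X" for c
    unfolding n_def using member_le_sum[OF that, of Nf] X(1) by simp
  have approx: "norm (g x - (\<Sum>k\<le>n. Bernstein n k x *\<^sub>R g (k/n))) < e" if x: "x \<in> {0..1}" for x
  proof -
    obtain c where c: "c \<in> X" "dist c x < d" using X(3) x by auto
    have gc: "norm (g x - g c) < e / 3"
      using d(2)[of x c] c X(2) x by (auto simp: dist_norm norm_minus_commute)
    have B: "0 \<le> Bernstein n k x" for k using x by (simp add: Bernstein_nonneg)
    \<comment> \<open>The Bernstein weights sum to 1, so \<open>g c\<close> may be subtracted in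
      every term.\<close>
    have "g x - (\<Sum>k\<le>n. Bernstein n k x *\<^sub>R g (k/n)) = (g x - g c) - (\<Sum>k\<le>n. Bernstein n k x *\<^sub>R (g (k/n) - g c))"
      by (simp add: scaleR_diff_right sum_subtractf scaleR_left.sum[symmetric])
    also have "norm \<dots> \<le> norm (g x - g c) + (\<Sum>k\<le>n. norm (g (k/n) - g c) * Bernstein n k x)"
      by (rule order_trans[OF norm_triangle_ineq4 add_left_mono], rule order_trans[OF norm_sum])
        (use B in \<open>simp add: mult.commute\<close>)
    also have "\<dots> < e / 3 + 2 * (e / 3)"
      using gc Nf[OF n[OF c(1)] x, of ] by linarith
    finally show ?thesis by simp
  qed
  \<comment> \<open>The Bernstein polynomial in \<open>t / T\<close> as an element of the polynomial
    type, so that its coefficients can define the vectors \<open>y\<close>.\<close>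
  define P where "P k = Polynomial.smult (of_nat (n choose k)) ([:0, 1/T:] ^ k * [:1, -1/T:] ^ (n - k))" for k
  have P: "poly (P k) t = Bernstein n k (t / T)" for k t
    by (simp add: P_def Bernstein_def poly_power power_divide mult_ac)
  have deg: "Polynomial.degree (P k) \<le> n" if "k \<le> n" for k
  proof -
    have "Polynomial.degree ([:0, 1/T:] ^ k * [:1, -1/T:] ^ (n - k)) \<le> Polynomial.degree ([:0, 1/T:] ^ k) + Polynomial.degree ([:1, -1/T:] ^ (n - k))"
      by (rule degree_mult_le)
    also have "\<dots> \<le> Polynomial.degree [:0, 1/T:] * k + Polynomial.degree [:1, -1/T:] * (n - k)"
      by (intro add_mono degree_power_le)
    also have "\<dots> \<le> 1 * k + 1 * (n - k)"
      by (intro add_mono mult_right_mono) auto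
    finally have "Polynomial.degree ([:0, 1/T:] ^ k * [:1, -1/T:] ^ (n - k)) \<le> n"
      using that by simp
    then show ?thesis
      unfolding P_def by (rule order_trans[OF degree_smult_le])
  qed
  define y where "y i = (\<Sum>k\<le>n. (poly.coeff (P k) i * fact i) *\<^sub>R g (k/n))" for i
  have "norm (f t - (\<Sum>i\<le>n. kern (real i + 1) t *\<^sub>R y i)) < e" if t: "0 < t" "t \<le> T" for t
  proof -
    have "(\<Sum>i\<le>n. kern (real i + 1) t *\<^sub>R y i)
        = (\<Sum>k\<le>n. \<Sum>i\<le>n. (poly.coeff (P k) i * t ^ i) *\<^sub>R g (k/n))"
      unfolding y_def scaleR_sum_right using t
      by (subst sum.swap) (simp add: power_eq_kern mult_ac)
    also have "\<dots> = (\<Sum>k\<le>n. Bernstein n k (t / T) *\<^sub>R g (k/n))"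
    proof (rule sum.cong)
      fix k assume "k \<in> {..n}"
      then have "poly (P k) t = (\<Sum>i\<le>n. poly.coeff (P k) i * t ^ i)"
        unfolding poly_altdef using deg[of k]
        by (intro sum.mono_neutral_left) (auto simp: coeff_eq_0)
      then show "(\<Sum>i\<le>n. (poly.coeff (P k) i * t ^ i) *\<^sub>R g (k/n)) = Bernstein n k (t / T) *\<^sub>R g (k/n)"
        by (simp add: P scaleR_left.sum[symmetric])
    qed simp
    finally show ?thesis
      using approx[of "t / T"] t T by (simp add: g_def)
  qed
  then show thesis using that by blast
qed

text \<open>Both claims are explicit for sums of kernels. A uniform error \<open>e\<close> of the
  argument becomes at most \<open>e * kern (c + 1) t\<close> after integration of order
  \<open>c\<close>, so they survive uniform limits.\<close>

lemma
  fixes f :: "real \<Rightarrow> 'b::banach"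
  assumes f: "continuous_on {0..T} f" and a: "0 < a"
  shows fint_continuous: "continuous_on {0..T} (fint a f)"
    and fint_fint_continuous: "0 < b \<Longrightarrow> 0 < t \<Longrightarrow> t \<le> T \<Longrightarrow> fint a (fint b f) t = fint (a + b) f t"
proof -
  define p where "p N y t = (\<Sum>i\<le>N. kern (real i + 1) t *\<^sub>R y i)" for N :: nat and y :: "nat \<Rightarrow> 'b" and t
  have p: "\<exists>N y. \<forall>t\<in>{0<..T}. norm (f t - p N y t) < e" if e: "0 < e" for e
  proof (cases "0 < T")
    case True
    obtain N y where "\<And>t. 0 < t \<Longrightarrow> t \<le> T \<Longrightarrow> norm (f t - (\<Sum>i\<le>N. kern (real i + 1) t *\<^sub>R y i)) < e"
      using kern_sum_approx[OF f True e] by blast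
    then show ?thesis
      by (intro exI[of _ N] exI[of _ y] ballI) (auto simp: p_def)
  qed auto
  have Lf: "L1c T f" by (rule L1c_continuous[OF f])
  have Lp: "L1c S (p N y)" for N y S
    unfolding p_def by (intro L1c_sum L1c_kern) auto
  have fp: "fint c (p N y) t = (\<Sum>i\<le>N. kern (c + (real i + 1)) t *\<^sub>R y i)" if "0 < c" "0 \<le> t" for c N y t
  proof (cases "t = 0")
    case False
    then show ?thesis
      unfolding p_def using that
      by (subst fint_sum[where T=t]) (auto intro!: L1c_kern fint_kern sum.cong)
  qed simp
  have bnd: "norm (fint c f t - fint c (p N y) t) \<le> e * kern (c + 1) t"
    if "0 < c" "\<forall>t\<in>{0<..T}. norm (f t - p N y t) < e" "0 < t" "t \<le> T" for c N y e t
    using norm_fint_le_const[of T "\<lambda>t. f t - p N y t" c t e] that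
    by (auto simp: fint_diff[OF Lf Lp] L1c_diff[OF Lf Lp] less_imp_le)
  have c: "continuous_on {0..T} (fint c f)" if "0 < c" for c
  proof -
    have "\<forall>k. \<exists>N y. \<forall>t\<in>{0<..T}. norm (f t - p N y t) < 1 / real (Suc k)"
      using p by simp
    then obtain qN qy where q: "\<And>k. \<forall>t\<in>{0<..T}. norm (f t - p (qN k) (qy k) t) < 1 / real (Suc k)"
      by metis
    have ul: "uniform_limit {0..T} (\<lambda>k t. fint c (p (qN k) (qy k)) t) (fint c f) sequentially"
    proof (rule uniform_limitI)
      fix e :: real assume e: "0 < e"
      have "(\<lambda>k. 1 / real (Suc k) * kern (c + 1) T) \<longlonglongrightarrow> 0 * kern (c + 1) T"
        by (intro tendsto_mult_right LIMSEQ_Suc lim_1_over_n)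
      then have "\<forall>\<^sub>F k in sequentially. 1 / real (Suc k) * kern (c + 1) T < e"
        using e by (auto intro: order_tendstoD)
      then show "\<forall>\<^sub>F k in sequentially. \<forall>t\<in>{0..T}. dist (fint c (p (qN k) (qy k)) t) (fint c f t) < e"
      proof (rule eventually_mono, intro ballI)
        fix k t assume k: "1 / real (Suc k) * kern (c + 1) T < e" and t: "t \<in> {0..T}"
        show "dist (fint c (p (qN k) (qy k)) t) (fint c f t) < e"
        proof (cases "t = 0")
          case False
          then have "norm (fint c f t - fint c (p (qN k) (qy k)) t) \<le> 1 / Suc k * kern (c + 1) t"
            using bnd[OF that q] t by auto
          also have "\<dots> \<le> 1 / Suc k * kern (c + 1) T"
            by (intro mult_left_mono kern_mono) (use t False that in auto)
          finally show ?thesis using k by (simp add: dist_norm norm_minus_commute)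
        qed (use e in simp)
      qed
    qed
    have "continuous_on {0..T} (fint c (p N y))" for N y
    proof -
      have "continuous_on {0..T} (\<lambda>t. \<Sum>i\<le>N. kern (c + (real i + 1)) t *\<^sub>R y i)"
        by (intro continuous_intros continuous_on_kern') (use that in auto)
      then show ?thesis
        by (rule continuous_on_cong[THEN iffD1, rotated 2]) (auto simp: fp that)
    qed
    then show ?thesis
      by (intro uniform_limit_theorem[OF _ ul]) simp_all
  qed
  show "continuous_on {0..T} (fint a f)" by (rule c[OF a])
  show "fint a (fint b f) t = fint (a + b) f t" if b: "0 < b" and t: "0 < t" "t \<le> T"
  proof -
    have "norm (fint a (fint b f) t - fint (a + b) f t) \<le> e" if e: "0 < e" for e
    proof -
      define K where "K = kern (a + b + 1) t"
      have K: "0 \<le> K" unfolding K_def by (rule kern_nonneg) (use a b in auto)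
      \<comment> \<open>Each of the two approximation errors below is at most \<open>d * K\<close>,
        half of \<open>e\<close>; the 1 guards against division by zero.\<close>
      define d where "d = e / (2 * (K + 1))"
      have d: "0 < d" "2 * d * K \<le> e" using K e by (auto simp: d_def field_simps)
      obtain N y where Ny: "\<forall>t\<in>{0<..T}. norm (f t - p N y t) < d" using p[OF d(1)] by blast
      have pp: "fint a (fint b (p N y)) t = fint (a + b) (p N y) t"
      proof -
        have "fint a (fint b (p N y)) t = fint a (\<lambda>\<tau>. \<Sum>i\<le>N. kern (b + (real i + 1)) \<tau> *\<^sub>R y i) t"
          by (rule fint_cong) (use b in \<open>simp add: fp\<close>)
        also have "\<dots> = (\<Sum>i\<le>N. kern (a + (b + (real i + 1))) t *\<^sub>R y i)"
          using a b t by (subst fint_sum[where T=t]) (auto intro!: L1c_kern fint_kern sum.cong)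
        also have "\<dots> = fint (a + b) (p N y) t"
          using a b t by (simp add: fp add.assoc)
        finally show ?thesis .
      qed
      have "L1c T (\<lambda>\<tau>. \<Sum>i\<le>N. kern (b + (real i + 1)) \<tau> *\<^sub>R y i)"
        by (intro L1c_sum L1c_kern) (use b in auto)
      then have Lbp: "L1c T (fint b (p N y))"
        by (rule L1c_cong) (use b in \<open>simp add: fp\<close>)
      have Lb: "L1c T (fint b f)" "L1c T (fint b (p N y))"
        using L1c_continuous[OF c[OF b]] Lbp by auto
      have "norm (fint a (fint b f) t - fint a (fint b (p N y)) t) \<le> fint a (\<lambda>\<tau>. kern (b + 1) \<tau> *\<^sub>R d) t"
        unfolding fint_diff[OF Lb a t, symmetric]
      proof (rule norm_fint_le_fint[OF L1c_diff[OF Lb] L1c_kern a t])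
        show "norm (fint b f \<tau> - fint b (p N y) \<tau>) \<le> kern (b + 1) \<tau> *\<^sub>R d" if "0 < \<tau>" "\<tau> < t" for \<tau>
          using bnd[OF b Ny, of \<tau>] that t by (simp add: mult.commute)
      qed (use b in simp)
      also have "\<dots> = d * K"
        using a b t by (subst fint_kern) (auto simp: K_def add.assoc)
      finally have 1: "norm (fint a (fint b f) t - fint a (fint b (p N y)) t) \<le> d * K" .
      have 2: "norm (fint (a + b) f t - fint (a + b) (p N y) t) \<le> d * K"
        unfolding K_def by (rule bnd) (use a b Ny t in auto)
      have "norm (fint a (fint b f) t - fint (a + b) f t) \<le> d * K + d * K"
        using 1 2 pp norm_triangle_ineq4[of "fint a (fint b f) t - fint a (fint b (p N y)) t" "fint (a + b) f t - fint (a + b) (p N y) t"]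
        by (simp add: mult.commute)
      then show ?thesis using d(2) by (simp add: mult_ac)
    qed
    then show ?thesis
      by (metis dense_ge norm_le_zero_iff right_minus_eq)
  qed
qed

section \<open>Cutting off the singularity at 0\<close>

text \<open>For positive \<open>n\<close>, a linear ramp between \<open>1 / n\<close> and
  \<open>2 / n\<close>. Vanishing near 0 makes the product with an \<open>L1c\<close> function
  continuous on the closed interval, and monotonicity in \<open>n\<close> makes monotone convergence
  available for the way back.\<close>

definition cutoff :: "nat \<Rightarrow> real \<Rightarrow> real" where
  "cutoff n t = max 0 (min 1 (real n * t - 1))"

lemma cutoff_bounds: "0 \<le> cutoff n t" "cutoff n t \<le> 1"
  by (auto simp: cutoff_def)

lemma cutoff_mono: "0 \<le> t \<Longrightarrow> cutoff n t \<le> cutoff (Suc n) t"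
  unfolding cutoff_def by (intro max.mono min.mono order_refl) (simp add: algebra_simps)

lemma cutoff_eq_1: "2 \<le> real n * t \<Longrightarrow> cutoff n t = 1"
  by (simp add: cutoff_def)

lemma cutoff_eq_0: "real n * t \<le> 1 \<Longrightarrow> cutoff n t = 0"
  by (simp add: cutoff_def)

lemma continuous_on_cutoff [continuous_intros]: "continuous_on S (cutoff n)"
  unfolding cutoff_def by (intro continuous_intros)

lemma tendsto_cutoff: "0 < t \<Longrightarrow> (\<lambda>n. cutoff n t) \<longlonglongrightarrow> 1"
proof (rule tendsto_eventually)
  assume t: "0 < t"
  show "\<forall>\<^sub>F n in sequentially. cutoff n t = 1"
    using eventually_ge_at_top[of "nat \<lceil>2 / t\<rceil>"]
    by eventually_elim (use t in \<open>auto intro!: cutoff_eq_1 simp: field_simps nat_le_iff ceiling_le_iff\<close>)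
qed

lemma continuous_on_cutoff_scaleR:
  fixes f :: "real \<Rightarrow> 'b::banach"
  assumes "L1c T f"
  shows "continuous_on {0..T} (\<lambda>t. cutoff n t *\<^sub>R f t)"
proof -
  have "continuous_on ({0..min T (1/n)} \<union> {1/n..T}) (\<lambda>t. cutoff n t *\<^sub>R f t)" if n: "0 < n"
  proof (rule continuous_on_closed_Un)
    have "cutoff n t *\<^sub>R f t = 0" if "t \<in> {0..min T (1/n)}" for t
      using that n cutoff_eq_0[of n t] by (simp add: field_simps)
    then show "continuous_on {0..min T (1/n)} (\<lambda>t. cutoff n t *\<^sub>R f t)"
      using continuous_on_cong[of _ "{0..min T (1/n)}" "\<lambda>t. cutoff n t *\<^sub>R f t" "\<lambda>_. 0"] by simp
    have "{1/n..T} \<subseteq> {0<..T}"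
    proof
      fix x assume "x \<in> {1/n..T}"
      then show "x \<in> {0<..T}"
        using less_le_trans[of 0 "1 / real n" x] n by simp
    qed
    then have "continuous_on {1/n..T} f"
      by (rule continuous_on_subset[rotated]) (use assms in \<open>simp add: L1c_def\<close>)
    then show "continuous_on {1/n..T} (\<lambda>t. cutoff n t *\<^sub>R f t)"
      by (intro continuous_intros)
  qed auto
  then have "continuous_on {0..T} (\<lambda>t. cutoff n t *\<^sub>R f t)" if "0 < n"
    by (rule continuous_on_subset) (use that in auto)
  moreover have "cutoff 0 t = 0" for t
    by (simp add: cutoff_def)
  ultimately show ?thesis by (cases "n = 0") auto
qed

lemma fint_monotone_convergence:
  fixes \<phi> :: "nat \<Rightarrow> real \<Rightarrow> real"
  assumes a: "0 < a" and t: "0 < t" "t \<le> T" and L: "\<And>k. L1c T (\<phi> k)"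
    and mono: "\<And>k \<tau>. 0 < \<tau> \<Longrightarrow> \<tau> < t \<Longrightarrow> \<phi> k \<tau> \<le> \<phi> (Suc k) \<tau>"
    and lim: "\<And>\<tau>. 0 < \<tau> \<Longrightarrow> \<tau> < t \<Longrightarrow> (\<lambda>k. \<phi> k \<tau>) \<longlonglongrightarrow> \<psi> \<tau>"
    and bnd: "\<And>k. \<bar>fint a (\<phi> k) t\<bar> \<le> B"
  shows "(\<lambda>\<tau>. kern a (t - \<tau>) * \<psi> \<tau>) integrable_on {0..t}"
    and "(\<lambda>k. fint a (\<phi> k) t) \<longlonglongrightarrow> fint a \<psi> t"
proof -
  have "(\<lambda>\<tau>. kern a (t - \<tau>) * \<psi> \<tau>) integrable_on {0<..<t} \<and>
    (\<lambda>k. integral {0<..<t} (\<lambda>\<tau>. kern a (t - \<tau>) * \<phi> k \<tau>)) \<longlonglongrightarrow> integral {0<..<t} (\<lambda>\<tau>. kern a (t - \<tau>) * \<psi> \<tau>)"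
  proof (rule monotone_convergence_increasing)
    show "(\<lambda>\<tau>. kern a (t - \<tau>) * \<phi> k \<tau>) integrable_on {0<..<t}" for k
      using fint_integrable[OF L a t] by (simp add: integrable_on_open_interval_real)
    show "kern a (t - \<tau>) * \<phi> k \<tau> \<le> kern a (t - \<tau>) * \<phi> (Suc k) \<tau>" if "\<tau> \<in> {0<..<t}" for k \<tau>
      using that by (intro mult_left_mono mono kern_nonneg a) auto
    show "(\<lambda>k. kern a (t - \<tau>) * \<phi> k \<tau>) \<longlonglongrightarrow> kern a (t - \<tau>) * \<psi> \<tau>" if "\<tau> \<in> {0<..<t}" for \<tau>
      using that by (intro tendsto_mult_left lim) auto
    show "bounded (range (\<lambda>k. integral {0<..<t} (\<lambda>\<tau>. kern a (t - \<tau>) * \<phi> k \<tau>)))"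
      unfolding bounded_real using bnd by (auto simp: fint_def integral_open_interval_real)
  qed
  then show "(\<lambda>\<tau>. kern a (t - \<tau>) * \<psi> \<tau>) integrable_on {0..t}"
    and "(\<lambda>k. fint a (\<phi> k) t) \<longlonglongrightarrow> fint a \<psi> t"
    by (simp_all add: integrable_on_open_interval_real fint_def integral_open_interval_real)
qed

lemma L1c_cutoff: "L1c T f \<Longrightarrow> L1c T (\<lambda>t. cutoff n t *\<^sub>R f t)"
  by (rule L1c_continuous, rule continuous_on_cutoff_scaleR)

lemma fint_nonneg:
  fixes \<phi> :: "real \<Rightarrow> real"
  assumes "L1c T \<phi>" "0 < a" "0 < t" "t \<le> T" "\<And>\<tau>. 0 \<le> \<phi> \<tau>"
  shows "0 \<le> fint a \<phi> t"
  using fint_mono[OF L1c_0 assms(1-4)] assms(5) by (simp add: fint_0)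

lemma fint_cutoff_tendsto:
  fixes \<phi> :: "real \<Rightarrow> real"
  assumes "L1c T \<phi>" "0 < a" "0 < t" "t \<le> T" "\<And>\<tau>. 0 \<le> \<phi> \<tau>"
  shows "(\<lambda>k. fint a (\<lambda>\<tau>. cutoff k \<tau> * \<phi> \<tau>) t) \<longlonglongrightarrow> fint a \<phi> t"
    and "fint a (\<lambda>\<tau>. cutoff k \<tau> * \<phi> \<tau>) t \<le> fint a \<phi> t"
proof -
  have L: "L1c T (\<lambda>\<tau>. cutoff k \<tau> * \<phi> \<tau>)" for k
    using L1c_cutoff[OF assms(1)] by simp
  show le: "fint a (\<lambda>\<tau>. cutoff k \<tau> * \<phi> \<tau>) t \<le> fint a \<phi> t" for k
    by (rule fint_mono[OF L assms(1-4)]) (simp add: cutoff_bounds assms(5) mult_left_le_one_le)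
  have ge: "0 \<le> fint a (\<lambda>\<tau>. cutoff k \<tau> * \<phi> \<tau>) t" for k
    by (rule fint_nonneg[OF L assms(2-4)]) (simp add: cutoff_bounds assms(5))
  show "(\<lambda>k. fint a (\<lambda>\<tau>. cutoff k \<tau> * \<phi> \<tau>) t) \<longlonglongrightarrow> fint a \<phi> t"
  proof (rule fint_monotone_convergence(2)[OF assms(2-4) L])
    show "(\<lambda>k. cutoff k \<tau> * \<phi> \<tau>) \<longlonglongrightarrow> \<phi> \<tau>" if "0 < \<tau>" for \<tau>
      using tendsto_mult_right[OF tendsto_cutoff[OF that], of "\<phi> \<tau>"] by simp
    show "\<bar>fint a (\<lambda>\<tau>. cutoff k \<tau> * \<phi> \<tau>) t\<bar> \<le> fint a \<phi> t" for k
      using le[of k] ge[of k] by simp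
  qed (intro mult_right_mono cutoff_mono assms(5); simp)
qed

lemma continuous_on_half_open:
  fixes f :: "real \<Rightarrow> 'b::topological_space"
  assumes "\<And>s. 0 < s \<Longrightarrow> s \<le> T \<Longrightarrow> continuous_on {s..T} f"
  shows "continuous_on {0<..T} f"
  unfolding continuous_on_eq_continuous_within
proof
  fix t assume t: "t \<in> {0<..T}"
  then have "continuous (at t within {t/2..T}) f"
    using assms[of "t/2"] unfolding continuous_on_eq_continuous_within by auto
  moreover have "at t within {t/2..T} = at t within {0<..T}"
    by (rule at_within_nhd[of t "{t/2<..}"]) (use t in auto)
  ultimately show "continuous (at t within {0<..T}) f" by simp
qed

text \<open>Convergence of the cut-off integrals is uniform on \<open>{s..T}\<close>: the part of
  \<open>f\<close> removed lives on \<open>\<tau> \<le> s / 2\<close>, where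
  \<open>t - \<tau> \<ge> s / 2\<close> bounds the kernel by \<open>C\<close>, so the error is at
  most \<open>C\<close> times the integral \<open>r n\<close> of the removed part.\<close>

lemma fint_continuous_L1c:
  fixes f :: "real \<Rightarrow> 'b::banach"
  assumes f: "L1c T f" and a: "0 < a"
  shows "continuous_on {0<..T} (fint a f)"
proof (rule continuous_on_half_open)
  fix s :: real assume s: "0 < s" "s \<le> T"
  have T: "0 < T" using s by simp
  let ?g = "\<lambda>n t. cutoff n t *\<^sub>R f t"
  have "compact (kern a ` {s/2..T})"
    by (intro compact_continuous_image continuous_on_subset[OF continuous_on_kern]) (use s in auto)
  then obtain C where C: "\<And>\<tau>. \<tau> \<in> {s/2..T} \<Longrightarrow> kern a \<tau> \<le> C"
    using bounded_imp_bdd_above[OF compact_imp_bounded] unfolding bdd_above_def by (metis imageI)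
  have "0 \<le> C" using C[of T] kern_nonneg[OF a, of T] s by auto
  have L: "L1c T (\<lambda>\<tau>. (1 - cutoff n \<tau>) * norm (f \<tau>))" for n
    using L1c_diff[OF L1c_norm[OF f] L1c_cutoff[OF L1c_norm[OF f]], of n] by (simp add: algebra_simps)
  define r where "r n = fint 1 (\<lambda>\<tau>. (1 - cutoff n \<tau>) * norm (f \<tau>)) T" for n
  have r: "r n = fint 1 (\<lambda>\<tau>. norm (f \<tau>)) T - fint 1 (\<lambda>\<tau>. cutoff n \<tau> * norm (f \<tau>)) T" for n
    unfolding r_def using fint_diff[OF L1c_norm[OF f] L1c_cutoff[OF L1c_norm[OF f]], of 1 T n] T
    by (simp add: algebra_simps)
  have r0: "r \<longlonglongrightarrow> 0"
    unfolding r[abs_def]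
    using tendsto_diff[OF tendsto_const fint_cutoff_tendsto(1)[OF L1c_norm[OF f], of 1 T],
      of "fint 1 (\<lambda>\<tau>. norm (f \<tau>)) T"] T by simp
  \<comment> \<open>The cut-off equals 1 from \<open>2 / n\<close> on, and
    \<open>4 \<le> n * s\<close> places \<open>2 / n\<close> below \<open>s / 2\<close>.\<close>
  have est: "norm (fint a f t - fint a (?g n) t) \<le> C * r n" if t: "t \<in> {s..T}" and n: "4 \<le> real n * s" for t n
  proof -
    have t': "0 < t" "t \<le> T" using t s by auto
    have "norm (fint a f t - fint a (?g n) t) = norm (fint a (\<lambda>\<tau>. f \<tau> - ?g n \<tau>) t)"
      by (simp add: fint_diff[OF f L1c_cutoff[OF f] a t'])
    also have "\<dots> \<le> fint a (\<lambda>\<tau>. (1 - cutoff n \<tau>) * norm (f \<tau>)) t"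
    proof (rule norm_fint_le_fint[OF _ L a t'])
      show "norm (f \<tau> - cutoff n \<tau> *\<^sub>R f \<tau>) \<le> (1 - cutoff n \<tau>) * norm (f \<tau>)" for \<tau>
        using norm_scaleR[of "1 - cutoff n \<tau>" "f \<tau>"] cutoff_bounds[of n \<tau>] by (simp add: scaleR_diff_left)
    qed (intro L1c_diff L1c_cutoff f)
    also have "\<dots> \<le> integral {0<..<t} (\<lambda>\<tau>. C * ((1 - cutoff n \<tau>) * norm (f \<tau>)))"
      unfolding fint_def integral_open_interval_real real_scaleR_def
    proof (rule integral_le)
      show "(\<lambda>\<tau>. kern a (t - \<tau>) * ((1 - cutoff n \<tau>) * norm (f \<tau>))) integrable_on {0<..<t}"
        using fint_integrable[OF L a t'] by (simp add: integrable_on_open_interval_real)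
      show "(\<lambda>\<tau>. C * ((1 - cutoff n \<tau>) * norm (f \<tau>))) integrable_on {0<..<t}"
        using L1c_integrable[OF L1c_subset[OF L t'(2)]]
        by (simp add: integrable_on_open_interval_real integrable_on_mult_right)
      fix \<tau> assume \<tau>: "\<tau> \<in> {0<..<t}"
      show "kern a (t - \<tau>) * ((1 - cutoff n \<tau>) * norm (f \<tau>)) \<le> C * ((1 - cutoff n \<tau>) * norm (f \<tau>))"
      proof (cases "2 \<le> real n * \<tau>")
        case True
        then show ?thesis by (simp add: cutoff_eq_1)
      next
        case False
        have "0 < real n" using n s by (metis less_le_trans mult_zero_left of_nat_0_less_iff gr0I of_nat_0 not_numeral_le_zero)
        then have "\<tau> \<le> s / 2" using False n by (smt (verit) mult_le_cancel_left_pos field_sum_of_halves distrib_left)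
        then show ?thesis
          using t \<tau> C[of "t - \<tau>"] by (intro mult_right_mono mult_nonneg_nonneg) (auto simp: cutoff_bounds)
      qed
    qed
    also have "\<dots> = C * integral {0..t} (\<lambda>\<tau>. (1 - cutoff n \<tau>) * norm (f \<tau>))"
      by (simp add: integral_open_interval_real)
    also have "\<dots> \<le> C * integral {0..T} (\<lambda>\<tau>. (1 - cutoff n \<tau>) * norm (f \<tau>))"
      by (intro mult_left_mono integral_subset_le)
        (use t' \<open>0 \<le> C\<close> L1c_integrable[OF L] L1c_integrable[OF L1c_subset[OF L t'(2)]] cutoff_bounds in auto)
    also have "integral {0..T} (\<lambda>\<tau>. (1 - cutoff n \<tau>) * norm (f \<tau>)) = r n"
      unfolding r_def fint_def integral_open_interval_real
      by (rule Henstock_Kurzweil_Integration.integral_cong) (auto simp: kern_1)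
    finally show ?thesis .
  qed
  have ul: "uniform_limit {s..T} (\<lambda>n. fint a (?g n)) (fint a f) sequentially"
  proof (rule uniform_limitI)
    fix e :: real assume e: "0 < e"
    have "(\<lambda>n. C * r n) \<longlonglongrightarrow> C * 0" by (intro tendsto_mult_left r0)
    then have "\<forall>\<^sub>F n in sequentially. C * r n < e" using e by (auto intro: order_tendstoD)
    moreover have "\<forall>\<^sub>F n in sequentially. 4 \<le> real n * s"
      using eventually_ge_at_top[of "nat \<lceil>4 / s\<rceil>"]
      by eventually_elim (use s in \<open>auto simp: field_simps nat_le_iff ceiling_le_iff\<close>)
    ultimately show "\<forall>\<^sub>F n in sequentially. \<forall>t\<in>{s..T}. dist (fint a (?g n) t) (fint a f t) < e"
      by eventually_elim (use est in \<open>fastforce simp: dist_norm norm_minus_commute\<close>)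
  qed
  have "continuous_on {s..T} (fint a (?g n))" for n
    by (rule continuous_on_subset[OF fint_continuous[OF continuous_on_cutoff_scaleR[OF f] a]])
      (use s in auto)
  then show "continuous_on {s..T} (fint a f)"
    by (intro uniform_limit_theorem[OF _ ul]) simp_all
qed

text \<open>Monotone convergence for the inner and then for the outer integral. Integrability of the
  iterated integral is part of the conclusion; with \<open>a = 1\<close> it shows that
  \<open>L1c\<close> is closed under fractional integration.\<close>

lemma fint_fint_nonneg:
  fixes \<phi> :: "real \<Rightarrow> real"
  assumes \<phi>: "L1c T \<phi>" "\<And>\<tau>. 0 \<le> \<phi> \<tau>" and a: "0 < a" and b: "0 < b" and t: "0 < t" "t \<le> T"
  shows "(\<lambda>\<tau>. kern a (t - \<tau>) * fint b \<phi> \<tau>) integrable_on {0..t}"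
    and "fint a (fint b \<phi>) t = fint (a + b) \<phi> t"
proof -
  let ?c = "\<lambda>k \<tau>. cutoff k \<tau> * \<phi> \<tau>"
  have c: "continuous_on {0..T} (?c k)" for k
    using continuous_on_cutoff_scaleR[OF \<phi>(1)] by simp
  have L: "L1c T (fint b (?c k))" for k
    by (intro L1c_continuous fint_continuous c b)
  have ff: "fint a (fint b (?c k)) t = fint (a + b) (?c k) t" for k
    by (rule fint_fint_continuous[OF c a b t])
  have ab: "0 < a + b" using a b by simp
  have nn: "0 \<le> fint (a + b) (?c k) t" for k
    by (rule fint_nonneg[OF L1c_continuous[OF c] ab t]) (simp add: cutoff_bounds \<phi>(2))
  have m: "fint b (?c k) \<tau> \<le> fint b (?c (Suc k)) \<tau>" if "0 < \<tau>" "\<tau> < t" for k \<tau>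
    by (rule fint_mono[OF L1c_continuous[OF c] L1c_continuous[OF c] b])
      (use that t in \<open>auto intro!: mult_right_mono cutoff_mono \<phi>(2)\<close>)
  have l: "(\<lambda>k. fint b (?c k) \<tau>) \<longlonglongrightarrow> fint b \<phi> \<tau>" if "0 < \<tau>" "\<tau> < t" for \<tau>
    by (rule fint_cutoff_tendsto(1)[OF \<phi>(1) b _ _ \<phi>(2)]) (use that t in auto)
  have bd: "\<bar>fint a (fint b (?c k)) t\<bar> \<le> fint (a + b) \<phi> t" for k
    unfolding ff using nn[of k] fint_cutoff_tendsto(2)[OF \<phi>(1) ab t \<phi>(2), of k] by simp
  note mc = fint_monotone_convergence[OF a t L m l bd]
  show "(\<lambda>\<tau>. kern a (t - \<tau>) * fint b \<phi> \<tau>) integrable_on {0..t}" by (rule mc(1))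
  have "(\<lambda>k. fint (a + b) (?c k) t) \<longlonglongrightarrow> fint (a + b) \<phi> t"
    by (rule fint_cutoff_tendsto(1)[OF \<phi>(1) ab t \<phi>(2)])
  then show "fint a (fint b \<phi>) t = fint (a + b) \<phi> t"
    using mc(2) unfolding ff by (rule LIMSEQ_unique[symmetric])
qed

lemma L1c_fint:
  fixes f :: "real \<Rightarrow> 'b::banach"
  assumes f: "L1c T f" and b: "0 < b"
  shows "L1c T (fint b f)"
proof (cases "0 < T")
  case True
  have "(\<lambda>\<tau>. kern 1 (T - \<tau>) * fint b (\<lambda>\<tau>. norm (f \<tau>)) \<tau>) integrable_on {0..T}"
    by (rule fint_fint_nonneg(1)[OF L1c_norm[OF f]]) (use b True in auto)
  then have "fint b (\<lambda>\<tau>. norm (f \<tau>)) integrable_on {0..T}"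
    by (rule integrable_spike_finite[of "{T}", rotated 2]) (auto simp: kern_1)
  then show ?thesis
    by (intro L1cI[where \<phi>="fint b (\<lambda>\<tau>. norm (f \<tau>))"] fint_continuous_L1c f b norm_fint_le[OF f b]) auto
next
  case False
  then show ?thesis
    using integrable_on_refl[of "\<lambda>t. norm (fint b f t)" 0] by (cases "T = 0") (auto simp: L1c_def)
qed

text \<open>The removed part has the scalar majorant \<open>?h k\<close>, which already obeys the
  semigroup law. Both errors are thus bounded by the integral of order \<open>a + b\<close> of
  \<open>?h k\<close>, which tends to 0.\<close>

lemma fint_fint:
  fixes f :: "real \<Rightarrow> 'b::banach"
  assumes f: "L1c T f" and a: "0 < a" and b: "0 < b" and t: "0 < t" "t \<le> T"
  shows "fint a (fint b f) t = fint (a + b) f t"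
proof -
  let ?n = "\<lambda>\<tau>. norm (f \<tau>)"
  let ?g = "\<lambda>k \<tau>. cutoff k \<tau> *\<^sub>R f \<tau>"
  let ?h = "\<lambda>k \<tau>. (1 - cutoff k \<tau>) * ?n \<tau>"
  have ab: "0 < a + b" using a b by simp
  have Lg: "L1c T (?g k)" for k by (rule L1c_cutoff[OF f])
  have Lh: "L1c T (?h k)" for k
    using L1c_diff[OF L1c_norm[OF f] L1c_cutoff[OF L1c_norm[OF f]], of k] by (simp add: algebra_simps)
  have le: "norm (f \<tau> - ?g k \<tau>) \<le> ?h k \<tau>" for k \<tau>
    using norm_scaleR[of "1 - cutoff k \<tau>" "f \<tau>"] cutoff_bounds[of k \<tau>] by (simp add: scaleR_diff_left)
  have nn: "0 \<le> ?h k \<tau>" for k \<tau> by (simp add: cutoff_bounds)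
  have est: "norm (fint a (fint b f) t - fint (a + b) f t) \<le> 2 * fint (a + b) (?h k) t" for k
  proof -
    have 1: "norm (fint (a + b) f t - fint (a + b) (?g k) t) \<le> fint (a + b) (?h k) t"
      unfolding fint_diff[OF f Lg ab t, symmetric]
      by (rule norm_fint_le_fint[OF L1c_diff[OF f Lg] Lh ab t le])
    have "norm (fint b f \<tau> - fint b (?g k) \<tau>) \<le> fint b (?h k) \<tau>" if "0 < \<tau>" "\<tau> < t" for \<tau>
    proof -
      have \<tau>: "\<tau> \<le> T" using that t by simp
      show ?thesis
        unfolding fint_diff[OF f Lg b that(1) \<tau>, symmetric]
        by (rule norm_fint_le_fint[OF L1c_diff[OF f Lg] Lh b that(1) \<tau> le])
    qed
    then have "norm (fint a (\<lambda>\<tau>. fint b f \<tau> - fint b (?g k) \<tau>) t) \<le> fint a (fint b (?h k)) t"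
      by (intro norm_fint_le_fint[OF L1c_diff[OF L1c_fint[OF f b] L1c_fint[OF Lg b]] L1c_fint[OF Lh b] a t])
    then have 2: "norm (fint a (fint b f) t - fint a (fint b (?g k)) t) \<le> fint (a + b) (?h k) t"
      unfolding fint_diff[OF L1c_fint[OF f b] L1c_fint[OF Lg b] a t]
        fint_fint_nonneg(2)[OF Lh nn a b t] .
    have "fint a (fint b (?g k)) t = fint (a + b) (?g k) t"
      by (rule fint_fint_continuous[OF continuous_on_cutoff_scaleR[OF f] a b t])
    then show ?thesis
      using 1 2 norm_triangle_ineq4[of "fint a (fint b f) t - fint a (fint b (?g k)) t" "fint (a + b) f t - fint (a + b) (?g k) t"]
      by simp
  qed
  have h: "fint (a + b) (?h k) t = fint (a + b) ?n t - fint (a + b) (\<lambda>\<tau>. cutoff k \<tau> * ?n \<tau>) t" for k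
    using fint_diff[OF L1c_norm[OF f] L1c_cutoff[OF L1c_norm[OF f]] ab t, of k]
    by (simp add: algebra_simps)
  have "(\<lambda>k. fint (a + b) ?n t - fint (a + b) (\<lambda>\<tau>. cutoff k \<tau> * ?n \<tau>) t) \<longlonglongrightarrow> fint (a + b) ?n t - fint (a + b) ?n t"
    by (intro tendsto_intros fint_cutoff_tendsto(1)[OF L1c_norm[OF f] ab t]) simp
  then have "(\<lambda>k. 2 * fint (a + b) (?h k) t) \<longlonglongrightarrow> 2 * 0"
    unfolding h by (intro tendsto_mult_left) simp
  then have "norm (fint a (fint b f) t - fint (a + b) f t) \<le> 2 * 0"
    by (rule LIMSEQ_le_const) (use est in auto)
  then show ?thesis by simp
qed

section \<open>Order one: primitives and derivatives\<close>

lemma fint_1: "fint 1 f t = integral {0..t} f"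
  unfolding fint_def integral_open_interval_real
  by (rule Henstock_Kurzweil_Integration.integral_cong) (auto simp: kern_1)

lemma continuous_on_fint_1:
  assumes "L1c T f" shows "continuous_on {0..T} (fint 1 f)"
  unfolding fint_1[abs_def] by (rule indefinite_integral_continuous_1[OF L1c_integrable[OF assms]])

lemma fint_1_has_vector_derivative:
  assumes "L1c T f" "0 < t" "t < T"
  shows "(fint 1 f has_vector_derivative f t) (at t)"
proof -
  have "continuous (at t within {0..T}) f"
  proof -
    have "continuous (at t within {0<..T}) f"
      using assms by (auto simp: L1c_def continuous_on_eq_continuous_within)
    moreover have "at t within {0<..T} = at t within {0..T}"
      by (rule at_within_nhd[of t "{0<..}"]) (use assms in auto)
    ultimately show ?thesis by simp
  qed
  then have "((\<lambda>u. integral {0..u} f) has_vector_derivative f t) (at t within {0..T})"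
    using integral_has_vector_derivative_continuous_at[OF L1c_integrable[OF assms(1)], of t "{}"] assms
    by auto
  then have "(fint 1 f has_vector_derivative f t) (at t within {0<..<T})"
    unfolding fint_1[abs_def] by (rule has_vector_derivative_within_subset) auto
  then show ?thesis
    using assms by (subst (asm) at_within_open) auto
qed

lemma fint_1_derivative:
  assumes "continuous_on {0..T} F" "0 < t" "t \<le> T"
    and "\<And>s. 0 < s \<Longrightarrow> s < t \<Longrightarrow> (F has_vector_derivative f s) (at s)"
  shows "fint 1 f t = F t - F 0"
  unfolding fint_1
  by (rule integral_unique, rule fundamental_theorem_of_calculus_interior)
    (use assms in \<open>auto intro: continuous_on_subset\<close>)

section \<open>Series of fractional integrals\<close>

text \<open>A crude substitute for Stirling's formula: \<open>Gamma (a + 1)\<close> is at least the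
  tail of its integral over \<open>{s..}\<close>, where \<open>t powr a\<close> is at least
  \<open>s powr a\<close>.\<close>

lemma powr_div_Gamma_le_exp:
  fixes s a :: real
  assumes "0 \<le> s" "0 \<le> a"
  shows "s powr a / Gamma (a + 1) \<le> exp s"
proof -
  have G: "((\<lambda>t. t powr (a + 1 - 1) / exp t) has_integral Gamma (a + 1)) {0..}"
    by (rule Gamma_integral_real) (use assms in auto)
  have "((\<lambda>t. exp (- 1 * t)) has_integral exp (- 1 * s) / 1) {s..}"
    by (rule has_integral_exp_minus_to_infinity) simp
  then have "((\<lambda>t. s powr a * exp (- t)) has_integral s powr a * exp (- s)) {s..}"
    using has_integral_mult_right[of "\<lambda>t. exp (- t)" "exp (- s)" "{s..}" "s powr a"] by simp
  then have "((\<lambda>t. if t \<in> {s..} then s powr a * exp (- t) else 0) has_integral s powr a * exp (- s)) {0..}"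
    by (subst has_integral_restrict) (use assms in auto)
  then have "s powr a * exp (- s) \<le> Gamma (a + 1)"
    by (rule has_integral_le[OF _ G])
      (use assms in \<open>auto simp: exp_minus field_simps intro!: powr_mono2\<close>)
  then have "s powr a \<le> Gamma (a + 1) * exp s"
    by (simp add: exp_minus field_simps)
  then show ?thesis
    using Gamma_real_pos[of "a + 1"] assms by (simp add: pos_divide_le_eq mult.commute)
qed

text \<open>The previous bound at \<open>w * T\<close>. The free parameter \<open>w\<close> buys the
  factor \<open>w powr - a\<close>, which beats geometric growth once \<open>w\<close> is
  large.\<close>

lemma kern_le_exp:
  assumes "0 < T" "0 < w" "0 \<le> a"
  shows "kern (a + 1) T \<le> exp (w * T) * w powr - a"
proof -
  have "kern (a + 1) T = (w * T) powr a / Gamma (a + 1) * w powr - a"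
    using assms by (simp add: kern_def powr_mult powr_minus)
  also have "\<dots> \<le> exp (w * T) * w powr - a"
    by (intro mult_right_mono powr_div_Gamma_le_exp) (use assms in auto)
  finally show ?thesis .
qed

lemma kern_geometric_bound:
  assumes "0 < T" "0 < h" "0 \<le> M"
  obtains K where "0 \<le> K" "\<And>i. M ^ i * kern (real i * h + 1) T \<le> K * (1/4) ^ i"
proof -
  \<comment> \<open>Chosen so that \<open>w powr - h = 1 / (4 * (M + 1))\<close>. The ratio 1/4
    rather than 1/2 leaves room for the factor \<open>i \<le> 2^i\<close> in
    \<open>kern_summable'\<close>.\<close>
  define w where "w = (4 * (M + 1)) powr (1 / h)"
  have w: "0 < w" unfolding w_def using assms by simp
  have "w powr - h = inverse (4 * (M + 1))"
    unfolding w_def using assms by (simp add: powr_powr powr_minus)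
  then have "w powr - h * (4 * (M + 1)) = 1"
    using assms by simp
  then have "4 * (M * w powr - h) + 4 * w powr - h = 1"
    by (simp add: algebra_simps)
  then have Mw: "M * w powr - h \<le> 1/4" "0 \<le> M * w powr - h"
    using assms powr_ge_zero[of w "- h"] by (linarith, simp)
  have "M ^ i * kern (real i * h + 1) T \<le> exp (w * T) * (1/4) ^ i" for i
  proof -
    have "M ^ i * kern (real i * h + 1) T \<le> M ^ i * (exp (w * T) * w powr - (real i * h))"
      by (intro mult_left_mono kern_le_exp) (use assms w in auto)
    also have "w powr - (real i * h) = (w powr - h) ^ i"
      using w by (simp add: powr_powr powr_realpow[symmetric] mult.commute)
    also have "M ^ i * (exp (w * T) * (w powr - h) ^ i) = exp (w * T) * (M * w powr - h) ^ i"
      by (simp add: power_mult_distrib)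
    also have "\<dots> \<le> exp (w * T) * (1/4) ^ i"
      by (intro mult_left_mono power_mono Mw) auto
    finally show ?thesis .
  qed
  then show thesis by (intro that[of "exp (w * T)"]) auto
qed

lemma
  assumes "0 < T" "0 < h" "0 \<le> M"
  shows kern_summable: "summable (\<lambda>i. M ^ i * kern (real i * h + 1) T)"
    and kern_summable': "summable (\<lambda>i. M ^ i * (real i * kern (real i * h + 1) T))"
proof -
  obtain K where K: "0 \<le> K" "\<And>i. M ^ i * kern (real i * h + 1) T \<le> K * (1/4) ^ i"
    using kern_geometric_bound[OF assms] by blast
  have nn: "0 \<le> kern (real i * h + 1) T" for i
    by (rule kern_nonneg) (use assms in \<open>auto intro!: add_nonneg_pos\<close>)
  show "summable (\<lambda>i. M ^ i * kern (real i * h + 1) T)"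
    by (rule summable_comparison_test'[where N=0 and g="\<lambda>i. K * (1/4) ^ i"])
      (use K nn assms in \<open>auto intro!: summable_mult summable_geometric simp: abs_mult\<close>)
  have "M ^ i * (real i * kern (real i * h + 1) T) \<le> K * (1/2) ^ i" for i
  proof -
    have "real i * (M ^ i * kern (real i * h + 1) T) \<le> 2 ^ i * (K * (1/4) ^ i)"
      by (rule mult_mono) (use K nn assms of_nat_less_two_power[of i, where ?'a=real] in auto)
    also have "\<dots> = K * (2 ^ i * (1/4) ^ i)" by simp
    also have "(2::real) ^ i * (1/4) ^ i = (1/2) ^ i"
      by (simp add: power_mult_distrib[symmetric])
    finally show ?thesis by (simp add: mult_ac)
  qed
  then show "summable (\<lambda>i. M ^ i * (real i * kern (real i * h + 1) T))"
    by (intro summable_comparison_test'[OF summable_mult[OF summable_geometric[of "1/2"]],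
          where N=0 and c1=K]) (use nn assms in \<open>auto simp: abs_mult\<close>)
qed

text \<open>\<open>s powr (a - 1)\<close> splits into \<open>s powr (a - h)\<close>, at most its
  value at \<open>T\<close>, and \<open>s powr (h - 1)\<close>. One singularity, that of
  \<open>kern h\<close>, thus dominates all kernels of the series.\<close>

lemma kern_le_kern:
  assumes "0 < h" "h \<le> a" "0 \<le> s" "s \<le> T"
  shows "kern a s \<le> T powr (a - h) * Gamma h / Gamma a * kern h s"
proof (cases "s = 0")
  case False
  have "0 < Gamma h" "0 < Gamma a" using assms Gamma_real_pos by auto
  then have "T powr (a - h) * Gamma h / Gamma a * kern h s = T powr (a - h) * s powr (h - 1) / Gamma a"
    by (simp add: kern_def)
  moreover have "s powr (a - 1) = s powr (a - h) * s powr (h - 1)"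
    by (simp add: powr_add[symmetric])
  moreover have "s powr (a - h) \<le> T powr (a - h)"
    using assms by (intro powr_mono2) auto
  ultimately show ?thesis
    using \<open>0 < Gamma a\<close> by (auto simp: kern_def intro!: divide_right_mono mult_right_mono)
qed simp

text \<open>With one majorant \<psi> and summable weights, the remainders are bounded by the tail of
  the weights times \<psi>. This gives uniform convergence away from 0 and convergence after
  fractional integration.\<close>

lemma
  fixes g :: "nat \<Rightarrow> real \<Rightarrow> 'b::banach"
  assumes g: "\<And>i. L1c T (g i)" and \<psi>: "L1c T \<psi>" and c: "summable c" "\<And>i. 0 \<le> c i"
    and le: "\<And>i \<tau>. 0 < \<tau> \<Longrightarrow> \<tau> \<le> T \<Longrightarrow> norm (g i \<tau>) \<le> c i * \<psi> \<tau>"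
  shows L1c_suminf: "L1c T (\<lambda>\<tau>. \<Sum>i. g i \<tau>)"
    and fint_sums: "0 < a \<Longrightarrow> 0 < t \<Longrightarrow> t \<le> T \<Longrightarrow> (\<lambda>i. fint a (g i) t) sums fint a (\<lambda>\<tau>. \<Sum>i. g i \<tau>) t"
    and L1c_summable: "0 < t \<Longrightarrow> t \<le> T \<Longrightarrow> summable (\<lambda>i. g i t)"
proof -
  have sm: "summable (\<lambda>i. norm (g i t))" if "0 < t" "t \<le> T" for t
    by (rule summable_comparison_test'[where N=0 and g="\<lambda>i. c i * \<psi> t"])
      (use le[OF that] c in \<open>auto intro: summable_mult2\<close>)
  show sg: "summable (\<lambda>i. g i t)" if "0 < t" "t \<le> T" for t
    by (rule summable_norm_cancel[OF sm[OF that]])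
  have tail: "norm ((\<Sum>i. g i t) - (\<Sum>i<n. g i t)) \<le> (suminf c - (\<Sum>i<n. c i)) * \<psi> t"
    if "0 < t" "t \<le> T" for n t
  proof -
    have "(\<Sum>i. g i t) - (\<Sum>i<n. g i t) = (\<Sum>i. g (i + n) t)"
      using suminf_split_initial_segment[OF sg[OF that], of n] by simp
    also have "norm \<dots> \<le> (\<Sum>i. norm (g (i + n) t))"
      by (rule summable_norm) (use sm[OF that] in \<open>simp add: summable_iff_shift[of "\<lambda>i. norm (g i t)"]\<close>)
    also have "\<dots> \<le> (\<Sum>i. c (i + n) * \<psi> t)"
      by (rule suminf_le)
        (use le[OF that] sm[OF that] c in \<open>auto simp: summable_iff_shift[of "\<lambda>i. norm (g i t)"]
          intro!: summable_mult2 summable_ignore_initial_segment\<close>)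
    also have "\<dots> = (\<Sum>i. c (i + n)) * \<psi> t"
      by (rule suminf_mult2[symmetric]) (use c in \<open>auto intro: summable_ignore_initial_segment\<close>)
    also have "(\<Sum>i. c (i + n)) = suminf c - (\<Sum>i<n. c i)"
      using suminf_split_initial_segment[OF c(1), of n] by simp
    finally show ?thesis .
  qed
  have gc: "continuous_on {0<..T} (g i)" for i using g[of i] by (simp add: L1c_def)
  have pc: "continuous_on {0<..T} \<psi>" using \<psi> by (simp add: L1c_def)
  show L: "L1c T (\<lambda>\<tau>. \<Sum>i. g i \<tau>)"
  proof (rule L1cI[where \<phi>="\<lambda>\<tau>. suminf c * norm (\<psi> \<tau>)"])
    show "continuous_on {0<..T} (\<lambda>\<tau>. \<Sum>i. g i \<tau>)"
    proof (rule continuous_on_half_open)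
      fix s assume s: "0 < s" "s \<le> T"
      have "compact (\<psi> ` {s..T})"
        by (intro compact_continuous_image continuous_on_subset[OF pc]) (use s in auto)
      then obtain K where K: "\<And>\<tau>. \<tau> \<in> {s..T} \<Longrightarrow> \<psi> \<tau> \<le> K"
        using bounded_imp_bdd_above[OF compact_imp_bounded] unfolding bdd_above_def by (metis imageI)
      have ul: "uniform_limit {s..T} (\<lambda>n \<tau>. \<Sum>i<n. g i \<tau>) (\<lambda>\<tau>. \<Sum>i. g i \<tau>) sequentially"
      proof (rule Weierstrass_m_test[where M="\<lambda>i. c i * K"])
        show "norm (g i \<tau>) \<le> c i * K" if "\<tau> \<in> {s..T}" for i \<tau>
          using le[of \<tau> i] K[OF that] that s c(2)[of i] by (auto intro: order_trans mult_left_mono)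
      qed (use c in \<open>auto intro: summable_mult2\<close>)
      show "continuous_on {s..T} (\<lambda>\<tau>. \<Sum>i. g i \<tau>)"
        by (rule uniform_limit_theorem[OF _ ul])
          (use s in \<open>auto intro!: always_eventually continuous_on_sum continuous_on_subset[OF gc]\<close>)
    qed
    show "(\<lambda>\<tau>. suminf c * norm (\<psi> \<tau>)) integrable_on {0..T}"
      using \<psi> by (auto simp: L1c_def intro: integrable_on_mult_right)
    show "norm (\<Sum>i. g i t) \<le> suminf c * norm (\<psi> t)" if "0 < t" "t < T" for t
      using tail[of t 0] that mult_left_mono[OF abs_ge_self[of "\<psi> t"] suminf_nonneg[OF c]]
      by simp
  qed
  show "(\<lambda>i. fint a (g i) t) sums fint a (\<lambda>\<tau>. \<Sum>i. g i \<tau>) t" if a: "0 < a" and t: "0 < t" "t \<le> T" for a t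
    unfolding sums_def
  proof (rule LIM_zero_cancel, rule tendsto_0_le)
    have "(\<lambda>n. (\<Sum>i<n. c i) - suminf c) \<longlonglongrightarrow> 0"
      using summable_LIMSEQ[OF c(1)] by (simp add: LIM_zero)
    then show "(\<lambda>n. ((\<Sum>i<n. c i) - suminf c) * fint a \<psi> t) \<longlonglongrightarrow> 0"
      using tendsto_mult_right[of _ 0 sequentially "fint a \<psi> t"] by simp
    have "norm ((\<Sum>i<n. fint a (g i) t) - fint a (\<lambda>\<tau>. \<Sum>i. g i \<tau>) t)
        \<le> norm (((\<Sum>i<n. c i) - suminf c) * fint a \<psi> t) * 1" for n
    proof -
      have "norm ((\<Sum>i<n. fint a (g i) t) - fint a (\<lambda>\<tau>. \<Sum>i. g i \<tau>) t)
          = norm (fint a (\<lambda>\<tau>. (\<Sum>i. g i \<tau>) - (\<Sum>i<n. g i \<tau>)) t)"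
        by (subst fint_diff[OF L L1c_sum a t])
          (use g in \<open>simp_all add: fint_sum[OF g a t] norm_minus_commute\<close>)
      also have "\<dots> \<le> fint a (\<lambda>\<tau>. (suminf c - (\<Sum>i<n. c i)) * \<psi> \<tau>) t"
        by (rule norm_fint_le_fint[OF _ _ a t])
          (use g L \<psi> tail t in \<open>auto intro!: L1c_diff L1c_sum L1c_scaleR[of T \<psi>, simplified]\<close>)
      also have "\<dots> = (suminf c - (\<Sum>i<n. c i)) * fint a \<psi> t"
        using fint_bounded_linear[OF bounded_linear_mult_right \<psi> a t] by simp
      also have "\<dots> \<le> norm (((\<Sum>i<n. c i) - suminf c) * fint a \<psi> t) * 1"
        using abs_ge_minus_self[of "((\<Sum>i<n. c i) - suminf c) * fint a \<psi> t"]
        by (simp add: algebra_simps)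
      finally show ?thesis .
    qed
    then show "\<forall>\<^sub>F n in sequentially. norm ((\<Sum>i<n. fint a (g i) t) - fint a (\<lambda>\<tau>. \<Sum>i. g i \<tau>) t)
        \<le> norm (((\<Sum>i<n. c i) - suminf c) * fint a \<psi> t) * 1"
      by simp
  qed
qed

text \<open>The integral is a limit of Riemann sums, which lie in the subspace.\<close>

lemma fint_mem_closed_subspace:
  fixes f :: "real \<Rightarrow> 'b::banach"
  assumes E: "closed E" "subspace E" and f: "\<And>\<tau>. 0 < \<tau> \<Longrightarrow> \<tau> < t \<Longrightarrow> f \<tau> \<in> E"
    and int: "(\<lambda>\<tau>. kern a (t - \<tau>) *\<^sub>R f \<tau>) integrable_on {0..t}"
  shows "fint a f t \<in> E"
proof -
  \<comment> \<open>Membership of \<open>f\<close> is known only inside the interval; the value 0 at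
    the endpoints keeps every Riemann sum in \<open>E\<close> without changing the integral.\<close>
  let ?g = "\<lambda>\<tau>. if \<tau> \<in> {0<..<t} then kern a (t - \<tau>) *\<^sub>R f \<tau> else 0"
  have "((\<lambda>\<tau>. kern a (t - \<tau>) *\<^sub>R f \<tau>) has_integral fint a f t) {0<..<t}"
    using integrable_integral[OF int] by (simp add: fint_def has_integral_Icc_iff_Ioo)
  then have "(?g has_integral fint a f t) {0<..<t}"
    by (rule has_integral_eq[rotated]) simp
  then have "(?g has_integral fint a f t) (cbox 0 t)"
    by (simp add: has_integral_Icc_iff_Ioo)
  then have lim: "((\<lambda>p. \<Sum>(x, k)\<in>p. measure lborel k *\<^sub>R ?g x) \<longlongrightarrow> fint a f t) (division_filter (cbox 0 t))"
    by (rule has_integral_cbox[THEN iffD1])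
  have "(\<Sum>(x, k)\<in>p. measure lborel k *\<^sub>R ?g x) \<in> E" for p :: "(real \<times> real set) set"
    by (rule subspace_sum[OF E(2)]) (use f E(2) in \<open>auto simp: subspace_scale subspace_0\<close>)
  then show ?thesis
    by (intro Lim_in_closed_set[OF E(1) _ division_filter_not_empty lim] always_eventually) simp
qed

lemma suminf_mem_closed_subspace:
  fixes f :: "nat \<Rightarrow> 'b::real_normed_vector"
  assumes "closed E" "subspace E" "\<And>i. f i \<in> E" "summable f"
  shows "suminf f \<in> E"
  by (rule Lim_in_closed_set[OF assms(1) _ _ summable_LIMSEQ[OF assms(4)]])
    (use assms(2,3) in \<open>auto intro!: always_eventually subspace_sum\<close>)

lemma fint_le_fint_kern:
  fixes \<phi> :: "real \<Rightarrow> real"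
  assumes \<phi>: "L1c T \<phi>" "\<And>\<tau>. 0 \<le> \<phi> \<tau>" and a: "0 < a" "0 < b" and t: "0 < t" "t \<le> T"
    and le: "\<And>s. 0 \<le> s \<Longrightarrow> s \<le> T \<Longrightarrow> kern a s \<le> D * kern b s"
  shows "fint a \<phi> t \<le> D * fint b \<phi> t"
proof -
  have "fint a \<phi> t \<le> integral {0<..<t} (\<lambda>\<tau>. D * (kern b (t - \<tau>) * \<phi> \<tau>))"
    unfolding fint_def integral_open_interval_real real_scaleR_def
  proof (rule integral_le)
    show "(\<lambda>\<tau>. kern a (t - \<tau>) * \<phi> \<tau>) integrable_on {0<..<t}"
      using fint_integrable[OF \<phi>(1) a(1) t] by (simp add: integrable_on_open_interval_real)
    show "(\<lambda>\<tau>. D * (kern b (t - \<tau>) * \<phi> \<tau>)) integrable_on {0<..<t}"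
      using integrable_on_mult_right[OF fint_integrable[OF \<phi>(1) a(2) t], of D]
      by (simp add: integrable_on_open_interval_real)
    show "kern a (t - \<tau>) * \<phi> \<tau> \<le> D * (kern b (t - \<tau>) * \<phi> \<tau>)" if "\<tau> \<in> {0<..<t}" for \<tau>
      using mult_right_mono[OF le \<phi>(2), of "t - \<tau>" \<tau>] that t by (simp add: mult.assoc)
  qed
  then show ?thesis
    by (simp add: fint_def integral_open_interval_real)
qed

text \<open>The orders of the system are \<open>n j * h\<close>; \<open>R i\<close> is the coefficient of \<open>t powr (i * h)\<close> in the
  solution operator, up to the Gamma factor.\<close>

locale frac_system =
  fixes h T :: real and n :: "nat \<Rightarrow> nat" and m :: nat
    and B :: "nat \<Rightarrow> nat \<Rightarrow> 'b::banach \<Rightarrow> 'b" and R :: "nat \<Rightarrow> nat \<Rightarrow> nat \<Rightarrow> 'b \<Rightarrow> 'b" and C M :: real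
    and \<phi> :: "nat \<Rightarrow> 'b" and g :: "nat \<Rightarrow> real \<Rightarrow> 'b"
  assumes h: "0 < h" and T: "0 < T" and n: "\<And>j. j < m \<Longrightarrow> 0 < n j"
    and B: "\<And>j k. j < m \<Longrightarrow> k < m \<Longrightarrow> bounded_linear (B j k)"
    and R: "\<And>i j k. j < m \<Longrightarrow> k < m \<Longrightarrow> bounded_linear (R i j k)"
    and R_bound: "\<And>i j k y. j < m \<Longrightarrow> k < m \<Longrightarrow> norm (R i j k y) \<le> C * M ^ i * norm y"
    and M: "0 \<le> M" and C: "0 \<le> C"
    and R_0: "\<And>j k y. j < m \<Longrightarrow> k < m \<Longrightarrow> R 0 j k y = (if j = k then y else 0)"
    and R_small: "\<And>i j k y. j < m \<Longrightarrow> k < m \<Longrightarrow> 0 < i \<Longrightarrow> i < n j \<Longrightarrow> R i j k y = 0"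
    and R_step: "\<And>i j k y. j < m \<Longrightarrow> k < m \<Longrightarrow> n j \<le> i \<Longrightarrow> R i j k y = (\<Sum>l<m. B j l (R (i - n j) l k y))"
    and g: "\<And>k. k < m \<Longrightarrow> L1c T (g k)"
begin

section \<open>The candidate solution and its equations\<close>

text \<open>\<open>G k i\<close> plays the role of the time derivative of \<open>H k i\<close>. The
  index 0 is separate: there the term with \<open>\<phi> k\<close> is constant and has derivative 0,
  and \<open>fint 0\<close> is not the identity.\<close>

definition G :: "nat \<Rightarrow> nat \<Rightarrow> real \<Rightarrow> 'b" where
  "G k i t = (if i = 0 then g k t else kern (real i * h) t *\<^sub>R \<phi> k + fint (real i * h) (g k) t)"

definition H :: "nat \<Rightarrow> nat \<Rightarrow> real \<Rightarrow> 'b" where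
  "H k i t = kern (real i * h + 1) t *\<^sub>R \<phi> k + fint (real i * h + 1) (g k) t"

text \<open>The termwise derivative of the solution series. Taking \<open>W\<close> as its primitive
  gives differentiability of \<open>W\<close> at once; that \<open>W\<close> is the expected series
  is then a theorem, \<open>W_eq_sum\<close>.\<close>

definition v :: "nat \<Rightarrow> real \<Rightarrow> 'b" where
  "v j t = (\<Sum>k<m. \<Sum>i. R i j k (G k i t))"

definition W :: "nat \<Rightarrow> real \<Rightarrow> 'b" where
  "W j t = \<phi> j + fint 1 (v j) t"

lemma L1c_G: "k < m \<Longrightarrow> L1c T (G k i)"
  using h g by (cases "i = 0") (auto simp: G_def[abs_def] intro!: L1c_add L1c_kern L1c_fint)

lemma fint_G:
  assumes "k < m" "0 < a" "0 < t" "t \<le> T"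
  shows "fint a (G k i) t = (if i = 0 then fint a (g k) t
    else kern (a + real i * h) t *\<^sub>R \<phi> k + fint (a + real i * h) (g k) t)"
proof (cases "i = 0")
  case False
  then have p: "0 < real i * h" using h by simp
  have "fint a (G k i) t = fint a (\<lambda>\<tau>. kern (real i * h) \<tau> *\<^sub>R \<phi> k) t + fint a (fint (real i * h) (g k)) t"
    using False unfolding G_def[abs_def]
    by (simp add: fint_add[OF L1c_kern[OF p] L1c_fint[OF g[OF assms(1)] p] assms(2-4)])
  then show ?thesis
    using False by (simp add: fint_kern[OF assms(2) p assms(3)] fint_fint[OF g[OF assms(1)] assms(2) p assms(3,4)])
qed (simp add: G_def[abs_def])

lemma fint_1_G:
  assumes "k < m" "0 < t" "t \<le> T"
  shows "fint 1 (G k i) t = H k i t - (if i = 0 then \<phi> k else 0)"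
  using assms by (auto simp: fint_G H_def add.commute kern_1)

lemma order_shift: "n j \<le> i \<Longrightarrow> 1 - real (n j) * h + real i * h = real (i - n j) * h + 1"
  by (simp add: of_nat_diff algebra_simps)

text \<open>The Caputo derivative is an integral of order \<open>1 - \<beta>\<close> of the
  derivative; on the terms of the series it lowers the index by \<open>n j\<close>, exactly as
  \<open>R_step\<close> does.\<close>

lemma fint_G_shift:
  assumes "j < m" "k < m" "real (n j) * h < 1" "n j \<le> i" "0 < t" "t \<le> T"
  shows "fint (1 - real (n j) * h) (G k i) t = H k (i - n j) t"
  using assms n[OF assms(1)] by (simp add: fint_G order_shift H_def)

lemma G_shift:
  assumes "j < m" "real (n j) * h = 1" "n j \<le> i"
  shows "G k i t = H k (i - n j) t"
  using order_shift[OF assms(3)] assms(2) n[OF assms(1)] assms(3) by (auto simp: G_def H_def)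

text \<open>By \<open>kern_le_kern\<close> all terms with \<open>i > 0\<close> are bounded through
  order \<open>h\<close> alone, at the cost of
  \<open>T powr (i * h - h) * Gamma h / Gamma (i * h)\<close>. The functional equation
  \<open>Gamma (i * h + 1) = i * h * Gamma (i * h)\<close> turns these weights into the series with
  the extra factor \<open>i\<close>; at \<open>i = 0\<close> the weight is just
  \<open>C\<close>.\<close>

lemma R_G_dominated:
  obtains c :: "nat \<Rightarrow> real" where "summable c" "\<And>i. 0 \<le> c i"
    "\<And>k. k < m \<Longrightarrow> \<exists>\<psi>. L1c T \<psi> \<and> (\<forall>j<m. \<forall>i t. 0 < t \<longrightarrow> t \<le> T \<longrightarrow> norm (R i j k (G k i t)) \<le> c i * \<psi> t)"
proof -
  define K where "K = C * (Gamma h * T powr - h * h)"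
  have Gh: "0 < Gamma h" using h by (simp add: Gamma_real_pos)
  have K: "0 \<le> K" unfolding K_def using h C Gh by simp
  define c where "c i = (if i = 0 then C else 0) + K * (M ^ i * (real i * kern (real i * h + 1) T))" for i
  have kn: "0 \<le> kern (real i * h + 1) T" for i
    by (rule kern_nonneg) (use h in \<open>auto intro!: add_nonneg_pos\<close>)
  have "summable (\<lambda>i. if i = (0::nat) then C else 0)"
    by (rule summable_single)
  then have c: "summable c" unfolding c_def
    by (intro summable_add summable_mult kern_summable'[OF T h M])
  have c0: "0 \<le> c i" for i
    unfolding c_def using K kn M C by (intro add_nonneg_nonneg) auto
  have D: "C * M ^ i * (T powr (real i * h - h) * Gamma h / Gamma (real i * h)) = c i" if "0 < i" for i
  proof -
    have p: "0 < real i * h" using that h by simp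
    have "Gamma (real i * h + 1) = real i * h * Gamma (real i * h)"
      using p by (subst Gamma_plus1) (auto elim!: nonpos_Ints_cases)
    then have "K * (M ^ i * (real i * kern (real i * h + 1) T)) =
        C * (Gamma h * T powr - h * h) * (M ^ i * (real i * (T powr (real i * h) / (real i * h * Gamma (real i * h)))))"
      by (simp add: K_def kern_def)
    also have "\<dots> = C * M ^ i * (T powr (real i * h) * T powr - h * Gamma h / Gamma (real i * h))"
      using that h by simp
    also have "T powr (real i * h) * T powr - h = T powr (real i * h - h)"
      by (simp add: powr_add[symmetric])
    finally show ?thesis using that by (simp add: c_def)
  qed
  have "\<exists>\<psi>. L1c T \<psi> \<and> (\<forall>j<m. \<forall>i t. 0 < t \<longrightarrow> t \<le> T \<longrightarrow> norm (R i j k (G k i t)) \<le> c i * \<psi> t)" if k: "k < m" for k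
  proof (intro exI conjI allI impI)
    let ?N = "\<lambda>t. norm (g k t)"
    let ?\<psi> = "\<lambda>t. ?N t + (kern h t * norm (\<phi> k) + fint h ?N t)"
    have gN: "L1c T ?N" by (rule L1c_norm[OF g[OF k]])
    show "L1c T ?\<psi>"
      using L1c_kern[OF h, of T "norm (\<phi> k)"] by (intro L1c_add gN L1c_fint[OF gN h]) simp
    fix j i t assume j: "j < m" and t: "0 < t" "t \<le> T"
    have nn: "0 \<le> kern h t * norm (\<phi> k)" "0 \<le> fint h ?N t"
      by (auto intro!: mult_nonneg_nonneg kern_nonneg h fint_nonneg[OF gN h t])
    show "norm (R i j k (G k i t)) \<le> c i * ?\<psi> t"
    proof (cases "i = 0")
      case True
      have "norm (R i j k (G k i t)) \<le> C * ?N t"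
        using R_bound[OF j k, of 0 "G k 0 t"] True by (simp add: G_def)
      also have "\<dots> \<le> c i * ?\<psi> t"
        using True nn C by (simp add: c_def mult_left_mono)
      finally show ?thesis .
    next
      case False
      define d where "d = T powr (real i * h - h) * Gamma h / Gamma (real i * h)"
      have p: "0 < real i * h" "h \<le> real i * h" using False h by auto
      have d: "0 \<le> d" unfolding d_def using Gh p by (simp add: Gamma_real_nonneg)
      have kk: "kern (real i * h) s \<le> d * kern h s" if "0 \<le> s" "s \<le> T" for s
        unfolding d_def by (rule kern_le_kern[OF h p(2) that])
      have "norm (G k i t) \<le> kern (real i * h) t * norm (\<phi> k) + fint (real i * h) ?N t"
        using False norm_fint_le[OF g[OF k] p(1) t] kern_nonneg[OF p(1), of t]
        by (auto simp: G_def intro!: order_trans[OF norm_triangle_ineq] add_mono)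
      also have "\<dots> \<le> d * kern h t * norm (\<phi> k) + d * fint h ?N t"
        by (intro add_mono mult_right_mono kk fint_le_fint_kern[OF gN _ p(1) h t]) (use t in auto)
      also have "\<dots> \<le> d * ?\<psi> t"
        using d by (simp add: algebra_simps)
      finally have "norm (G k i t) \<le> d * ?\<psi> t" .
      then have "C * M ^ i * norm (G k i t) \<le> C * M ^ i * (d * ?\<psi> t)"
        by (intro mult_left_mono) (use C M in auto)
      then have "norm (R i j k (G k i t)) \<le> C * M ^ i * (d * ?\<psi> t)"
        by (rule order_trans[OF R_bound[OF j k]])
      also have "C * M ^ i * d = c i"
        unfolding d_def by (rule D) (use False in simp)
      then have "C * M ^ i * (d * ?\<psi> t) = c i * ?\<psi> t"
        by (simp only: mult.assoc[symmetric])
      finally show ?thesis .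
    qed
  qed
  then show thesis using that[of c] c c0 by blast
qed

lemma
  assumes j: "j < m" and k: "k < m"
  shows R_G_L1c: "L1c T (\<lambda>t. \<Sum>i. R i j k (G k i t))"
    and R_G_fint: "0 < a \<Longrightarrow> 0 < t \<Longrightarrow> t \<le> T \<Longrightarrow>
      (\<lambda>i. R i j k (fint a (G k i) t)) sums fint a (\<lambda>t. \<Sum>i. R i j k (G k i t)) t"
    and R_G_summable: "0 < t \<Longrightarrow> t \<le> T \<Longrightarrow> summable (\<lambda>i. R i j k (G k i t))"
proof -
  obtain c :: "nat \<Rightarrow> real" where c: "summable c" "\<And>i. 0 \<le> c i"
    and "\<exists>\<psi>. L1c T \<psi> \<and> (\<forall>j<m. \<forall>i t. 0 < t \<longrightarrow> t \<le> T \<longrightarrow> norm (R i j k (G k i t)) \<le> c i * \<psi> t)"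
    using R_G_dominated k by metis
  then obtain \<psi> where \<psi>: "L1c T \<psi>" and le: "\<And>i t. 0 < t \<Longrightarrow> t \<le> T \<Longrightarrow> norm (R i j k (G k i t)) \<le> c i * \<psi> t"
    using j by blast
  have L: "L1c T (\<lambda>t. R i j k (G k i t))" for i
    by (rule L1c_bounded_linear[OF R[OF j k] L1c_G[OF k]])
  show "L1c T (\<lambda>t. \<Sum>i. R i j k (G k i t))"
    by (rule L1c_suminf[OF L \<psi> c le])
  show "summable (\<lambda>i. R i j k (G k i t))" if "0 < t" "t \<le> T" for t
    by (rule L1c_summable[OF L \<psi> c le that])
  show "(\<lambda>i. R i j k (fint a (G k i) t)) sums fint a (\<lambda>t. \<Sum>i. R i j k (G k i t)) t"
    if a: "0 < a" and t: "0 < t" "t \<le> T" for a t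
    using fint_sums[OF L \<psi> c le a t]
    by (simp add: fint_bounded_linear[OF R[OF j k] L1c_G[OF k] a t])
qed

lemma L1c_v: "j < m \<Longrightarrow> L1c T (v j)"
  unfolding v_def[abs_def] by (intro L1c_sum R_G_L1c) auto

lemma R_fint_sums:
  assumes "j < m" "0 < a" "0 < t" "t \<le> T"
  shows "fint a (v j) t = (\<Sum>k<m. fint a (\<lambda>t. \<Sum>i. R i j k (G k i t)) t)"
  unfolding v_def[abs_def] by (rule fint_sum) (use assms in \<open>auto intro: R_G_L1c\<close>)

lemma R_H_sums:
  assumes j: "j < m" and k: "k < m" and t: "0 < t" "t \<le> T"
  shows "(\<lambda>i. R i j k (H k i t)) sums (R 0 j k (\<phi> k) + fint 1 (\<lambda>t. \<Sum>i. R i j k (G k i t)) t)"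
proof -
  have "(\<lambda>i. (if i = 0 then R 0 j k (\<phi> k) else 0) + R i j k (fint 1 (G k i) t)) sums
     (R 0 j k (\<phi> k) + fint 1 (\<lambda>t. \<Sum>i. R i j k (G k i t)) t)"
    using R_G_fint[OF j k _ t, of 1] sums_single[of 0 "\<lambda>_. R 0 j k (\<phi> k)"]
    by (intro sums_add) auto
  moreover have "(if i = 0 then R 0 j k (\<phi> k) else 0) + R i j k (fint 1 (G k i) t) = R i j k (H k i t)" for i
    using bounded_linear.linear[OF R[OF j k, of i]]
    by (simp add: fint_1_G[OF k t] linear_diff linear_0)
  ultimately show ?thesis by simp
qed

text \<open>Integrating \<open>G\<close> term by term gives back \<open>H\<close> except for the
  constant at index 0, and since \<open>R 0\<close> is the identity matrix that constant is
  \<open>\<phi> j\<close>.\<close>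

lemma W_eq_sum:
  assumes j: "j < m" and t: "0 < t" "t \<le> T"
  shows "W j t = (\<Sum>k<m. \<Sum>i. R i j k (H k i t))"
proof -
  have "(\<Sum>k<m. \<Sum>i. R i j k (H k i t)) = (\<Sum>k<m. R 0 j k (\<phi> k) + fint 1 (\<lambda>t. \<Sum>i. R i j k (G k i t)) t)"
    using R_H_sums[OF j _ t] by (intro sum.cong) (auto simp: sums_iff)
  also have "\<dots> = (\<Sum>k<m. R 0 j k (\<phi> k)) + fint 1 (v j) t"
    using R_fint_sums[OF j _ t, of 1] by (simp add: sum.distrib)
  also have "(\<Sum>k<m. R 0 j k (\<phi> k)) = (\<Sum>k<m. if k = j then \<phi> k else 0)"
    using j by (intro sum.cong) (auto simp: R_0)
  also have "\<dots> = \<phi> j"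
    using j by simp
  finally show ?thesis by (simp add: W_def)
qed

text \<open>Of the indices below \<open>n j\<close> only 0 survives and contributes
  \<open>X j 0\<close>; from \<open>n j\<close> on, \<open>R_step\<close> and an index shift
  reproduce the series of \<open>W\<close>. The family \<open>X\<close> is left abstract because it
  is \<open>G\<close> for order 1 and a fractional integral of \<open>G\<close> otherwise.\<close>

lemma system_step:
  assumes j: "j < m" and t: "0 < t" "t \<le> T"
    and S: "\<And>k. k < m \<Longrightarrow> (\<lambda>i. R i j k (X k i)) sums S k"
    and X: "\<And>k i. k < m \<Longrightarrow> n j \<le> i \<Longrightarrow> X k i = H k (i - n j) t"
  shows "(\<Sum>k<m. S k) = X j 0 + (\<Sum>l<m. B j l (W l t))"
proof -
  have Sk: "S k = R 0 j k (X k 0) + (\<Sum>l<m. B j l (\<Sum>i. R i l k (H k i t)))" if k: "k < m" for k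
  proof -
    have 1: "(\<lambda>i. R (i + n j) j k (X k (i + n j))) sums (S k - (\<Sum>i<n j. R i j k (X k i)))"
      using S[OF k] by (rule sums_split_initial_segment)
    have "(\<Sum>i<n j. R i j k (X k i)) = (\<Sum>i<n j. if i = 0 then R 0 j k (X k 0) else 0)"
      using R_small[OF j k] by (intro sum.cong) auto
    also have "\<dots> = R 0 j k (X k 0)"
      using n[OF j] by simp
    finally have 2: "(\<Sum>i<n j. R i j k (X k i)) = R 0 j k (X k 0)" .
    have 3: "(\<lambda>i. R (i + n j) j k (X k (i + n j))) = (\<lambda>i. \<Sum>l<m. B j l (R i l k (H k i t)))"
      by (simp add: R_step[OF j k] X[OF k])
    have "(\<lambda>i. \<Sum>l<m. B j l (R i l k (H k i t))) sums (\<Sum>l<m. B j l (\<Sum>i. R i l k (H k i t)))"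
      using R_H_sums[OF _ k t] by (intro sums_sum bounded_linear.sums[OF B[OF j]]) (auto simp: sums_iff)
    then have "S k - R 0 j k (X k 0) = (\<Sum>l<m. B j l (\<Sum>i. R i l k (H k i t)))"
      using 1 unfolding 2 3 by (rule sums_unique2[rotated])
    then show ?thesis by (simp add: algebra_simps)
  qed
  have "(\<Sum>k<m. S k) = (\<Sum>k<m. R 0 j k (X k 0)) + (\<Sum>k<m. \<Sum>l<m. B j l (\<Sum>i. R i l k (H k i t)))"
    using Sk by (simp add: sum.distrib)
  also have "(\<Sum>k<m. R 0 j k (X k 0)) = (\<Sum>k<m. if k = j then X k 0 else 0)"
    using j by (intro sum.cong) (auto simp: R_0)
  also have "\<dots> = X j 0" using j by simp
  also have "(\<Sum>k<m. \<Sum>l<m. B j l (\<Sum>i. R i l k (H k i t))) = (\<Sum>l<m. B j l (W l t))"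
    using t by (subst sum.swap)
      (auto simp: W_eq_sum linear_sum[OF bounded_linear.linear[OF B[OF j]]] intro!: sum.cong)
  finally show ?thesis .
qed

lemma system_order_1:
  assumes j: "j < m" and nh: "real (n j) * h = 1" and t: "0 < t" "t \<le> T"
  shows "v j t = g j t + (\<Sum>l<m. B j l (W l t))"
  unfolding v_def
  using system_step[OF j t, of "\<lambda>k i. G k i t"] R_G_summable[OF j _ t] G_shift[OF j nh]
  by (simp add: summable_sums G_def)

lemma system_fractional:
  assumes j: "j < m" and nh: "real (n j) * h < 1" and t: "0 < t" "t \<le> T"
  shows "fint (1 - real (n j) * h) (v j) t = fint (1 - real (n j) * h) (g j) t + (\<Sum>l<m. B j l (W l t))"
proof -
  have a: "0 < 1 - real (n j) * h" using nh by simp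
  show ?thesis
    unfolding R_fint_sums[OF j a t]
    by (subst system_step[OF j t, of "\<lambda>k i. fint (1 - real (n j) * h) (G k i) t"])
      (use R_G_fint[OF j _ a t] fint_G_shift[OF j _ nh _ t] in \<open>auto simp: fint_G[OF j a t]\<close>)
qed

lemma W_0: "W j 0 = \<phi> j"
  by (simp add: W_def)

lemma continuous_W: "j < m \<Longrightarrow> continuous_on {0..T} (W j)"
  unfolding W_def[abs_def] by (intro continuous_intros continuous_on_fint_1 L1c_v)

lemma continuous_BW: "j < m \<Longrightarrow> continuous_on {0..T} (\<lambda>\<tau>. \<Sum>l<m. B j l (W l \<tau>))"
  by (intro continuous_on_sum bounded_linear.continuous_on[OF B] continuous_W) auto

text \<open>For fractional order, \<open>J = J^\<beta> J^(1-\<beta>)\<close> is applied to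
  \<open>system_fractional\<close>. This integrated form is what the uniqueness proof compares with
  an arbitrary solution.\<close>

lemma W_integral_equation:
  assumes j: "j < m" and nh: "real (n j) * h \<le> 1" and t: "0 < t" "t \<le> T"
  shows "W j t = \<phi> j + fint 1 (g j) t + fint (real (n j) * h) (\<lambda>\<tau>. \<Sum>l<m. B j l (W l \<tau>)) t"
proof -
  have p: "0 < real (n j) * h" using n[OF j] h by simp
  have LB: "L1c T (\<lambda>\<tau>. \<Sum>l<m. B j l (W l \<tau>))" by (rule L1c_continuous[OF continuous_BW[OF j]])
  consider (1) "real (n j) * h = 1" | (2) "real (n j) * h < 1" using nh by linarith
  then have "fint 1 (v j) t = fint 1 (g j) t + fint (real (n j) * h) (\<lambda>\<tau>. \<Sum>l<m. B j l (W l \<tau>)) t"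
  proof cases
    case 1
    have "fint 1 (v j) t = fint 1 (\<lambda>\<tau>. g j \<tau> + (\<Sum>l<m. B j l (W l \<tau>))) t"
      by (rule fint_cong) (use system_order_1[OF j 1] t in auto)
    then show ?thesis
      using fint_add[OF g[OF j] LB _ t, of 1] 1 by simp
  next
    case 2
    let ?a = "1 - real (n j) * h"
    have a: "0 < ?a" using 2 by simp
    have "fint 1 (v j) t = fint (real (n j) * h) (fint ?a (v j)) t"
      by (simp add: fint_fint[OF L1c_v[OF j] p a t])
    also have "\<dots> = fint (real (n j) * h) (\<lambda>\<tau>. fint ?a (g j) \<tau> + (\<Sum>l<m. B j l (W l \<tau>))) t"
      by (rule fint_cong) (use system_fractional[OF j 2] t in auto)
    also have "\<dots> = fint (real (n j) * h) (fint ?a (g j)) t + fint (real (n j) * h) (\<lambda>\<tau>. \<Sum>l<m. B j l (W l \<tau>)) t"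
      by (rule fint_add[OF L1c_fint[OF g[OF j] a] LB p t])
    also have "fint (real (n j) * h) (fint ?a (g j)) t = fint 1 (g j) t"
      by (simp add: fint_fint[OF g[OF j] p a t])
    finally show ?thesis .
  qed
  then show ?thesis by (simp add: W_def)
qed

text \<open>Used with \<open>E\<close> the space of sequences that encode vectors: it certifies that
  the solution found among all bounded sequences really encodes vectors.\<close>

lemma
  assumes E: "closed E" "subspace E" and \<phi>: "\<And>k. k < m \<Longrightarrow> \<phi> k \<in> E"
    and gE: "\<And>k \<tau>. k < m \<Longrightarrow> 0 < \<tau> \<Longrightarrow> \<tau> \<le> T \<Longrightarrow> g k \<tau> \<in> E"
    and RE: "\<And>i j k y. j < m \<Longrightarrow> k < m \<Longrightarrow> y \<in> E \<Longrightarrow> R i j k y \<in> E" and j: "j < m"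
  shows v_mem: "0 < t \<Longrightarrow> t \<le> T \<Longrightarrow> v j t \<in> E" and W_mem: "0 \<le> t \<Longrightarrow> t \<le> T \<Longrightarrow> W j t \<in> E"
proof -
  have GE: "G k i t \<in> E" if "k < m" "0 < t" "t \<le> T" for k i t
  proof (cases "i = 0")
    case False
    then have p: "0 < real i * h" using h by simp
    have "fint (real i * h) (g k) t \<in> E"
      by (rule fint_mem_closed_subspace[OF E _ fint_integrable[OF g[OF that(1)] p that(2,3)]])
        (use gE that in auto)
    then show ?thesis
      using False \<phi> that E(2) by (simp add: G_def subspace_add subspace_scale)
  qed (use gE that in \<open>simp add: G_def\<close>)
  show v: "v j t \<in> E" if "0 < t" "t \<le> T" for t
    unfolding v_def
    by (intro subspace_sum[OF E(2)] suminf_mem_closed_subspace[OF E] RE GE R_G_summable)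
      (use j that in auto)
  show "W j t \<in> E" if "0 \<le> t" "t \<le> T" for t
  proof (cases "t = 0")
    case False
    then have t: "0 < t" "t \<le> T" using that by auto
    have "fint 1 (v j) t \<in> E"
      by (rule fint_mem_closed_subspace[OF E _ fint_integrable[OF L1c_v[OF j] _ t]])
        (use v t in auto)
    then show ?thesis using \<phi>[OF j] E(2) by (simp add: W_def subspace_add)
  qed (use \<phi>[OF j] in \<open>simp add: W_0\<close>)
qed

end

section \<open>Solution operator, Duhamel formula and iterated Volterra operator\<close>

context frac_system
begin

definition sol :: "nat \<Rightarrow> nat \<Rightarrow> real \<Rightarrow> 'b \<Rightarrow> 'b" where
  "sol j k t y = (\<Sum>i. kern (real i * h + 1) t *\<^sub>R R i j k y)"

lemma sol_sums:
  assumes "j < m" "k < m" "0 < t"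
  shows "(\<lambda>i. kern (real i * h + 1) t *\<^sub>R R i j k y) sums sol j k t y"
  unfolding sol_def
proof (rule summable_sums, rule summable_comparison_test'[where N=0])
  show "summable (\<lambda>i. M ^ i * kern (real i * h + 1) t * (C * norm y))"
    by (intro summable_mult2 kern_summable assms h M)
  fix i :: nat
  have "0 \<le> kern (real i * h + 1) t"
    by (rule kern_nonneg) (use h in \<open>auto intro!: add_nonneg_pos\<close>)
  then show "norm (kern (real i * h + 1) t *\<^sub>R R i j k y) \<le> M ^ i * kern (real i * h + 1) t * (C * norm y)"
    using mult_left_mono[OF R_bound[OF assms(1,2), of i y], of "kern (real i * h + 1) t"]
    by (simp add: mult_ac)
qed

lemma duhamel:
  assumes j: "j < m" and k: "k < m" and t: "0 < t" "t \<le> T"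
  shows "(\<lambda>\<tau>. sol j k (t - \<tau>) (g k \<tau>)) integrable_on {0..t}"
    and "(\<lambda>i. R i j k (fint (real i * h + 1) (g k) t)) sums integral {0..t} (\<lambda>\<tau>. sol j k (t - \<tau>) (g k \<tau>))"
proof -
  \<comment> \<open>Repairs the value of \<open>kern 1\<close> at 0, so that every kernel of the
    series is continuous on the closed interval.\<close>
  define K where "K i s = (if i = 0 then 1 else kern (real i * h + 1) s)" for i s
  have K: "K i s = kern (real i * h + 1) s" if "0 < s" for i s
    using that by (simp add: K_def kern_1)
  have Kc: "continuous_on {0..T} (K i)" for i
    using h unfolding K_def[abs_def] by (cases "i = 0") (auto intro: continuous_on_kern')
  define f where "f i \<tau> = K i (t - \<tau>) *\<^sub>R R i j k (g k \<tau>)" for i \<tau>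
  have gt: "L1c t (g k)" by (rule L1c_subset[OF g[OF k] t(2)])
  have knn: "0 \<le> kern (real i * h + 1) s" for i s
    by (rule kern_nonneg) (use h in \<open>auto intro!: add_nonneg_pos\<close>)
  have Kle: "0 \<le> K i s" "K i s \<le> kern (real i * h + 1) T" if "0 \<le> s" "s \<le> T" for i s
  proof -
    show "0 \<le> K i s" by (auto simp: K_def knn)
    show "K i s \<le> kern (real i * h + 1) T"
    proof (cases "s = 0 \<or> i = 0")
      case False
      then show ?thesis using that h by (auto simp: K_def intro!: kern_mono)
    qed (use T knn in \<open>auto simp: K_def kern_1\<close>)
  qed
  have le: "norm (f i \<tau>) \<le> C * (M ^ i * kern (real i * h + 1) T) * norm (g k \<tau>)" if \<tau>: "0 < \<tau>" "\<tau> \<le> t" for i \<tau>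
  proof -
    have "norm (f i \<tau>) = K i (t - \<tau>) * norm (R i j k (g k \<tau>))"
      using Kle(1)[of "t - \<tau>" i] \<tau> t by (simp add: f_def)
    also have "\<dots> \<le> kern (real i * h + 1) T * (C * M ^ i * norm (g k \<tau>))"
      using Kle[of "t - \<tau>" i] \<tau> t R_bound[OF j k] knn by (intro mult_mono) auto
    finally show ?thesis by (simp add: mult_ac)
  qed
  have fc: "continuous_on {0<..t} (f i)" for i
    unfolding f_def[abs_def]
  proof (rule continuous_on_scaleR)
    show "continuous_on {0<..t} (\<lambda>\<tau>. K i (t - \<tau>))"
      by (rule continuous_on_compose2[OF Kc]) (use t in \<open>auto intro!: continuous_intros\<close>)
    show "continuous_on {0<..t} (\<lambda>\<tau>. R i j k (g k \<tau>))"
      using gt by (intro bounded_linear.continuous_on[OF R[OF j k]]) (simp add: L1c_def)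
  qed
  have Lf: "L1c t (f i)" for i
    by (rule L1cI[OF fc, where \<phi>="\<lambda>\<tau>. C * (M ^ i * kern (real i * h + 1) T) * norm (g k \<tau>)"])
      (use gt le in \<open>auto simp: L1c_def intro: integrable_on_mult_right\<close>)
  have c: "summable (\<lambda>i. C * (M ^ i * kern (real i * h + 1) T))"
    by (intro summable_mult kern_summable T h M)
  have c0: "0 \<le> C * (M ^ i * kern (real i * h + 1) T)" for i
    using C M knn by simp
  have sum_f: "(\<Sum>i. f i \<tau>) = sol j k (t - \<tau>) (g k \<tau>)" if "0 < \<tau>" "\<tau> < t" for \<tau>
    unfolding sol_def f_def using that by (simp add: K)
  have f1: "fint 1 (f i) t = R i j k (fint (real i * h + 1) (g k) t)" for i
  proof -
    have p: "0 < real i * h + 1" using h by (auto intro!: add_nonneg_pos)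
    have "fint 1 (f i) t = fint (real i * h + 1) (\<lambda>\<tau>. R i j k (g k \<tau>)) t"
      unfolding fint_1 unfolding fint_def integral_open_interval_real
      by (rule Henstock_Kurzweil_Integration.integral_cong) (auto simp: f_def K)
    then show ?thesis
      by (simp add: fint_bounded_linear[OF R[OF j k] gt p t(1) order_refl])
  qed
  have "L1c t (\<lambda>\<tau>. \<Sum>i. f i \<tau>)"
    by (rule L1c_suminf[OF Lf L1c_norm[OF gt] c c0 le])
  then have "(\<lambda>\<tau>. \<Sum>i. f i \<tau>) integrable_on {0..t}" by (rule L1c_integrable)
  then show "(\<lambda>\<tau>. sol j k (t - \<tau>) (g k \<tau>)) integrable_on {0..t}"
    by (rule integrable_spike_finite[of "{0, t}", rotated 2]) (auto simp: sum_f)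
  have "(\<lambda>i. fint 1 (f i) t) sums fint 1 (\<lambda>\<tau>. \<Sum>i. f i \<tau>) t"
    by (rule fint_sums[OF Lf L1c_norm[OF gt] c c0 le]) (use t in auto)
  moreover have "fint 1 (\<lambda>\<tau>. \<Sum>i. f i \<tau>) t = integral {0..t} (\<lambda>\<tau>. sol j k (t - \<tau>) (g k \<tau>))"
    unfolding fint_1 integral_open_interval_real
    by (rule Henstock_Kurzweil_Integration.integral_cong) (auto simp: sum_f)
  ultimately show "(\<lambda>i. R i j k (fint (real i * h + 1) (g k) t)) sums integral {0..t} (\<lambda>\<tau>. sol j k (t - \<tau>) (g k \<tau>))"
    by (simp add: f1)
qed

lemma W_representation:
  assumes j: "j < m" and t: "0 < t" "t \<le> T"
  shows "W j t = (\<Sum>k<m. sol j k t (\<phi> k) + integral {0..t} (\<lambda>\<tau>. sol j k (t - \<tau>) (g k \<tau>)))"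
  unfolding W_eq_sum[OF j t]
proof (rule sum.cong)
  fix k assume "k \<in> {..<m}"
  then have k: "k < m" by simp
  have "(\<lambda>i. kern (real i * h + 1) t *\<^sub>R R i j k (\<phi> k) + R i j k (fint (real i * h + 1) (g k) t)) sums
      (sol j k t (\<phi> k) + integral {0..t} (\<lambda>\<tau>. sol j k (t - \<tau>) (g k \<tau>)))"
    by (intro sums_add sol_sums duhamel j k t)
  moreover have "R i j k (H k i t) = kern (real i * h + 1) t *\<^sub>R R i j k (\<phi> k) + R i j k (fint (real i * h + 1) (g k) t)" for i
    using bounded_linear.linear[OF R[OF j k, of i]] by (simp add: H_def linear_add linear_scale)
  ultimately show "(\<Sum>i. R i j k (H k i t)) = sol j k t (\<phi> k) + integral {0..t} (\<lambda>\<tau>. sol j k (t - \<tau>) (g k \<tau>))"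
    by (simp add: sums_iff)
qed simp

definition volterra :: "(nat \<Rightarrow> real \<Rightarrow> 'b) \<Rightarrow> nat \<Rightarrow> real \<Rightarrow> 'b" where
  "volterra V j = fint (real (n j) * h) (\<lambda>\<tau>. \<Sum>l<m. B j l (V l \<tau>))"

lemma continuous_volterra:
  assumes "\<And>j. j < m \<Longrightarrow> continuous_on {0..T} (V j)" "j < m"
  shows "continuous_on {0..T} (volterra V j)"
  unfolding volterra_def
  by (intro fint_continuous continuous_on_sum bounded_linear.continuous_on[OF B] assms)
    (use assms n h in auto)

lemma continuous_volterra_pow:
  assumes "\<And>j. j < m \<Longrightarrow> continuous_on {0..T} (V j)" "j < m"
  shows "continuous_on {0..T} ((volterra ^^ N) V j)"
  using assms(2) by (induction N arbitrary: j) (auto simp: assms(1) intro!: continuous_volterra)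

text \<open>Each iteration raises the kernel order by \<open>h\<close>: \<open>b\<close> bounds the
  operators, \<open>D\<close> the passage from \<open>kern (n j * h)\<close> to
  \<open>kern h\<close>, and the \<open>N\<close>-th iterate is at most
  \<open>c * (D * b)^N * kern (N * h + 1) t\<close>, a multiple of the general term of a convergent
  series.\<close>

lemma volterra_pow_tendsto_0:
  assumes V: "\<And>j. j < m \<Longrightarrow> continuous_on {0..T} (V j)" and j: "j < m" and t: "0 < t" "t \<le> T"
  shows "(\<lambda>N. (volterra ^^ N) V j t) \<longlonglongrightarrow> 0"
proof -
  have "\<exists>b. \<forall>y. norm (B j k y) \<le> norm y * b" if "j < m" "k < m" for j k
    using bounded_linear.bounded[OF B[OF that]] .
  then obtain bb where bb: "\<And>j k y. j < m \<Longrightarrow> k < m \<Longrightarrow> norm (B j k y) \<le> norm y * bb j k"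
    by metis
  define b where "b = (\<Sum>j<m. \<Sum>k<m. \<bar>bb j k\<bar>)"
  have b0: "0 \<le> b" unfolding b_def by (intro sum_nonneg) auto
  have b: "norm (\<Sum>l<m. B j l (y l)) \<le> b * c" if "j < m" "\<And>l. l < m \<Longrightarrow> norm (y l) \<le> c" "0 \<le> c" for j y c
  proof -
    have "norm (\<Sum>l<m. B j l (y l)) \<le> (\<Sum>l<m. \<bar>bb j l\<bar> * c)"
    proof (rule order_trans[OF norm_sum sum_mono])
      fix l assume "l \<in> {..<m}"
      then have l: "l < m" by simp
      have "norm (B j l (y l)) \<le> norm (y l) * bb j l" by (rule bb[OF that(1) l])
      also have "\<dots> \<le> norm (y l) * \<bar>bb j l\<bar>" by (intro mult_left_mono) auto
      also have "\<dots> \<le> \<bar>bb j l\<bar> * c"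
        using mult_right_mono[OF that(2)[OF l], of "\<bar>bb j l\<bar>"] by (simp add: mult.commute)
      finally show "norm (B j l (y l)) \<le> \<bar>bb j l\<bar> * c" .
    qed
    also have "\<dots> = (\<Sum>l<m. \<bar>bb j l\<bar>) * c" by (simp add: sum_distrib_right)
    also have "(\<Sum>l<m. \<bar>bb j l\<bar>) \<le> b"
      unfolding b_def using that(1)
      by (intro member_le_sum[of j "{..<m}" "\<lambda>j. \<Sum>l<m. \<bar>bb j l\<bar>"]) (auto intro: sum_nonneg)
    then have "(\<Sum>l<m. \<bar>bb j l\<bar>) * c \<le> b * c" using that(3) by (rule mult_right_mono)
    finally show ?thesis .
  qed
  define d where "d j = T powr (real (n j) * h - h) * Gamma h / Gamma (real (n j) * h)" for j
  have p: "0 < real (n j) * h" "h \<le> real (n j) * h" if "j < m" for j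
    using n[OF that] h by auto
  have d0: "0 \<le> d j" if "j < m" for j
    unfolding d_def using h p[OF that] by (intro divide_nonneg_nonneg mult_nonneg_nonneg) (auto simp: Gamma_real_nonneg)
  define D where "D = (\<Sum>j<m. d j)"
  have D: "d j \<le> D" if "j < m" for j
    unfolding D_def using that d0 by (intro member_le_sum) auto
  have D0: "0 \<le> D" unfolding D_def using d0 by (intro sum_nonneg) auto
  have kD: "kern (real (n j) * h) s \<le> D * kern h s" if "j < m" "0 \<le> s" "s \<le> T" for j s
    using kern_le_kern[OF h p(2)[OF that(1)] that(2,3)] mult_right_mono[OF D[OF that(1)] kern_nonneg[OF h]]
    unfolding d_def by (rule order_trans)
  have "\<exists>c. \<forall>t\<in>{0..T}. norm (V j t) \<le> c" if "j < m" for j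
  proof -
    have "compact (V j ` {0..T})" by (intro compact_continuous_image V that) simp
    from compact_imp_bounded[OF this] show ?thesis unfolding bounded_iff by auto
  qed
  then obtain cc where cc: "\<And>j t. j < m \<Longrightarrow> 0 \<le> t \<Longrightarrow> t \<le> T \<Longrightarrow> norm (V j t) \<le> cc j"
    by (metis atLeastAtMost_iff)
  define c where "c = (\<Sum>j<m. \<bar>cc j\<bar>)"
  have c0: "0 \<le> c" unfolding c_def by (intro sum_nonneg) auto
  have c: "norm (V j t) \<le> c" if "j < m" "0 \<le> t" "t \<le> T" for j t
    using cc[OF that] member_le_sum[of j "{..<m}" "\<lambda>j. \<bar>cc j\<bar>"] that(1) unfolding c_def by force
  have bound: "norm ((volterra ^^ N) V j t) \<le> c * ((D * b) ^ N * kern (real N * h + 1) t)"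
    if "j < m" "0 < t" "t \<le> T" for N j t
    using that
  proof (induction N arbitrary: j t)
    case 0
    then show ?case by (simp add: kern_1 c)
  next
    case (Suc N)
    let ?V = "(volterra ^^ N) V"
    let ?k = "\<lambda>\<tau>. kern (real N * h + 1) \<tau>"
    have kp: "0 < real N * h + 1" using h by (auto intro!: add_nonneg_pos)
    define A where "A = b * (c * (D * b) ^ N)"
    have A: "0 \<le> A" unfolding A_def using b0 c0 D0 by simp
    have Lk: "L1c T ?k" using L1c_kern[OF kp, of T "1::real"] by simp
    have LV: "L1c T (\<lambda>\<tau>. \<Sum>l<m. B j l (?V l \<tau>))"
      by (intro L1c_continuous continuous_on_sum bounded_linear.continuous_on[OF B] continuous_volterra_pow V)
        (use Suc.prems in auto)
    have "norm ((volterra ^^ Suc N) V j t) = norm (fint (real (n j) * h) (\<lambda>\<tau>. \<Sum>l<m. B j l (?V l \<tau>)) t)"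
      by (simp add: volterra_def)
    also have "\<dots> \<le> fint (real (n j) * h) (\<lambda>\<tau>. A * ?k \<tau>) t"
    proof (rule norm_fint_le_fint[OF LV])
      show "L1c T (\<lambda>\<tau>. A * ?k \<tau>)" using L1c_scaleR[OF Lk, of A] by simp
      fix \<tau> assume \<tau>: "0 < \<tau>" "\<tau> < t"
      have "norm (\<Sum>l<m. B j l (?V l \<tau>)) \<le> b * (c * ((D * b) ^ N * ?k \<tau>))"
        by (rule b) (use Suc \<tau> c0 D0 b0 kern_nonneg[OF kp] in auto)
      then show "norm (\<Sum>l<m. B j l (?V l \<tau>)) \<le> A * ?k \<tau>"
        by (simp add: A_def mult.assoc)
    qed (use Suc.prems p in auto)
    also have "\<dots> = A * fint (real (n j) * h) ?k t"
      using fint_bounded_linear[OF bounded_linear_mult_right Lk, of "real (n j) * h" t A] Suc.prems p by simp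
    also have "\<dots> \<le> A * (D * fint h ?k t)"
      by (intro mult_left_mono A fint_le_fint_kern[OF Lk])
        (use Suc.prems p h kD kern_nonneg[OF kp] in auto)
    also have "fint h ?k t = kern (real (Suc N) * h + 1) t"
      using fint_kern[OF h kp Suc.prems(2), of "1::real"] by (simp add: algebra_simps)
    finally show ?case
      by (simp add: A_def mult_ac)
  qed
  show ?thesis
  proof (rule Lim_null_comparison)
    show "\<forall>\<^sub>F N in sequentially. norm ((volterra ^^ N) V j t) \<le> c * ((D * b) ^ N * kern (real N * h + 1) t)"
      using bound[OF j t] by simp
    have "(\<lambda>N. (D * b) ^ N * kern (real N * h + 1) t) \<longlonglongrightarrow> 0"
      by (rule summable_LIMSEQ_zero[OF kern_summable[OF t(1) h]]) (use D0 b0 in simp)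
    then show "(\<lambda>N. c * ((D * b) ^ N * kern (real N * h + 1) t)) \<longlonglongrightarrow> 0"
      using tendsto_mult_left[of _ 0 sequentially c] by simp
  qed
qed

end

section \<open>The functional calculus on sequences\<close>

interpretation scaleC: bounded_bilinear "scaleC :: complex \<Rightarrow> 'a::complex_banach \<Rightarrow> 'a"
proof
  fix a b :: complex and x y :: 'a and r :: real
  show "(a + b) *\<^sub>C x = a *\<^sub>C x + b *\<^sub>C x" by (rule scaleC_add_left)
  show "a *\<^sub>C (x + y) = a *\<^sub>C x + a *\<^sub>C y" by (rule scaleC_add_right)
  show "(r *\<^sub>R a) *\<^sub>C x = r *\<^sub>R (a *\<^sub>C x)"
    by (simp add: scaleR_scaleC scaleC_scaleC scaleR_conv_of_real)
  show "a *\<^sub>C r *\<^sub>R x = r *\<^sub>R (a *\<^sub>C x)"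
    by (simp add: scaleR_scaleC scaleC_scaleC mult.commute)
  show "\<exists>K. \<forall>(a::complex) (b::'a). norm (a *\<^sub>C b) \<le> norm a * norm b * K"
    by (rule exI[of _ 1]) (simp add: norm_scaleC)
qed

text \<open>The power series with coefficients \<open>a\<close> in the backward shift on bounded
  sequences. On \<open>espace\<close> that shift is \<open>(A - l) / \<mu>\<close>, so this will be
  \<open>f(A)\<close> for weighted Taylor coefficients \<open>a\<close>.\<close>

definition act :: "(nat \<Rightarrow> complex) \<Rightarrow> (nat \<Rightarrow>\<^sub>C 'a::complex_banach) \<Rightarrow> (nat \<Rightarrow>\<^sub>C 'a)" where
  "act a u = Bcontfun (\<lambda>k. \<Sum>i. a i *\<^sub>C apply_bcontfun u (i + k))"

lemma norm_apply_bcontfun: "norm (apply_bcontfun u k) \<le> norm u"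
  using norm_bounded[of u k] .

lemma Bcontfun_nat_inverse:
  fixes f :: "nat \<Rightarrow> 'b::real_normed_vector"
  assumes "\<And>k. norm (f k) \<le> B"
  shows "apply_bcontfun (Bcontfun f) = f"
  by (rule Bcontfun_inverse, rule bcontfun_normI) (use assms in \<open>auto intro: continuous_on_discrete\<close>)

lemma norm_bcontfun_le:
  assumes "\<And>k. norm (apply_bcontfun u k) \<le> B"
  shows "norm u \<le> B"
  by (rule norm_bound[OF assms])

context
  fixes a :: "nat \<Rightarrow> complex"
  assumes a: "summable (\<lambda>i. norm (a i))"
begin

lemma act_summable_norm: "summable (\<lambda>i. norm (a i *\<^sub>C apply_bcontfun u (i + k)))"
  by (rule summable_comparison_test'[OF summable_mult2[OF a, of "norm u"], where N=0])
    (simp add: norm_scaleC mult_left_mono norm_apply_bcontfun)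

lemma act_summable: "summable (\<lambda>i. a i *\<^sub>C apply_bcontfun u (i + k))"
  by (rule summable_norm_cancel[OF act_summable_norm])

lemma act_term_bound: "norm (\<Sum>i. a i *\<^sub>C apply_bcontfun u (i + k)) \<le> (\<Sum>i. norm (a i)) * norm u"
proof -
  have "norm (\<Sum>i. a i *\<^sub>C apply_bcontfun u (i + k)) \<le> (\<Sum>i. norm (a i *\<^sub>C apply_bcontfun u (i + k)))"
    by (rule summable_norm[OF act_summable_norm])
  also have "\<dots> \<le> (\<Sum>i. norm (a i) * norm u)"
    by (rule suminf_le[OF _ act_summable_norm summable_mult2[OF a]])
      (simp add: norm_scaleC mult_left_mono norm_apply_bcontfun)
  also have "\<dots> = (\<Sum>i. norm (a i)) * norm u"
    by (rule suminf_mult2[OF a, symmetric])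
  finally show ?thesis .
qed

lemma act_apply: "apply_bcontfun (act a u) k = (\<Sum>i. a i *\<^sub>C apply_bcontfun u (i + k))"
  unfolding act_def by (subst Bcontfun_nat_inverse[OF act_term_bound]) simp

lemma norm_act_le: "norm (act a u) \<le> (\<Sum>i. norm (a i)) * norm u"
  by (rule norm_bcontfun_le) (simp add: act_apply act_term_bound)

lemma bounded_linear_act: "bounded_linear (act a)"
proof (rule bounded_linear_intro)
  show "act a (u + w) = act a u + act a w" for u w
    by (rule bcontfun_eqI) (simp add: act_apply scaleC.add_right suminf_add act_summable)
  show "act a (r *\<^sub>R u) = r *\<^sub>R act a u" for r u
    by (rule bcontfun_eqI) (simp add: act_apply scaleC.scaleR_right suminf_scaleR_right act_summable)
  show "norm (act a u) \<le> norm u * (\<Sum>i. norm (a i))" for u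
    using norm_act_le[of u] by (simp add: mult.commute)
qed

end

lemma apply_bcontfun_sum:
  fixes f :: "'i \<Rightarrow> nat \<Rightarrow>\<^sub>C 'b::real_normed_vector"
  shows "apply_bcontfun (\<Sum>j\<in>J. f j) k = (\<Sum>j\<in>J. apply_bcontfun (f j) k)"
  by (induction J rule: infinite_finite_induct) auto

lemma act_sum:
  assumes "\<And>j. j \<in> J \<Longrightarrow> summable (\<lambda>i. norm (a j i))"
  shows "act (\<lambda>i. \<Sum>j\<in>J. a j i) u = (\<Sum>j\<in>J. act (a j) u)"
proof -
  have s: "summable (\<lambda>i. norm (\<Sum>j\<in>J. a j i))"
    by (rule summable_comparison_test'[where N=0 and g="\<lambda>i. \<Sum>j\<in>J. norm (a j i)"])
      (auto intro: summable_sum assms norm_sum)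
  show ?thesis
    by (rule bcontfun_eqI)
      (simp add: act_apply[OF s] apply_bcontfun_sum act_apply[OF assms] scaleC.sum_left suminf_sum[OF act_summable[OF assms]])
qed

lemma act_delta: "act (\<lambda>i. if i = 0 then 1 else 0) u = u"
proof -
  have s: "summable (\<lambda>i::nat. norm (if i = 0 then 1 else (0::complex)))"
    by (rule summable_finite[of "{0}"]) auto
  have "(\<lambda>i. (if i = 0 then 1 else 0) *\<^sub>C apply_bcontfun u (i + k)) = (\<lambda>i. if i = 0 then apply_bcontfun u k else 0)" for k
    by (auto simp: scaleC_one scaleC.zero_left)
  moreover have "(\<Sum>i::nat. if i = 0 then c else 0) = c" for c :: 'a
    using sums_single[of 0 "\<lambda>_. c"] by (simp add: sums_iff)
  ultimately show ?thesis
    by (intro bcontfun_eqI) (simp add: act_apply[OF s])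
qed

lemma act_diff:
  assumes "summable (\<lambda>i. norm (a i))" "summable (\<lambda>i. norm (b i))"
  shows "act (\<lambda>i. a i - b i) u = act a u - act b u"
proof -
  have "summable (\<lambda>i. norm (a i - b i))"
    by (rule summable_comparison_test'[OF summable_add[OF assms], where N=0])
      (simp add: norm_triangle_ineq4)
  then show ?thesis
    by (intro bcontfun_eqI) (simp add: act_apply assms scaleC.diff_left suminf_diff[OF act_summable act_summable])
qed

text \<open>The double family \<open>F\<close> is absolutely summable, so its sum may be taken by
  rows, giving the composition, or by antidiagonals, giving the Cauchy product.\<close>

lemma act_mult:
  assumes a: "summable (\<lambda>i. norm (a i))" and b: "summable (\<lambda>i. norm (b i))"
  shows "act (\<lambda>n. \<Sum>i\<le>n. a i * b (n - i)) u = act a (act b u)"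
proof (rule bcontfun_eqI)
  fix k
  let ?u = "apply_bcontfun u"
  define F where "F p = (a (fst p) * b (snd p)) *\<^sub>C ?u (fst p + snd p + k)" for p :: "nat \<times> nat"
  have c: "summable (\<lambda>n. norm (\<Sum>i\<le>n. a i * b (n - i)))"
    by (rule summable_comparison_test'[OF summable_Cauchy_product[of "\<lambda>i. norm (a i)" "\<lambda>i. norm (b i)"], where N=0])
      (use a b in \<open>auto simp flip: norm_mult intro: norm_sum\<close>)
  have hb: "((\<lambda>j. norm (b j)) has_sum (\<Sum>j. norm (b j))) UNIV"
    using b by (intro norm_summable_imp_has_sum summable_sums) auto
  have ha: "(\<lambda>i. norm (a i)) summable_on UNIV"
    using a by (intro norm_summable_imp_summable_on) auto
  have "(\<lambda>p. norm (a (fst p)) * norm (b (snd p))) summable_on UNIV \<times> UNIV"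
    by (rule summable_on_SigmaI[where g="\<lambda>i. norm (a i) * (\<Sum>j. norm (b j))"])
      (auto intro: has_sum_cmult_right hb summable_on_cmult_left ha)
  then have "(\<lambda>p. norm (a (fst p)) * norm (b (snd p)) * norm u) summable_on UNIV \<times> UNIV"
    by (rule summable_on_cmult_left)
  then have "(\<lambda>p. norm (F p)) summable_on UNIV \<times> UNIV"
    by (rule summable_on_comparison_test)
      (auto simp: F_def norm_scaleC norm_mult mult_left_mono norm_apply_bcontfun)
  then have F: "F summable_on UNIV \<times> UNIV"
    by (rule abs_summable_summable)
  have inner: "infsum (\<lambda>j. F (i, j)) UNIV = a i *\<^sub>C apply_bcontfun (act b u) (i + k)" for i
  proof -
    have "(\<lambda>j. b j *\<^sub>C ?u (j + (i + k))) sums apply_bcontfun (act b u) (i + k)"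
      unfolding act_apply[OF b] by (rule summable_sums[OF act_summable[OF b]])
    then have "((\<lambda>j. b j *\<^sub>C ?u (j + (i + k))) has_sum apply_bcontfun (act b u) (i + k)) UNIV"
      by (rule norm_summable_imp_has_sum[OF act_summable_norm[OF b]])
    then have "((\<lambda>j. a i *\<^sub>C b j *\<^sub>C ?u (j + (i + k))) has_sum a i *\<^sub>C apply_bcontfun (act b u) (i + k)) UNIV"
      by (rule has_sum_bounded_linear[OF scaleC.bounded_linear_right, unfolded o_def])
    then show ?thesis
      by (intro infsumI) (simp add: F_def scaleC_scaleC add_ac)
  qed
  have "infsum F (UNIV \<times> UNIV) = infsum (\<lambda>i. a i *\<^sub>C apply_bcontfun (act b u) (i + k)) UNIV"
    using infsum_Sigma_banach[OF F] by (simp add: inner)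
  also have "\<dots> = apply_bcontfun (act a (act b u)) k"
    unfolding act_apply[OF a]
    by (intro infsumI norm_summable_imp_has_sum act_summable_norm[OF a] summable_sums act_summable[OF a])
  finally have 1: "infsum F (UNIV \<times> UNIV) = apply_bcontfun (act a (act b u)) k" .
  \<comment> \<open>The pair \<open>(n, i)\<close> with \<open>i \<le> n\<close> is sent to
    \<open>(i, n - i)\<close>, on the antidiagonal \<open>n\<close>.\<close>
  define g where "g p = (snd p, fst p - snd p)" for p :: "nat \<times> nat"
  have bij: "bij_betw g (Sigma UNIV (\<lambda>n. {..n})) (UNIV \<times> UNIV)"
    by (rule bij_betwI[where g="\<lambda>(i, j). (i + j, i)"]) (auto simp: g_def)
  have Fg: "(\<lambda>p. F (g p)) summable_on Sigma UNIV (\<lambda>n. {..n})"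
    using F summable_on_reindex_bij_betw[OF bij] by blast
  have "infsum F (UNIV \<times> UNIV) = infsum (\<lambda>p. F (g p)) (Sigma UNIV (\<lambda>n. {..n}))"
    by (rule infsum_reindex_bij_betw[OF bij, symmetric])
  also have "\<dots> = infsum (\<lambda>n. infsum (\<lambda>i. F (g (n, i))) {..n}) UNIV"
    using infsum_Sigma_banach[OF Fg] by simp
  also have "(\<lambda>n. infsum (\<lambda>i. F (g (n, i))) {..n}) = (\<lambda>n. (\<Sum>i\<le>n. a i * b (n - i)) *\<^sub>C ?u (n + k))"
    by (rule ext) (simp add: F_def g_def scaleC.sum_left)
  also have "infsum \<dots> UNIV = apply_bcontfun (act (\<lambda>n. \<Sum>i\<le>n. a i * b (n - i)) u) k"
    unfolding act_apply[OF c]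
    by (intro infsumI norm_summable_imp_has_sum act_summable_norm[OF c] summable_sums act_summable[OF c])
  finally show "apply_bcontfun (act (\<lambda>n. \<Sum>i\<le>n. a i * b (n - i)) u) k = apply_bcontfun (act a (act b u)) k"
    using 1 by simp
qed

section \<open>Taylor coefficients of symbols and Cauchy's inequality\<close>

text \<open>The weight \<open>\<mu>^i\<close> undoes the division by powers of \<mu> in the encoding
  of vectors as bounded sequences.\<close>

definition coef :: "(complex \<Rightarrow> complex) \<Rightarrow> complex \<Rightarrow> real \<Rightarrow> nat \<Rightarrow> complex" where
  "coef f l \<mu> i = (deriv ^^ i) f l / fact i * complex_of_real (\<mu> ^ i)"

lemma norm_coef_le:
  assumes f: "f holomorphic_on G" "open G" "cball l \<rho> \<subseteq> G" and \<mu>: "0 < \<mu>" "\<mu> < \<rho>"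
    and B: "\<And>z. z \<in> cball l \<rho> \<Longrightarrow> norm (f z) \<le> B"
  shows "norm (coef f l \<mu> i) \<le> B * (\<mu> / \<rho>) ^ i"
proof -
  have "norm ((deriv ^^ i) f l) \<le> fact i * B / \<rho> ^ i"
  proof (rule Cauchy_inequality)
    show "f holomorphic_on ball l \<rho>"
      by (rule holomorphic_on_subset[OF f(1)]) (use f(3) ball_subset_cball in blast)
    show "continuous_on (cball l \<rho>) f"
      using f by (auto intro: continuous_on_subset holomorphic_on_imp_continuous_on)
    show "norm (f x) \<le> B" if "norm (l - x) = \<rho>" for x
      using B[of x] that by (simp add: dist_norm)
  qed (use \<mu> in auto)
  then have "norm ((deriv ^^ i) f l) / fact i * \<mu> ^ i \<le> fact i * B / \<rho> ^ i / fact i * \<mu> ^ i"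
    by (intro mult_right_mono divide_right_mono) (use \<mu> in auto)
  then show ?thesis
    using \<mu> by (simp add: coef_def norm_mult norm_divide norm_power power_divide)
qed

lemma summable_coef:
  assumes f: "f holomorphic_on G" "open G" "cball l \<rho> \<subseteq> G" and \<mu>: "0 < \<mu>" "\<mu> < \<rho>"
    and B: "\<And>z. z \<in> cball l \<rho> \<Longrightarrow> norm (f z) \<le> B"
  shows "summable (\<lambda>i. norm (coef f l \<mu> i))"
  by (rule summable_comparison_test'[OF summable_mult[OF summable_geometric[of "\<mu> / \<rho>"]],
        where N=0 and c1=B]) (use norm_coef_le[OF assms] \<mu> in auto)

text \<open>Summing Cauchy's inequality over the geometric ratio \<open>\<mu> / \<rho>\<close>. The
  symbol enters only through its maximum on the disc, so uniformly convergent symbols give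
  convergent operators.\<close>

lemma norm_act_coef_le:
  assumes f: "f holomorphic_on G" "open G" "cball l \<rho> \<subseteq> G" and \<mu>: "0 < \<mu>" "\<mu> < \<rho>"
    and B: "\<And>z. z \<in> cball l \<rho> \<Longrightarrow> norm (f z) \<le> B"
  shows "norm (act (coef f l \<mu>) u) \<le> B / (1 - \<mu> / \<rho>) * norm u"
proof -
  have q: "norm (\<mu> / \<rho>) < 1" using \<mu> by auto
  note s = summable_coef[OF assms]
  have "(\<Sum>i. norm (coef f l \<mu> i)) \<le> (\<Sum>i. B * (\<mu> / \<rho>) ^ i)"
    by (rule suminf_le[OF norm_coef_le[OF assms] s summable_mult[OF summable_geometric[OF q]]])
  also have "\<dots> = B / (1 - \<mu> / \<rho>)"
    using suminf_mult[OF summable_geometric[OF q], of B] suminf_geometric[OF q] by simp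
  finally show ?thesis
    using norm_act_le[OF s, of u] mult_right_mono[OF _ norm_ge_zero[of u]] by (meson order_trans)
qed

lemma summable_coef':
  assumes f: "f holomorphic_on G" "open G" "cball l \<rho> \<subseteq> G" and \<mu>: "0 < \<mu>" "\<mu> < \<rho>"
  shows "summable (\<lambda>i. norm (coef f l \<mu> i))"
proof -
  have "compact (f ` cball l \<rho>)"
    using f by (intro compact_continuous_image)
      (auto intro: continuous_on_subset holomorphic_on_imp_continuous_on)
  from compact_imp_bounded[OF this] obtain B where "\<And>z. z \<in> cball l \<rho> \<Longrightarrow> norm (f z) \<le> B"
    unfolding bounded_iff by blast
  then show ?thesis by (rule summable_coef[OF f \<mu>])
qed

text \<open>Leibniz's rule; with \<open>act_mult\<close> it makes the passage from symbols to
  operators multiplicative.\<close>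

lemma coef_mult:
  assumes "f holomorphic_on G" "g holomorphic_on G" "open G" "l \<in> G"
  shows "coef (\<lambda>z. f z * g z) l \<mu> n = (\<Sum>i\<le>n. coef f l \<mu> i * coef g l \<mu> (n - i))"
proof -
  have "of_nat (n choose i) / fact n = (1 / (fact i * fact (n - i)) :: complex)" if "i \<le> n" for i
    using binomial_fact[OF that, where ?'a=complex] by simp
  then have *: "of_nat (n choose i) * x * y / fact n * complex_of_real (\<mu> ^ n) =
      (x / fact i * complex_of_real (\<mu> ^ i)) * (y / fact (n - i) * complex_of_real (\<mu> ^ (n - i)))" if "i \<le> n" for i x y
    using that power_add[of "complex_of_real \<mu>" i "n - i"] by (simp add: field_simps)
  show ?thesis
    unfolding coef_def higher_deriv_mult[OF assms]
    unfolding sum_divide_distrib sum_distrib_right atMost_atLeast0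
    by (rule sum.cong) (use * in auto)
qed

lemma coef_sum:
  assumes "\<And>j. j \<in> J \<Longrightarrow> f j holomorphic_on G" "open G" "l \<in> G"
  shows "coef (\<lambda>z. \<Sum>j\<in>J. f j z) l \<mu> n = (\<Sum>j\<in>J. coef (f j) l \<mu> n)"
proof -
  have "(deriv ^^ n) (\<lambda>z. \<Sum>j\<in>J. f j z) l = (\<Sum>j\<in>J. (deriv ^^ n) (f j) l)"
    using assms(1)
  proof (induction J rule: infinite_finite_induct)
    case (insert j J)
    then show ?case
      using higher_deriv_add[of "f j" G "\<lambda>z. \<Sum>j\<in>J. f j z" l n] assms(2,3)
      by (auto intro: holomorphic_on_sum)
  qed (auto simp: higher_deriv_const)
  then show ?thesis
    by (simp add: coef_def sum_divide_distrib sum_distrib_right)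
qed

lemma coef_cong:
  assumes "open G" "l \<in> G" "\<And>z. z \<in> G \<Longrightarrow> f z = g z"
  shows "coef f l \<mu> n = coef g l \<mu> n"
proof -
  have "(deriv ^^ n) f l = (deriv ^^ n) g l"
    by (rule higher_deriv_cong_ev) (use assms in \<open>auto intro: eventually_nhds_in_open[THEN eventually_mono]\<close>)
  then show ?thesis by (simp add: coef_def)
qed

text \<open>The library proves completeness of \<open>bcontfun\<close> only over a metric space.\<close>

instantiation nat :: metric_space
begin

definition dist_nat :: "nat \<Rightarrow> nat \<Rightarrow> real" where
  "dist_nat m n = \<bar>real m - real n\<bar>"

definition uniformity_nat :: "(nat \<times> nat) filter" where
  "uniformity_nat = (INF e\<in>{0<..}. principal {(x, y). dist x y < e})"

instance
proof
  show "uniformity = (INF e\<in>{0<..}. principal {(x :: nat, y). dist x y < e})"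
    by (rule uniformity_nat_def)
  have ev: "eventually P uniformity \<longleftrightarrow> (\<exists>e>0. \<forall>x y. dist x y < e \<longrightarrow> P (x, y))" for P :: "nat \<times> nat \<Rightarrow> bool"
    unfolding uniformity_nat_def
    by (subst eventually_INF_base)
      (auto simp: eventually_principal subset_eq intro: bexI[of _ "min _ _"])
  have "dist x y < 1 \<longleftrightarrow> x = y" for x y :: nat
    by (auto simp: dist_nat_def)
  then show "open U \<longleftrightarrow> (\<forall>x\<in>U. \<forall>\<^sub>F (x', y) in uniformity. x' = x \<longrightarrow> y \<in> U)" for U :: "nat set"
    using open_discrete[of U] by (auto simp: ev intro!: exI[of _ "1::real"])
qed (auto simp: dist_nat_def)

end

instance bcontfun :: (metric_space, banach) banach ..

section \<open>Exponential vectors as bounded sequences\<close>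

text \<open>A vector \<open>x\<close> of \<open>X_mu A D l \<mu>\<close> is encoded by the bounded sequence \<open>(A - l)\<^sup>k x / \<mu>\<^sup>k\<close>; the sup norm of
  the sequence is \<open>exp_norm A l \<mu> x\<close>, and \<open>A - l\<close> becomes \<open>\<mu>\<close> times the backward shift.\<close>

definition espace :: "('a::complex_banach \<Rightarrow> 'a) \<Rightarrow> 'a set \<Rightarrow> complex \<Rightarrow> real \<Rightarrow> (nat \<Rightarrow>\<^sub>C 'a) set" where
  "espace A D l \<mu> = {u. \<forall>k. apply_bcontfun u k \<in> D \<and>
     shift_op A l (apply_bcontfun u k) = \<mu> *\<^sub>R apply_bcontfun u (Suc k)}"

definition emb :: "('a::complex_banach \<Rightarrow> 'a) \<Rightarrow> complex \<Rightarrow> real \<Rightarrow> 'a \<Rightarrow> (nat \<Rightarrow>\<^sub>C 'a)" where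
  "emb A l \<mu> x = Bcontfun (\<lambda>k. (1 / \<mu> ^ k) *\<^sub>R (shift_op A l ^^ k) x)"

definition evl :: "(nat \<Rightarrow>\<^sub>C 'a) \<Rightarrow> 'a::complex_banach" where
  "evl u = apply_bcontfun u 0"

text \<open>Change of radius: with \<open>q = \<mu>' / \<mu>\<close> the encoding of a vector for
  \<open>\<mu>'\<close> becomes its encoding for the larger radius \<mu>.\<close>

definition resc :: "real \<Rightarrow> (nat \<Rightarrow>\<^sub>C 'a) \<Rightarrow> (nat \<Rightarrow>\<^sub>C 'a::complex_banach)" where
  "resc q u = Bcontfun (\<lambda>k. q ^ k *\<^sub>R apply_bcontfun u k)"

lemma bounded_linear_apply_bcontfun: "bounded_linear (\<lambda>u. apply_bcontfun u k)"
  by (rule bounded_linear_intro[where K=1]) (auto simp: norm_apply_bcontfun)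

lemma bounded_linear_evl: "bounded_linear evl"
  unfolding evl_def[abs_def] by (rule bounded_linear_apply_bcontfun)

lemma evl_0: "evl 0 = 0" and evl_diff: "evl (u - w) = evl u - evl w"
  and evl_add: "evl (u + w) = evl u + evl w"
  by (simp_all add: evl_def)

lemma evl_sum: "evl (\<Sum>i\<in>I. u i) = (\<Sum>i\<in>I. evl (u i))"
  by (simp add: evl_def apply_bcontfun_sum)

context
  fixes q :: real
  assumes q: "0 \<le> q" "q \<le> 1"
begin

lemma resc_bound: "norm (q ^ k *\<^sub>R apply_bcontfun u k) \<le> norm u"
  using mult_mono[OF power_le_one[OF q, of k] norm_apply_bcontfun[of u k]] q by simp

lemma resc_apply: "apply_bcontfun (resc q u) k = q ^ k *\<^sub>R apply_bcontfun u k"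
  unfolding resc_def by (subst Bcontfun_nat_inverse[OF resc_bound]) simp

lemma bounded_linear_resc: "bounded_linear (resc q)"
proof (rule bounded_linear_intro)
  show "resc q (u + w) = resc q u + resc q w" for u w
    by (rule bcontfun_eqI) (simp add: resc_apply scaleR_add_right)
  show "resc q (r *\<^sub>R u) = r *\<^sub>R resc q u" for r u
    by (rule bcontfun_eqI) (simp add: resc_apply)
  show "norm (resc q u) \<le> norm u * 1" for u
    by (rule norm_bcontfun_le) (simp add: resc_apply[simplified] resc_bound[simplified])
qed

lemma evl_resc: "evl (resc q u) = evl u"
  by (simp add: evl_def resc_apply)

end

lemma sums_Pair:
  fixes f :: "nat \<Rightarrow> 'b::real_normed_vector" and g :: "nat \<Rightarrow> 'c::real_normed_vector"
  assumes "f sums x" "g sums y"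
  shows "(\<lambda>i. (f i, g i)) sums (x, y)"
proof -
  have "(\<Sum>i<n. (f i, g i)) = (\<Sum>i<n. f i, \<Sum>i<n. g i)" for n
    by (induction n) (auto simp: zero_prod_def)
  then show ?thesis
    using assms by (simp add: sums_def tendsto_Pair)
qed

section \<open>Closed operators, their graph and the sequence spaces\<close>

locale closed_op =
  fixes A :: "'a::complex_banach \<Rightarrow> 'a" and D :: "'a set"
  assumes closed_op: "closed_dense_operator A D"
begin

lemma D_add: "x \<in> D \<Longrightarrow> y \<in> D \<Longrightarrow> x + y \<in> D" and A_add: "x \<in> D \<Longrightarrow> y \<in> D \<Longrightarrow> A (x + y) = A x + A y"
  and D_scaleC: "x \<in> D \<Longrightarrow> c *\<^sub>C x \<in> D" and A_scaleC: "x \<in> D \<Longrightarrow> A (c *\<^sub>C x) = c *\<^sub>C A x"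
  and D_0: "0 \<in> D"
  using closed_op by (auto simp: closed_dense_operator_def)

lemma D_scaleR: "x \<in> D \<Longrightarrow> r *\<^sub>R x \<in> D" and A_scaleR: "x \<in> D \<Longrightarrow> A (r *\<^sub>R x) = r *\<^sub>R A x"
  by (simp_all add: scaleR_scaleC D_scaleC A_scaleC)

lemma A_0: "A 0 = 0"
  using A_scaleR[OF D_0, of 0] by simp

lemma shift_op_scaleR: "x \<in> D \<Longrightarrow> shift_op A l (r *\<^sub>R x) = r *\<^sub>R shift_op A l x"
  by (simp add: shift_op_def A_scaleR scaleC.scaleR_right scaleR_diff_right)

lemma shift_op_0: "shift_op A l 0 = 0"
  by (simp add: shift_op_def A_0 scaleC.zero_right)

lemma shift_op_pow_0: "(shift_op A l ^^ k) 0 = 0"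
  by (induction k) (simp_all add: shift_op_0)

definition graph :: "('a \<times> 'a) set" where "graph = (\<lambda>x. (x, A x)) ` D"

lemma closed_graph: "closed graph"
  using closed_op by (simp add: graph_def closed_dense_operator_def)

lemma graph_iff: "(x, y) \<in> graph \<longleftrightarrow> x \<in> D \<and> A x = y"
  by (auto simp: graph_def)

lemma subspace_graph: "subspace graph"
  unfolding subspace_def
  by (auto simp: graph_iff D_0 A_0 D_add A_add D_scaleR A_scaleR zero_prod_def)

lemma graph_scaleC: "(x, y) \<in> graph \<Longrightarrow> (c *\<^sub>C x, c *\<^sub>C y) \<in> graph"
  by (auto simp: graph_iff D_scaleC A_scaleC)

text \<open>Phrased through the graph, since closedness of \<open>A\<close> means that its graph is
  a closed subspace: limits, series and integrals of pairs then stay inside.\<close>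

lemma espace_iff:
  "u \<in> espace A D l \<mu> \<longleftrightarrow>
    (\<forall>k. (apply_bcontfun u k, \<mu> *\<^sub>R apply_bcontfun u (Suc k) + l *\<^sub>C apply_bcontfun u k) \<in> graph)"
  by (auto simp: espace_def graph_iff shift_op_def algebra_simps)

lemma subspace_espace: "subspace (espace A D l \<mu>)"
proof -
  let ?p = "\<lambda>k (u :: nat \<Rightarrow>\<^sub>C 'a). (apply_bcontfun u k, \<mu> *\<^sub>R apply_bcontfun u (Suc k) + l *\<^sub>C apply_bcontfun u k)"
  have "linear (?p k)" for k
    by (rule linearI) (simp_all add: scaleC.add_right scaleC.scaleR_right scaleR_add_right)
  then have "subspace (?p k -` graph)" for k
    by (rule linear_subspace_vimage[OF _ subspace_graph])
  then have "subspace (\<Inter>k. ?p k -` graph)"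
    by (intro subspace_Inter) auto
  also have "(\<Inter>k. ?p k -` graph) = espace A D l \<mu>"
    by (auto simp: espace_iff)
  finally show ?thesis .
qed

lemma closed_espace: "closed (espace A D l \<mu>)"
proof -
  let ?p = "\<lambda>k (u :: nat \<Rightarrow>\<^sub>C 'a). (apply_bcontfun u k, \<mu> *\<^sub>R apply_bcontfun u (Suc k) + l *\<^sub>C apply_bcontfun u k)"
  have c: "continuous_on UNIV (\<lambda>u :: nat \<Rightarrow>\<^sub>C 'a. apply_bcontfun u k)" for k
    by (rule linear_continuous_on[OF bounded_linear_apply_bcontfun])
  have "continuous_on UNIV (?p k)" for k
    by (intro continuous_on_Pair continuous_on_add continuous_on_scaleR continuous_on_const c
        bounded_linear.continuous_on[OF scaleC.bounded_linear_right])
  then have "closed (?p k -` graph)" for k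
    by (rule closed_vimage[OF closed_graph])
  then have "closed (\<Inter>k. ?p k -` graph)"
    by blast
  also have "(\<Inter>k. ?p k -` graph) = espace A D l \<mu>"
    by (auto simp: espace_iff)
  finally show ?thesis .
qed

text \<open>A closed operator passes through a series when the series of images also converges, so
  pairs in the graph are summed.\<close>

lemma act_espace:
  assumes a: "summable (\<lambda>i. norm (a i))" and u: "u \<in> espace A D l \<mu>"
  shows "act a u \<in> espace A D l \<mu>"
  unfolding espace_iff
proof
  fix k
  let ?u = "apply_bcontfun u"
  have "(a i *\<^sub>C ?u (i + k), a i *\<^sub>C (\<mu> *\<^sub>R ?u (i + Suc k) + l *\<^sub>C ?u (i + k))) \<in> graph" for i
    using u by (intro graph_scaleC) (simp add: espace_iff)
  moreover have s: "(\<lambda>i. (a i *\<^sub>C ?u (i + k), a i *\<^sub>C (\<mu> *\<^sub>R ?u (i + Suc k) + l *\<^sub>C ?u (i + k)))) sums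
      (apply_bcontfun (act a u) k, \<mu> *\<^sub>R apply_bcontfun (act a u) (Suc k) + l *\<^sub>C apply_bcontfun (act a u) k)"
  proof (rule sums_Pair)
    have 1: "(\<lambda>i. a i *\<^sub>C ?u (i + j)) sums apply_bcontfun (act a u) j" for j
      unfolding act_apply[OF a] by (rule summable_sums[OF act_summable[OF a]])
    show "(\<lambda>i. a i *\<^sub>C ?u (i + k)) sums apply_bcontfun (act a u) k" by (rule 1)
    have "(\<lambda>i. \<mu> *\<^sub>R (a i *\<^sub>C ?u (i + Suc k)) + l *\<^sub>C (a i *\<^sub>C ?u (i + k))) sums
        (\<mu> *\<^sub>R apply_bcontfun (act a u) (Suc k) + l *\<^sub>C apply_bcontfun (act a u) k)"
      by (intro sums_add sums_scaleR_right bounded_linear.sums[OF scaleC.bounded_linear_right] 1)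
    then show "(\<lambda>i. a i *\<^sub>C (\<mu> *\<^sub>R ?u (i + Suc k) + l *\<^sub>C ?u (i + k))) sums
        (\<mu> *\<^sub>R apply_bcontfun (act a u) (Suc k) + l *\<^sub>C apply_bcontfun (act a u) k)"
      by (simp add: scaleC.add_right scaleC.scaleR_right scaleC_scaleC mult.commute)
  qed
  ultimately show "(apply_bcontfun (act a u) k, \<mu> *\<^sub>R apply_bcontfun (act a u) (Suc k) + l *\<^sub>C apply_bcontfun (act a u) k) \<in> graph"
    using suminf_mem_closed_subspace[OF closed_graph subspace_graph _ sums_summable[OF s]] sums_unique[OF s] by simp
qed

lemma espace_pow:
  assumes "u \<in> espace A D l \<mu>"
  shows "(shift_op A l ^^ k) (evl u) = \<mu> ^ k *\<^sub>R apply_bcontfun u k"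
  using assms by (induction k) (auto simp: evl_def espace_def shift_op_scaleR)

lemma evl_X_mu:
  assumes u: "u \<in> espace A D l \<mu>" and \<mu>: "0 < \<mu>"
  shows "evl u \<in> X_mu A D l \<mu>"
  unfolding X_mu_def
proof (intro CollectI conjI allI impI)
  have "apply_bcontfun u k \<in> D" for k using u by (simp add: espace_def)
  then show "evl u \<in> pow_domain A D l k" for k
    by (simp add: pow_domain_def espace_pow[OF u] D_scaleR)
  show "\<exists>C>0. \<forall>k\<ge>1. norm ((shift_op A l ^^ k) (evl u)) \<le> C * \<mu> ^ k * norm (evl u)"
  proof (cases "evl u = 0")
    case True
    then show ?thesis by (intro exI[of _ 1]) (simp add: shift_op_pow_0)
  next
    case False
    show ?thesis
    proof (intro exI conjI allI impI)
      \<comment> \<open>The constant in \<open>X_mu\<close> multiplies the norm of the vector, here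
        \<open>evl u\<close>; hence the quotient, and hence the separate case of the zero vector.
        The summand 1 secures positivity.\<close>
      show "0 < norm u / norm (evl u) + 1" by (intro add_nonneg_pos) auto
      fix k
      have "norm ((shift_op A l ^^ k) (evl u)) \<le> \<mu> ^ k * norm u"
        using \<mu> by (simp add: espace_pow[OF u] norm_apply_bcontfun)
      also have "\<dots> \<le> (norm u / norm (evl u) + 1) * \<mu> ^ k * norm (evl u)"
        using False \<mu> by (simp add: field_simps)
      finally show "norm ((shift_op A l ^^ k) (evl u)) \<le> (norm u / norm (evl u) + 1) * \<mu> ^ k * norm (evl u)" .
    qed
  qed
qed

lemma
  assumes x: "x \<in> X_mu A D l \<mu>" and \<mu>: "0 < \<mu>"
  shows emb_espace: "emb A l \<mu> x \<in> espace A D l \<mu>" and evl_emb: "evl (emb A l \<mu> x) = x"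
proof -
  obtain C where C: "0 < C" "\<And>k. 1 \<le> k \<Longrightarrow> norm ((shift_op A l ^^ k) x) \<le> C * \<mu> ^ k * norm x"
    using x by (auto simp: X_mu_def)
  have D: "(shift_op A l ^^ k) x \<in> D" for k
    using x by (auto simp: X_mu_def pow_domain_def)
  \<comment> \<open>\<open>X_mu\<close> bounds the powers only from 1 on; the added 1 covers
    \<open>k = 0\<close>.\<close>
  have "norm ((1 / \<mu> ^ k) *\<^sub>R (shift_op A l ^^ k) x) \<le> (C + 1) * norm x" for k
  proof (cases "k = 0")
    case True
    then show ?thesis using C(1) by (simp add: algebra_simps)
  next
    case False
    have "norm ((1 / \<mu> ^ k) *\<^sub>R (shift_op A l ^^ k) x) = norm ((shift_op A l ^^ k) x) / \<mu> ^ k"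
      using \<mu> by simp
    also have "\<dots> \<le> C * \<mu> ^ k * norm x / \<mu> ^ k"
      using C(2)[of k] False \<mu> by (intro divide_right_mono) auto
    also have "\<dots> \<le> (C + 1) * norm x"
      using \<mu> by (simp add: algebra_simps)
    finally show ?thesis .
  qed
  then have e: "apply_bcontfun (emb A l \<mu> x) = (\<lambda>k. (1 / \<mu> ^ k) *\<^sub>R (shift_op A l ^^ k) x)"
    unfolding emb_def by (rule Bcontfun_nat_inverse)
  show "emb A l \<mu> x \<in> espace A D l \<mu>"
    using D \<mu> by (simp add: espace_def e D_scaleR shift_op_scaleR)
  show "evl (emb A l \<mu> x) = x"
    by (simp add: evl_def e)
qed

lemma exp_norm_evl:
  assumes u: "u \<in> espace A D l \<mu>" and \<mu>: "0 < \<mu>"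
  shows "exp_norm A l \<mu> (evl u) = norm u"
proof -
  have e: "norm ((shift_op A l ^^ k) (evl u)) / \<mu> ^ k = norm (apply_bcontfun u k)" for k
    using \<mu> by (simp add: espace_pow[OF u])
  have b: "bdd_above (range (\<lambda>k. norm (apply_bcontfun u k)))"
    by (rule bdd_aboveI2) (rule norm_apply_bcontfun)
  have "norm u \<le> (SUP k. norm (apply_bcontfun u k))"
    by (rule norm_bcontfun_le) (rule cSUP_upper[OF UNIV_I b])
  moreover have "(SUP k. norm (apply_bcontfun u k)) \<le> norm u"
    by (rule cSUP_least) (auto simp: norm_apply_bcontfun)
  ultimately show ?thesis by (simp add: exp_norm_def e)
qed

lemma resc_espace:
  assumes u: "u \<in> espace A D l \<mu>'" and \<mu>: "0 < \<mu>'" "\<mu>' \<le> \<mu>"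
  shows "resc (\<mu>' / \<mu>) u \<in> espace A D l \<mu>"
proof -
  have q: "0 \<le> \<mu>' / \<mu>" "\<mu>' / \<mu> \<le> 1" using \<mu> by auto
  show ?thesis
    using u \<mu> unfolding espace_def by (auto simp: resc_apply[OF q] D_scaleR shift_op_scaleR)
qed

end

section \<open>Decompositions over finitely many points\<close>

locale calculus_op = closed_op +
  fixes G :: "complex set"
  assumes G: "open G" and calculus: "calculus_well_defined A D G"
begin

text \<open>The strict inequality leaves room for a closed disc in \<open>G\<close> of radius larger
  than \<open>\<mu> l\<close>, as Cauchy's inequality requires.\<close>

definition radii :: "complex set \<Rightarrow> (complex \<Rightarrow> real) \<Rightarrow> bool" where
  "radii \<Lambda> \<mu> \<longleftrightarrow> finite \<Lambda> \<and> \<Lambda> \<subseteq> G \<and> (\<forall>l\<in>\<Lambda>. 0 < \<mu> l \<and> ereal (\<mu> l) < bdist G l)"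

text \<open>A connected set that meets \<open>G\<close> without being contained in it meets the
  frontier, here at distance at most \<rho> from \<open>l\<close>. An empty frontier, with infinite
  \<open>bdist\<close>, is covered.\<close>

lemma cball_subset_G:
  assumes "l \<in> G" "0 \<le> \<rho>" "ereal \<rho> < bdist G l"
  shows "cball l \<rho> \<subseteq> G"
proof (rule ccontr)
  assume "\<not> cball l \<rho> \<subseteq> G"
  then have "cball l \<rho> \<inter> frontier G \<noteq> {}"
    using assms by (intro connected_Int_frontier) (auto intro: centre_in_cball[THEN iffD2] simp: disjoint_iff)
  then obtain z where z: "z \<in> frontier G" "dist l z \<le> \<rho>" by auto
  have "bdist G l \<le> ereal (dist l z)"
    unfolding bdist_def by (rule INF_lower[OF z(1)])
  then show False using z(2) assms(3) by (meson ereal_less_eq(3) leD order_trans)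
qed

lemma radii_cball:
  assumes "radii \<Lambda> \<mu>" "l \<in> \<Lambda>"
  obtains \<rho> where "\<mu> l < \<rho>" "cball l \<rho> \<subseteq> G"
proof -
  obtain \<rho> where \<rho>: "ereal (\<mu> l) < ereal \<rho>" "ereal \<rho> < bdist G l"
    using assms ereal_dense2 by (meson radii_def)
  show thesis
  proof (rule that)
    show "cball l \<rho> \<subseteq> G"
      by (rule cball_subset_G) (use assms \<rho> in \<open>auto simp: radii_def\<close>)
  qed (use \<rho> in simp)
qed

lemma radii_decomposition:
  assumes "radii \<Lambda> \<mu>" "\<And>l. l \<in> \<Lambda> \<Longrightarrow> u l \<in> espace A D l (\<mu> l)"
  shows "decomposition A D G (\<Sum>l\<in>\<Lambda>. evl (u l)) \<Lambda> (\<lambda>l. evl (u l))"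
  unfolding decomposition_def
proof (intro conjI ballI)
  fix l assume l: "l \<in> \<Lambda>"
  then obtain r where r: "ereal (\<mu> l) < ereal r" "ereal r < bdist G l"
    using assms(1) ereal_dense2 by (meson radii_def)
  have "evl (u l) \<in> X_r A D l r"
    unfolding X_r_def using assms l r by (auto intro!: bexI[of _ "\<mu> l"] evl_X_mu simp: radii_def)
  then show "\<exists>r. ereal r < bdist G l \<and> evl (u l) \<in> X_r A D l r" using r by blast
qed (use assms in \<open>auto simp: radii_def\<close>)

lemma X_AG_I:
  assumes "radii \<Lambda> \<mu>" "\<And>l. l \<in> \<Lambda> \<Longrightarrow> u l \<in> espace A D l (\<mu> l)"
  shows "(\<Sum>l\<in>\<Lambda>. evl (u l)) \<in> X_AG A D G"
  using radii_decomposition[of \<Lambda> \<mu> u] assms unfolding X_AG_def by blast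

lemma X_AG_E:
  assumes "x \<in> X_AG A D G"
  shows "\<exists>\<Lambda> \<mu> u. radii \<Lambda> \<mu> \<and> (\<forall>l\<in>\<Lambda>. u l \<in> espace A D l (\<mu> l)) \<and> x = (\<Sum>l\<in>\<Lambda>. evl (u l))"
proof -
  obtain \<Lambda> c where d: "decomposition A D G x \<Lambda> c" using assms by (auto simp: X_AG_def)
  have "\<exists>\<mu>. 0 < \<mu> \<and> ereal \<mu> < bdist G l \<and> c l \<in> X_mu A D l \<mu>" if l: "l \<in> \<Lambda>" for l
  proof -
    from d have "\<forall>l\<in>\<Lambda>. \<exists>r. ereal r < bdist G l \<and> c l \<in> X_r A D l r"
      unfolding decomposition_def by (elim conjE)
    then obtain r where r: "ereal r < bdist G l" "c l \<in> X_r A D l r"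
      using bspec[OF _ l] by blast
    then obtain \<mu> where "0 < \<mu>" "\<mu> < r" "c l \<in> X_mu A D l \<mu>"
      by (auto simp: X_r_def)
    moreover have "ereal \<mu> < bdist G l"
      using r(1) \<open>\<mu> < r\<close> less_trans[of "ereal \<mu>" "ereal r"] by simp
    ultimately show ?thesis by blast
  qed
  then have "\<exists>\<mu>. \<forall>l\<in>\<Lambda>. 0 < \<mu> l \<and> ereal (\<mu> l) < bdist G l \<and> c l \<in> X_mu A D l (\<mu> l)"
    by (intro bchoice) blast
  then obtain \<mu> where \<mu>: "\<And>l. l \<in> \<Lambda> \<Longrightarrow> 0 < \<mu> l \<and> ereal (\<mu> l) < bdist G l \<and> c l \<in> X_mu A D l (\<mu> l)"
    by blast
  show ?thesis
  proof (intro exI[of _ \<Lambda>] exI[of _ \<mu>] exI[of _ "\<lambda>l. emb A l (\<mu> l) (c l)"] conjI ballI)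
    show "x = (\<Sum>l\<in>\<Lambda>. evl (emb A l (\<mu> l) (c l)))"
      using d \<mu> by (simp add: decomposition_def evl_emb)
  qed (use d \<mu> in \<open>auto simp: radii_def decomposition_def intro: emb_espace\<close>)
qed

text \<open>Termwise the powers of \<mu> cancel, so the right side is one of the values allowed by
  \<open>op_fun_rel\<close>; \<open>calculus_well_defined\<close> makes it the only one. Hence the
  right side depends on the vector alone, not on its decomposition.\<close>

lemma op_fun_eq:
  assumes r: "radii \<Lambda> \<mu>" and u: "\<And>l. l \<in> \<Lambda> \<Longrightarrow> u l \<in> espace A D l (\<mu> l)" and f: "f holomorphic_on G"
  shows "op_fun A D G f (\<Sum>l\<in>\<Lambda>. evl (u l)) = (\<Sum>l\<in>\<Lambda>. evl (act (coef f l (\<mu> l)) (u l)))"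
proof -
  have "evl (act (coef f l (\<mu> l)) (u l)) = (\<Sum>n. ((deriv ^^ n) f l / fact n) *\<^sub>C (shift_op A l ^^ n) (evl (u l)))"
    if l: "l \<in> \<Lambda>" for l
  proof -
    obtain \<rho> where \<rho>: "\<mu> l < \<rho>" "cball l \<rho> \<subseteq> G" using radii_cball[OF r l] .
    have "summable (\<lambda>i. norm (coef f l (\<mu> l) i))"
      by (rule summable_coef'[OF f G \<rho>(2) _ \<rho>(1)]) (use r l in \<open>simp add: radii_def\<close>)
    then have "evl (act (coef f l (\<mu> l)) (u l)) = (\<Sum>i. coef f l (\<mu> l) i *\<^sub>C apply_bcontfun (u l) i)"
      by (simp add: evl_def act_apply)
    also have "\<dots> = (\<Sum>n. ((deriv ^^ n) f l / fact n) *\<^sub>C (shift_op A l ^^ n) (evl (u l)))"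
      by (simp add: espace_pow[OF u[OF l]] coef_def scaleR_scaleC scaleC_scaleC)
    finally show ?thesis .
  qed
  then have "op_fun_rel A D G f (\<Sum>l\<in>\<Lambda>. evl (u l)) (\<Sum>l\<in>\<Lambda>. evl (act (coef f l (\<mu> l)) (u l)))"
    unfolding op_fun_rel_def
    by (intro exI[of _ \<Lambda>] exI[of _ "\<lambda>l. evl (u l)"]) (auto intro!: radii_decomposition[OF r u])
  then show ?thesis
    unfolding op_fun_def using calculus f by (intro the_equality) (auto simp: calculus_well_defined_def)
qed

lemma integrable_on_half_open_iff:
  fixes f :: "real \<Rightarrow> 'b::banach"
  shows "f integrable_on {0<..T} \<longleftrightarrow> f integrable_on {0..T}"
  by (rule integrable_spike_set_eq)
    (auto intro!: negligible_subset[OF negligible_sing[of 0]])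

text \<open>By \<open>exp_norm_evl\<close> the encoding is isometric, so the stepwise topology of
  the definition is ordinary norm continuity of the lifted functions.\<close>

lemma XAG_L1_I:
  assumes "\<And>T. 0 < T \<Longrightarrow> \<exists>\<Lambda> \<mu> d. radii \<Lambda> \<mu> \<and> (\<forall>l\<in>\<Lambda>. L1c T (d l) \<and> (\<forall>t\<in>{0<..T}. d l t \<in> espace A D l (\<mu> l))) \<and>
    (\<forall>t\<in>{0<..T}. f t = (\<Sum>l\<in>\<Lambda>. evl (d l t)))"
  shows "XAG_L1_continuous A D G f"
  unfolding XAG_L1_continuous_def
proof (intro allI impI)
  fix T :: real assume "0 < T"
  then obtain \<Lambda> \<mu> d where r: "radii \<Lambda> \<mu>" and L: "\<And>l. l \<in> \<Lambda> \<Longrightarrow> L1c T (d l)"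
    and e: "\<And>l t. l \<in> \<Lambda> \<Longrightarrow> t \<in> {0<..T} \<Longrightarrow> d l t \<in> espace A D l (\<mu> l)"
    and f: "\<And>t. t \<in> {0<..T} \<Longrightarrow> f t = (\<Sum>l\<in>\<Lambda>. evl (d l t))"
    using assms by metis
  have \<mu>: "0 < \<mu> l" if "l \<in> \<Lambda>" for l using r that by (simp add: radii_def)
  show "\<exists>\<Lambda> \<mu> c. finite \<Lambda> \<and> \<Lambda> \<subseteq> G \<and> (\<forall>t\<in>{0<..T}. f t = (\<Sum>l\<in>\<Lambda>. c l t)) \<and>
     (\<forall>l\<in>\<Lambda>. 0 < \<mu> l \<and> ereal (\<mu> l) < bdist G l \<and>
        (\<forall>t\<in>{0<..T}. c l t \<in> X_mu A D l (\<mu> l)) \<and>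
        (\<forall>s\<in>{0<..T}. ((\<lambda>t. exp_norm A l (\<mu> l) (c l t - c l s)) \<longlongrightarrow> 0) (at s within {0<..T})) \<and>
        (\<lambda>t. exp_norm A l (\<mu> l) (c l t)) integrable_on {0<..T})"
  proof (intro exI[of _ \<Lambda>] exI[of _ \<mu>] exI[of _ "\<lambda>l t. evl (d l t)"] conjI ballI)
    fix l assume l: "l \<in> \<Lambda>"
    show "evl (d l t) \<in> X_mu A D l (\<mu> l)" if "t \<in> {0<..T}" for t
      by (rule evl_X_mu[OF e[OF l that] \<mu>[OF l]])
    show "((\<lambda>t. exp_norm A l (\<mu> l) (evl (d l t) - evl (d l s))) \<longlongrightarrow> 0) (at s within {0<..T})"
      if s: "s \<in> {0<..T}" for s
    proof -
      have "((\<lambda>t. d l t) \<longlongrightarrow> d l s) (at s within {0<..T})"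
        using L[OF l] s by (simp add: L1c_def continuous_on_def)
      then have "((\<lambda>t. norm (d l t - d l s)) \<longlongrightarrow> 0) (at s within {0<..T})"
        using tendsto_norm[OF LIM_zero] by fastforce
      then show ?thesis
      proof (rule Lim_transform_within[where d=1])
        fix t assume "t \<in> {0<..T}"
        then show "norm (d l t - d l s) = exp_norm A l (\<mu> l) (evl (d l t) - evl (d l s))"
          using exp_norm_evl[OF subspace_diff[OF subspace_espace e[OF l] e[OF l s]] \<mu>[OF l]]
          by (simp add: evl_diff)
      qed simp
    qed
    have "(\<lambda>t. norm (d l t)) integrable_on {0<..T}"
      using L[OF l] by (simp add: L1c_def integrable_on_half_open_iff)
    then show "(\<lambda>t. exp_norm A l (\<mu> l) (evl (d l t))) integrable_on {0<..T}"
      by (rule integrable_eq) (simp add: exp_norm_evl[OF e[OF l] \<mu>[OF l]])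
  qed (use r f in \<open>auto simp: radii_def\<close>)
qed

lemma XAG_L1_E:
  assumes "XAG_L1_continuous A D G f" "0 < T"
  obtains \<Lambda> \<mu> d where "radii \<Lambda> \<mu>" "\<And>l. l \<in> \<Lambda> \<Longrightarrow> L1c T (d l)"
    "\<And>l t. l \<in> \<Lambda> \<Longrightarrow> t \<in> {0<..T} \<Longrightarrow> d l t \<in> espace A D l (\<mu> l)"
    "\<And>t. t \<in> {0<..T} \<Longrightarrow> f t = (\<Sum>l\<in>\<Lambda>. evl (d l t))"
proof -
  from assms(1)[unfolded XAG_L1_continuous_def, THEN spec, THEN mp, OF assms(2)]
  obtain \<Lambda> \<mu> c where *: "finite \<Lambda> \<and> \<Lambda> \<subseteq> G \<and> (\<forall>t\<in>{0<..T}. f t = (\<Sum>l\<in>\<Lambda>. c l t)) \<and>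
     (\<forall>l\<in>\<Lambda>. 0 < \<mu> l \<and> ereal (\<mu> l) < bdist G l \<and>
        (\<forall>t\<in>{0<..T}. c l t \<in> X_mu A D l (\<mu> l)) \<and>
        (\<forall>s\<in>{0<..T}. ((\<lambda>t. exp_norm A l (\<mu> l) (c l t - c l s)) \<longlongrightarrow> 0) (at s within {0<..T})) \<and>
        (\<lambda>t. exp_norm A l (\<mu> l) (c l t)) integrable_on {0<..T})"
    by (elim exE)
  then have c: "finite \<Lambda>" "\<Lambda> \<subseteq> G" "\<And>t. t \<in> {0<..T} \<Longrightarrow> f t = (\<Sum>l\<in>\<Lambda>. c l t)"
    and \<mu>: "\<And>l. l \<in> \<Lambda> \<Longrightarrow> 0 < \<mu> l" "\<And>l. l \<in> \<Lambda> \<Longrightarrow> ereal (\<mu> l) < bdist G l"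
    and X: "\<And>l t. l \<in> \<Lambda> \<Longrightarrow> t \<in> {0<..T} \<Longrightarrow> c l t \<in> X_mu A D l (\<mu> l)"
    and lim: "\<And>l s. l \<in> \<Lambda> \<Longrightarrow> s \<in> {0<..T} \<Longrightarrow>
        ((\<lambda>t. exp_norm A l (\<mu> l) (c l t - c l s)) \<longlongrightarrow> 0) (at s within {0<..T})"
    and int: "\<And>l. l \<in> \<Lambda> \<Longrightarrow> (\<lambda>t. exp_norm A l (\<mu> l) (c l t)) integrable_on {0<..T}"
    by blast+
  define d where "d l t = emb A l (\<mu> l) (c l t)" for l t
  have e: "d l t \<in> espace A D l (\<mu> l)" and ev: "evl (d l t) = c l t" if "l \<in> \<Lambda>" "t \<in> {0<..T}" for l t
    unfolding d_def using emb_espace evl_emb X[OF that] \<mu>(1)[OF that(1)] by auto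
  show thesis
  proof (rule that[of \<Lambda> \<mu> d])
    show "L1c T (d l)" if l: "l \<in> \<Lambda>" for l
      unfolding L1c_def
    proof
      show "continuous_on {0<..T} (d l)"
        unfolding continuous_on_def
      proof
        fix s assume s: "s \<in> {0<..T}"
        have "((\<lambda>t. norm (d l t - d l s)) \<longlongrightarrow> 0) (at s within {0<..T})"
        proof (rule Lim_transform_within[OF lim[OF l s], where d=1])
          fix t assume t: "t \<in> {0<..T}"
          show "exp_norm A l (\<mu> l) (c l t - c l s) = norm (d l t - d l s)"
            using exp_norm_evl[OF subspace_diff[OF subspace_espace e[OF l t] e[OF l s]] \<mu>(1)[OF l]]
            by (simp add: evl_diff ev[OF l t] ev[OF l s])
        qed simp
        then show "(d l \<longlongrightarrow> d l s) (at s within {0<..T})"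
          by (rule LIM_zero_cancel[OF tendsto_norm_zero_cancel])
      qed
      have "(\<lambda>t. norm (d l t)) integrable_on {0<..T}"
        by (rule integrable_eq[OF int[OF l]])
          (use exp_norm_evl[OF e[OF l] \<mu>(1)[OF l]] ev[OF l] in simp)
      then show "(\<lambda>t. norm (d l t)) integrable_on {0..T}"
        by (simp add: integrable_on_half_open_iff)
    qed
  qed (use c \<mu> e ev in \<open>auto simp: radii_def\<close>)
qed

lemma XAG_L1_const:
  assumes "x \<in> X_AG A D G"
  shows "XAG_L1_continuous A D G (\<lambda>_. x)"
proof -
  obtain \<Lambda> \<mu> u where "radii \<Lambda> \<mu>" "\<forall>l\<in>\<Lambda>. u l \<in> espace A D l (\<mu> l)" "x = (\<Sum>l\<in>\<Lambda>. evl (u l))"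
    using X_AG_E[OF assms] by blast
  then show ?thesis
    by (intro XAG_L1_I exI[of _ \<Lambda>] exI[of _ \<mu>] exI[of _ "\<lambda>l t. u l"]) (auto intro: L1c_continuous)
qed

text \<open>At each point the largest radius occurring there is taken; the other sequences are
  adapted by \<open>resc\<close>, and a function that does not use the point gets the component
  0.\<close>

lemma XAG_L1_common:
  fixes f :: "'i \<Rightarrow> real \<Rightarrow> 'a"
  assumes I: "finite I" and f: "\<And>i. i \<in> I \<Longrightarrow> XAG_L1_continuous A D G (f i)" and T: "0 < T"
  obtains \<Lambda> \<mu> d where "radii \<Lambda> \<mu>" "\<And>i l. i \<in> I \<Longrightarrow> l \<in> \<Lambda> \<Longrightarrow> L1c T (d i l)"
    "\<And>i l t. i \<in> I \<Longrightarrow> l \<in> \<Lambda> \<Longrightarrow> 0 < t \<Longrightarrow> t \<le> T \<Longrightarrow> d i l t \<in> espace A D l (\<mu> l)"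
    "\<And>i t. i \<in> I \<Longrightarrow> 0 < t \<Longrightarrow> t \<le> T \<Longrightarrow> f i t = (\<Sum>l\<in>\<Lambda>. evl (d i l t))"
proof -
  define P where "P i \<Lambda> \<mu> d \<longleftrightarrow> radii \<Lambda> \<mu> \<and> (\<forall>l\<in>\<Lambda>. L1c T (d l) \<and> (\<forall>t\<in>{0<..T}. d l t \<in> espace A D l (\<mu> l))) \<and>
      (\<forall>t\<in>{0<..T}. f i t = (\<Sum>l\<in>\<Lambda>. evl (d l t)))" for i \<Lambda> \<mu> d
  have "\<exists>w. P i (fst w) (fst (snd w)) (snd (snd w))" if i: "i \<in> I" for i
  proof (rule XAG_L1_E[OF f[OF i] T])
    fix \<Lambda> \<mu> d
    assume "radii \<Lambda> \<mu>" "\<And>l. l \<in> \<Lambda> \<Longrightarrow> L1c T (d l)"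
      "\<And>l t. l \<in> \<Lambda> \<Longrightarrow> t \<in> {0<..T} \<Longrightarrow> d l t \<in> espace A D l (\<mu> l)"
      "\<And>t. t \<in> {0<..T} \<Longrightarrow> f i t = (\<Sum>l\<in>\<Lambda>. evl (d l t))"
    then have "P i \<Lambda> \<mu> d" unfolding P_def by blast
    then show ?thesis by (intro exI[of _ "(\<Lambda>, \<mu>, d)"]) simp
  qed
  then have "\<exists>w. \<forall>i\<in>I. P i (fst (w i)) (fst (snd (w i))) (snd (snd (w i)))"
    by (intro bchoice) blast
  then obtain w where w: "\<And>i. i \<in> I \<Longrightarrow> P i (fst (w i)) (fst (snd (w i))) (snd (snd (w i)))"
    by blast
  define \<Lambda> \<mu> d where "\<Lambda> i = fst (w i)" and "\<mu> i = fst (snd (w i))" and "d i = snd (snd (w i))" for i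
  have r: "\<And>i. i \<in> I \<Longrightarrow> radii (\<Lambda> i) (\<mu> i)"
    and L: "\<And>i l. i \<in> I \<Longrightarrow> l \<in> \<Lambda> i \<Longrightarrow> L1c T (d i l)"
    and e: "\<And>i l t. i \<in> I \<Longrightarrow> l \<in> \<Lambda> i \<Longrightarrow> t \<in> {0<..T} \<Longrightarrow> d i l t \<in> espace A D l (\<mu> i l)"
    and s: "\<And>i t. i \<in> I \<Longrightarrow> t \<in> {0<..T} \<Longrightarrow> f i t = (\<Sum>l\<in>\<Lambda> i. evl (d i l t))"
    using w unfolding P_def \<Lambda>_def \<mu>_def d_def by blast+
  define L' where "L' = (\<Union>i\<in>I. \<Lambda> i)"
  define m where "m l = Max ((\<lambda>i. \<mu> i l) ` {i\<in>I. l \<in> \<Lambda> i})" for l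
  have m: "\<mu> i l \<le> m l" if "i \<in> I" "l \<in> \<Lambda> i" for i l
    unfolding m_def using I that by (intro Max_ge) auto
  have m_in: "\<exists>i\<in>I. l \<in> \<Lambda> i \<and> m l = \<mu> i l" if "l \<in> L'" for l
  proof -
    have "m l \<in> (\<lambda>i. \<mu> i l) ` {i\<in>I. l \<in> \<Lambda> i}"
      unfolding m_def using I that by (intro Max_in) (auto simp: L'_def)
    then show ?thesis by auto
  qed
  have rad: "radii L' m"
    unfolding radii_def
  proof (intro conjI ballI)
    show "finite L'" "L' \<subseteq> G" using I r by (auto simp: L'_def radii_def)
    fix l assume "l \<in> L'"
    then obtain i where "i \<in> I" "l \<in> \<Lambda> i" "m l = \<mu> i l" using m_in by blast
    then show "0 < m l" "ereal (m l) < bdist G l" using r[of i] by (auto simp: radii_def)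
  qed
  have pos: "0 < \<mu> i l" if "i \<in> I" "l \<in> \<Lambda> i" for i l
    using r[OF that(1)] that(2) by (simp add: radii_def)
  have q: "0 \<le> \<mu> i l / m l" "\<mu> i l / m l \<le> 1" if "i \<in> I" "l \<in> \<Lambda> i" for i l
    using pos[OF that] m[OF that] by auto
  define d' where "d' i l t = (if l \<in> \<Lambda> i then resc (\<mu> i l / m l) (d i l t) else 0)" for i l t
  show thesis
  proof (rule that[of L' m d', OF rad])
    show "L1c T (d' i l)" if "i \<in> I" "l \<in> L'" for i l
      using L[OF that(1)] L1c_bounded_linear[OF bounded_linear_resc[OF q[OF that(1)]]] L1c_0
      unfolding d'_def[abs_def] by (cases "l \<in> \<Lambda> i") auto
    show "d' i l t \<in> espace A D l (m l)" if "i \<in> I" "l \<in> L'" "0 < t" "t \<le> T" for i l t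
      using that e[of i l t] pos[of i l] m[of i l] resc_espace subspace_0[OF subspace_espace]
      by (auto simp: d'_def)
    show "f i t = (\<Sum>l\<in>L'. evl (d' i l t))" if "i \<in> I" "0 < t" "t \<le> T" for i t
    proof -
      have "(\<Sum>l\<in>L'. evl (d' i l t)) = (\<Sum>l\<in>\<Lambda> i. evl (d' i l t))"
        using rad that by (intro sum.mono_neutral_right) (auto simp: radii_def L'_def d'_def evl_0)
      also have "\<dots> = (\<Sum>l\<in>\<Lambda> i. evl (d i l t))"
        using that by (intro sum.cong) (auto simp: d'_def evl_resc[OF q])
      finally show ?thesis using s[of i t] that by simp
    qed
  qed
qed

end

section \<open>The symbol as a power series in a fractional power of time\<close>

text \<open>With orders \<open>\<beta> j = n j * h\<close> the symbol of the solution operator is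
  \<open>\<Sum>i. t powr (i * h) / Gamma (i * h + 1) * symbol_coeff m n F i j k z\<close>; the recursion comes from
  inserting this into the Volterra equation of the scalar system.\<close>

function symbol_coeff :: "nat \<Rightarrow> (nat \<Rightarrow> nat) \<Rightarrow> (complex \<Rightarrow> complex mat) \<Rightarrow> nat \<Rightarrow> nat \<Rightarrow> nat \<Rightarrow> complex \<Rightarrow> complex" where
  "symbol_coeff m n F i j k z =
     (if i = 0 then (if j = k then 1 else 0)
      else if 0 < n j \<and> n j \<le> i then \<Sum>l<m. F z $$ (j, l) * symbol_coeff m n F (i - n j) l k z
      else 0)"
  by pat_completeness auto
termination
  by (relation "Wellfounded.measure (\<lambda>(m, n, F, i, j, k, z). i)") auto

declare symbol_coeff.simps [simp del]

definition series_symbol :: "real \<Rightarrow> nat \<Rightarrow> (nat \<Rightarrow> nat) \<Rightarrow> (complex \<Rightarrow> complex mat) \<Rightarrow> real \<Rightarrow> nat \<Rightarrow> nat \<Rightarrow> complex \<Rightarrow> complex" where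
  "series_symbol h m n F t j k z =
     (\<Sum>i. complex_of_real (kern (real i * h + 1) t) * symbol_coeff m n F i j k z)"

lemma coef_const: "coef (\<lambda>z. c) l \<mu> i = (if i = 0 then c else 0)"
  by (simp add: coef_def higher_deriv_const)

lemma coef_diff:
  assumes "f holomorphic_on G" "g holomorphic_on G" "open G" "l \<in> G"
  shows "coef (\<lambda>z. f z - g z) l \<mu> i = coef f l \<mu> i - coef g l \<mu> i"
  using higher_deriv_diff[OF assms, of i] by (simp add: coef_def diff_divide_distrib left_diff_distrib)

lemma coef_cmult:
  assumes "f holomorphic_on G" "open G" "l \<in> G"
  shows "coef (\<lambda>z. c * f z) l \<mu> i = c * coef f l \<mu> i"
  using higher_deriv_cmult[OF assms(1,3,2), of i c] by (simp add: coef_def)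

lemma act_of_real:
  fixes u :: "nat \<Rightarrow>\<^sub>C 'b::complex_banach"
  assumes "summable (\<lambda>i. norm (a i))"
  shows "act (\<lambda>i. complex_of_real r * a i) u = r *\<^sub>R act a u"
proof -
  have "summable (\<lambda>i. norm (complex_of_real r * a i))"
    using summable_mult[OF assms, of "\<bar>r\<bar>"] by (simp add: norm_mult)
  moreover have "(complex_of_real r * c) *\<^sub>C x = r *\<^sub>R (c *\<^sub>C x)" for c and x :: 'b
    by (simp add: scaleR_scaleC scaleC_scaleC)
  ultimately show ?thesis
    by (intro bcontfun_eqI) (simp add: act_apply assms suminf_scaleR_right act_summable)
qed

section \<open>The coefficients of the symbol as analytic functions and as operators\<close>

locale analytic_symbol =
  fixes G :: "complex set" and m :: nat and n :: "nat \<Rightarrow> nat" and F :: "complex \<Rightarrow> complex mat" and h :: real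
  assumes open_G: "open G" and n_pos: "\<And>j. j < m \<Longrightarrow> 0 < n j" and h_pos: "0 < h"
    and F_holo: "\<And>j k. j < m \<Longrightarrow> k < m \<Longrightarrow> (\<lambda>z. F z $$ (j, k)) holomorphic_on G"
begin

abbreviation "sc \<equiv> symbol_coeff m n F"

lemma sc_0: "sc 0 j k z = (if j = k then 1 else 0)"
  by (simp add: symbol_coeff.simps)

lemma sc_small: "0 < i \<Longrightarrow> i < n j \<Longrightarrow> sc i j k z = 0"
  by (simp add: symbol_coeff.simps)

text \<open>The guard \<open>0 < n j\<close> in the recursive definition serves termination; in this
  setting it always holds.\<close>

lemma sc_step: "j < m \<Longrightarrow> n j \<le> i \<Longrightarrow> sc i j k z = (\<Sum>l<m. F z $$ (j, l) * sc (i - n j) l k z)"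
  using n_pos[of j] by (subst symbol_coeff.simps) simp

lemma sc_holomorphic: "j < m \<Longrightarrow> k < m \<Longrightarrow> sc i j k holomorphic_on G"
proof (induction i arbitrary: j rule: less_induct)
  case (less i)
  consider "i = 0" | "0 < i" "i < n j" | "n j \<le> i" by linarith
  then show ?case
  proof cases
    case 1
    then show ?thesis by (simp add: sc_0[abs_def])
  next
    case 2
    then have "sc i j k = (\<lambda>z. 0)" by (simp add: sc_small fun_eq_iff)
    then show ?thesis by simp
  next
    case 3
    have "(\<lambda>z. \<Sum>l<m. F z $$ (j, l) * sc (i - n j) l k z) holomorphic_on G"
      using less 3 n_pos[OF less.prems(1)]
      by (intro holomorphic_on_sum holomorphic_on_mult F_holo less.IH) auto
    moreover have "sc i j k = (\<lambda>z. \<Sum>l<m. F z $$ (j, l) * sc (i - n j) l k z)"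
      using sc_step[OF less.prems(1) 3] by blast
    ultimately show ?thesis by simp
  qed
qed

text \<open>One recursion step costs a factor \<open>m * b \<le> M\<close> and lowers the index by
  at least 1; \<open>1 \<le> M\<close> absorbs larger drops.\<close>

lemma sc_bound:
  assumes b: "\<And>j k. j < m \<Longrightarrow> k < m \<Longrightarrow> norm (F z $$ (j, k)) \<le> b" and M: "1 \<le> M" "real m * b \<le> M"
    and "j < m" "k < m"
  shows "norm (sc i j k z) \<le> M ^ i"
  using assms(4,5)
proof (induction i arbitrary: j rule: less_induct)
  case (less i)
  consider "i = 0" | "0 < i" "i < n j" | "n j \<le> i" by linarith
  then show ?case
  proof cases
    case 1
    then show ?thesis by (simp add: sc_0)
  next
    case 2
    then show ?thesis using M by (simp add: sc_small)
  next
    case 3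
    have n: "0 < n j" by (rule n_pos[OF less.prems(1)])
    have "norm (sc i j k z) \<le> (\<Sum>l<m. norm (F z $$ (j, l)) * norm (sc (i - n j) l k z))"
      unfolding sc_step[OF less.prems(1) 3] by (rule order_trans[OF norm_sum]) (simp add: norm_mult)
    also have "\<dots> \<le> (\<Sum>l<m. b * M ^ (i - n j))"
      using less 3 n by (intro sum_mono mult_mono b less.IH) (auto intro: order_trans[OF norm_ge_zero b])
    also have "\<dots> = real m * b * M ^ (i - n j)" by simp
    also have "\<dots> \<le> M ^ Suc (i - n j)"
      using mult_right_mono[OF M(2), of "M ^ (i - n j)"] M(1) by simp
    also have "\<dots> \<le> M ^ i"
      by (rule power_increasing) (use 3 n M(1) in auto)
    finally show ?thesis .
  qed
qed

lemma F_bounded: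
  assumes "compact K" "K \<subseteq> G"
  obtains M where "1 \<le> M" "\<And>z i j k. z \<in> K \<Longrightarrow> j < m \<Longrightarrow> k < m \<Longrightarrow> norm (sc i j k z) \<le> M ^ i"
proof -
  have "\<exists>b. \<forall>z\<in>K. norm (F z $$ (j, k)) \<le> b" if "j < m" "k < m" for j k
  proof -
    have "continuous_on K (\<lambda>z. F z $$ (j, k))"
      using F_holo[OF that] assms(2) by (meson continuous_on_subset holomorphic_on_imp_continuous_on)
    then have "compact ((\<lambda>z. F z $$ (j, k)) ` K)" by (rule compact_continuous_image[OF _ assms(1)])
    from compact_imp_bounded[OF this] show ?thesis unfolding bounded_iff by auto
  qed
  then obtain bb where bb: "\<And>j k z. j < m \<Longrightarrow> k < m \<Longrightarrow> z \<in> K \<Longrightarrow> norm (F z $$ (j, k)) \<le> bb j k"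
    by metis
  define b where "b = (\<Sum>j<m. \<Sum>k<m. \<bar>bb j k\<bar>)"
  have b: "norm (F z $$ (j, k)) \<le> b" if "j < m" "k < m" "z \<in> K" for j k z
  proof -
    have "norm (F z $$ (j, k)) \<le> \<bar>bb j k\<bar>" using bb[OF that] by simp
    also have "\<dots> \<le> (\<Sum>k<m. \<bar>bb j k\<bar>)"
      using that by (intro member_le_sum) auto
    also have "\<dots> \<le> b" unfolding b_def
      using that by (intro member_le_sum[of j _ "\<lambda>j. \<Sum>k<m. \<bar>bb j k\<bar>"]) (auto intro: sum_nonneg)
    finally show ?thesis .
  qed
  show thesis
    by (rule that[of "max 1 (real m * b)"]) (auto intro!: sc_bound b)
qed

lemma series_symbol_uniform:
  assumes K: "compact K" "K \<subseteq> G" and t: "0 < t" and j: "j < m" "k < m"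
  shows "uniform_limit K (\<lambda>N z. \<Sum>i<N. complex_of_real (kern (real i * h + 1) t) * sc i j k z)
    (series_symbol h m n F t j k) sequentially"
proof -
  obtain M where M: "1 \<le> M" "\<And>z i j k. z \<in> K \<Longrightarrow> j < m \<Longrightarrow> k < m \<Longrightarrow> norm (sc i j k z) \<le> M ^ i"
    using F_bounded[OF K] by blast
  show ?thesis
    unfolding series_symbol_def
  proof (rule Weierstrass_m_test)
    show "summable (\<lambda>i. M ^ i * kern (real i * h + 1) t)"
      by (rule kern_summable[OF t h_pos]) (use M in simp)
    fix i z assume z: "z \<in> K"
    have k0: "0 \<le> kern (real i * h + 1) t"
      by (rule kern_nonneg) (use h_pos in \<open>auto intro!: add_nonneg_pos\<close>)
    then show "norm (complex_of_real (kern (real i * h + 1) t) * sc i j k z) \<le> M ^ i * kern (real i * h + 1) t"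
      using mult_left_mono[OF M(2)[OF z j, of i] k0] by (simp add: norm_mult mult.commute)
  qed
qed

lemma partial_symbol_holomorphic:
  "j < m \<Longrightarrow> k < m \<Longrightarrow> (\<lambda>z. \<Sum>i<N. complex_of_real (kern (real i * h + 1) t) * sc i j k z) holomorphic_on G"
  by (intro holomorphic_on_sum holomorphic_on_mult holomorphic_on_const sc_holomorphic)

lemma series_symbol_holomorphic:
  assumes t: "0 < t" and j: "j < m" "k < m"
  shows "series_symbol h m n F t j k holomorphic_on G"
proof (rule holomorphic_uniform_sequence[OF open_G partial_symbol_holomorphic[OF j]])
  fix x assume "x \<in> G"
  then obtain d where "0 < d" "cball x d \<subseteq> G"
    using open_G open_contains_cball by blast
  then show "\<exists>d>0. cball x d \<subseteq> G \<and>
      uniform_limit (cball x d) (\<lambda>N z. \<Sum>i<N. complex_of_real (kern (real i * h + 1) t) * sc i j k z)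
        (series_symbol h m n F t j k) sequentially"
    by (intro exI[of _ d] conjI series_symbol_uniform[OF _ _ t j] compact_cball)
qed

context
  fixes l :: complex and \<mu> \<rho> :: real
  assumes \<rho>: "cball l \<rho> \<subseteq> G" "0 < \<mu>" "\<mu> < \<rho>"
begin

lemma l_in_G: "l \<in> G"
  using \<rho> by auto

text \<open>Partial sums converge uniformly on the disc, and \<open>norm_act_coef_le\<close> applied
  to the difference of symbols turns this into convergence of the operators.\<close>

lemma act_series_symbol:
  assumes t: "0 < t" and j: "j < m" "k < m"
  shows "(\<lambda>i. kern (real i * h + 1) t *\<^sub>R act (coef (sc i j k) l \<mu>) u) sums
    act (coef (series_symbol h m n F t j k) l \<mu>) u"
  unfolding sums_def
proof (rule LIM_zero_cancel, rule tendstoI)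
  let ?p = "\<lambda>N z. \<Sum>i<N. complex_of_real (kern (real i * h + 1) t) * sc i j k z"
  let ?s = "series_symbol h m n F t j k"
  note s = summable_coef'[OF _ open_G \<rho>]
  note hs = series_symbol_holomorphic[OF t j] and hp = partial_symbol_holomorphic[OF j, where t=t]
  have p: "act (coef (?p N) l \<mu>) u = (\<Sum>i<N. kern (real i * h + 1) t *\<^sub>R act (coef (sc i j k) l \<mu>) u)" for N
  proof -
    have "coef (?p N) l \<mu> = (\<lambda>n. \<Sum>i<N. complex_of_real (kern (real i * h + 1) t) * coef (sc i j k) l \<mu> n)"
    proof
      fix n'
      have "coef (?p N) l \<mu> n' = (\<Sum>i<N. coef (\<lambda>z. complex_of_real (kern (real i * h + 1) t) * sc i j k z) l \<mu> n')"
        by (rule coef_sum[OF _ open_G l_in_G]) (intro holomorphic_on_mult holomorphic_on_const sc_holomorphic j)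
      also have "\<dots> = (\<Sum>i<N. complex_of_real (kern (real i * h + 1) t) * coef (sc i j k) l \<mu> n')"
        by (intro sum.cong coef_cmult[OF _ open_G l_in_G] sc_holomorphic j) simp
      finally show "coef (?p N) l \<mu> n' = (\<Sum>i<N. complex_of_real (kern (real i * h + 1) t) * coef (sc i j k) l \<mu> n')" .
    qed
    moreover have "act (\<lambda>n. \<Sum>i<N. complex_of_real (kern (real i * h + 1) t) * coef (sc i j k) l \<mu> n) u =
        (\<Sum>i<N. act (\<lambda>n. complex_of_real (kern (real i * h + 1) t) * coef (sc i j k) l \<mu> n) u)"
      by (rule act_sum) (use s[OF sc_holomorphic[OF j]] in \<open>simp add: norm_mult summable_mult\<close>)
    ultimately show ?thesis
      by (simp add: act_of_real[OF s[OF sc_holomorphic[OF j]]])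
  qed
  fix e :: real assume e: "0 < e"
  define q where "q = 1 - \<mu> / \<rho>"
  have q: "0 < q" using \<rho> by (simp add: q_def)
  \<comment> \<open>\<open>1 / q\<close> is the constant of \<open>norm_act_coef_le\<close>; the 1
    in the denominator also serves \<open>u = 0\<close>.\<close>
  define d where "d = e * q / (norm u + 1)"
  have un: "0 < norm u + 1" by (simp add: add_nonneg_pos)
  have d: "0 < d" unfolding d_def using e q un by simp
  have de: "d / q * norm u < e"
  proof -
    have "d / q * norm u = e * (norm u / (norm u + 1))" using q by (simp add: d_def)
    also have "\<dots> < e * 1"
      by (rule mult_strict_left_mono) (use e un in \<open>auto simp: divide_less_eq\<close>)
    finally show ?thesis by simp
  qed
  have "\<forall>\<^sub>F N in sequentially. \<forall>z\<in>cball l \<rho>. dist (?p N z) (?s z) < d"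
    by (rule uniform_limitD[OF series_symbol_uniform[OF compact_cball \<rho>(1) t j] d])
  then show "\<forall>\<^sub>F N in sequentially. dist ((\<Sum>i<N. kern (real i * h + 1) t *\<^sub>R act (coef (sc i j k) l \<mu>) u) - act (coef ?s l \<mu>) u) 0 < e"
  proof eventually_elim
    case (elim N)
    have "coef (\<lambda>z. ?p N z - ?s z) l \<mu> = (\<lambda>i. coef (?p N) l \<mu> i - coef ?s l \<mu> i)"
      by (rule ext, rule coef_diff[OF hp hs open_G l_in_G])
    then have "act (coef (?p N) l \<mu>) u - act (coef ?s l \<mu>) u = act (coef (\<lambda>z. ?p N z - ?s z) l \<mu>) u"
      by (simp add: act_diff[OF s[OF hp] s[OF hs]])
    moreover have "norm (act (coef (\<lambda>z. ?p N z - ?s z) l \<mu>) u) \<le> d / (1 - \<mu> / \<rho>) * norm u"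
      by (rule norm_act_coef_le[OF _ open_G \<rho>])
        (use elim hp hs in \<open>auto intro!: holomorphic_on_diff simp: dist_norm less_imp_le\<close>)
    ultimately show ?case
      using de unfolding p q_def by (simp add: dist_norm)
  qed
qed

text \<open>The recursion of the coefficients is an identity between analytic functions, so
  multiplicativity of the calculus carries it over to bounded operators. The constant
  \<open>C\<close> is the sum of the geometric series with ratio \<open>\<mu> / \<rho>\<close>, and
  \<open>M\<close> governs the growth of the coefficients on the disc.\<close>

lemma frac_system_act:
  fixes g :: "nat \<Rightarrow> real \<Rightarrow> nat \<Rightarrow>\<^sub>C 'b::complex_banach"
  assumes T: "0 < T" and g: "\<And>k. k < m \<Longrightarrow> L1c T (g k)"
  shows "\<exists>C M. frac_system h T n m (\<lambda>j k. act (coef (\<lambda>z. F z $$ (j, k)) l \<mu>))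
    (\<lambda>i j k. act (coef (sc i j k) l \<mu>)) C M g"
proof -
  note s = summable_coef'[OF _ open_G \<rho>]
  note sF = s[OF F_holo] and ss = s[OF sc_holomorphic]
  obtain M where M: "1 \<le> M" "\<And>z i j k. z \<in> cball l \<rho> \<Longrightarrow> j < m \<Longrightarrow> k < m \<Longrightarrow> norm (sc i j k z) \<le> M ^ i"
    using F_bounded[OF compact_cball \<rho>(1)] by blast
  show ?thesis
  proof (rule exI[of _ "1 / (1 - \<mu> / \<rho>)"], rule exI[of _ M], rule frac_system.intro)
    show "0 < h" by (rule h_pos)
    show "0 < T" by (rule T)
    show "0 < n j" if "j < m" for j by (rule n_pos[OF that])
    show "bounded_linear (act (coef (\<lambda>z. F z $$ (j, k)) l \<mu>) :: (nat \<Rightarrow>\<^sub>C 'b) \<Rightarrow> _)" if "j < m" "k < m" for j k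
      by (rule bounded_linear_act[OF sF[OF that]])
    show "bounded_linear (act (coef (sc i j k) l \<mu>) :: (nat \<Rightarrow>\<^sub>C 'b) \<Rightarrow> _)" if "j < m" "k < m" for i j k
      by (rule bounded_linear_act[OF ss[OF that]])
    show "norm (act (coef (sc i j k) l \<mu>) y) \<le> 1 / (1 - \<mu> / \<rho>) * M ^ i * norm y" if "j < m" "k < m" for i j k and y :: "nat \<Rightarrow>\<^sub>C 'b"
      using norm_act_coef_le[OF sc_holomorphic[OF that] open_G \<rho> M(2)[OF _ that], where u=y] by simp
    show "0 \<le> M" using M(1) by simp
    show "0 \<le> 1 / (1 - \<mu> / \<rho>)" using \<rho> by simp
    \<comment> \<open>The empty instance of \<open>act_sum\<close> says that the zero sequence of
      coefficients acts as 0.\<close>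
    show "act (coef (sc 0 j k) l \<mu>) y = (if j = k then y else 0)" if "j < m" "k < m" for j k and y :: "nat \<Rightarrow>\<^sub>C 'b"
      using act_delta[of y] act_sum[of "{}" "\<lambda>_ _. 0" y]
      by (simp add: sc_0[abs_def] coef_const[abs_def])
    show "act (coef (sc i j k) l \<mu>) y = 0" if "j < m" "k < m" "0 < i" "i < n j" for i j k and y :: "nat \<Rightarrow>\<^sub>C 'b"
    proof -
      have "sc i j k = (\<lambda>z. 0)" using that by (simp add: sc_small fun_eq_iff)
      then show ?thesis
        using act_sum[of "{}" "\<lambda>_ _. 0" y] by (simp add: coef_const[abs_def])
    qed
    show "act (coef (sc i j k) l \<mu>) y =
        (\<Sum>l'<m. act (coef (\<lambda>z. F z $$ (j, l')) l \<mu>) (act (coef (sc (i - n j) l' k) l \<mu>) y))"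
      if j: "j < m" "k < m" "n j \<le> i" for i j k and y :: "nat \<Rightarrow>\<^sub>C 'b"
    proof -
      have eq: "coef (sc i j k) l \<mu> = (\<lambda>i'. \<Sum>l'<m. \<Sum>p\<le>i'. coef (\<lambda>z. F z $$ (j, l')) l \<mu> p * coef (sc (i - n j) l' k) l \<mu> (i' - p))"
      proof
        fix i'
        have "sc i j k = (\<lambda>z. \<Sum>l'<m. F z $$ (j, l') * sc (i - n j) l' k z)"
          using sc_step[OF j(1,3)] by blast
        moreover have "coef (\<lambda>z. \<Sum>l'<m. F z $$ (j, l') * sc (i - n j) l' k z) l \<mu> i' =
            (\<Sum>l'<m. coef (\<lambda>z. F z $$ (j, l') * sc (i - n j) l' k z) l \<mu> i')"
          by (rule coef_sum[OF _ open_G l_in_G]) (use j in \<open>simp add: holomorphic_on_mult F_holo sc_holomorphic\<close>)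
        ultimately have "coef (sc i j k) l \<mu> i' = (\<Sum>l'<m. coef (\<lambda>z. F z $$ (j, l') * sc (i - n j) l' k z) l \<mu> i')"
          by simp
        also have "\<dots> = (\<Sum>l'<m. \<Sum>p\<le>i'. coef (\<lambda>z. F z $$ (j, l')) l \<mu> p * coef (sc (i - n j) l' k) l \<mu> (i' - p))"
          by (intro sum.cong coef_mult[OF _ _ open_G l_in_G] F_holo sc_holomorphic j) auto
        finally show "coef (sc i j k) l \<mu> i' = (\<Sum>l'<m. \<Sum>p\<le>i'. coef (\<lambda>z. F z $$ (j, l')) l \<mu> p * coef (sc (i - n j) l' k) l \<mu> (i' - p))" .
      qed
      have sm: "summable (\<lambda>i'. norm (\<Sum>p\<le>i'. coef (\<lambda>z. F z $$ (j, l')) l \<mu> p * coef (sc (i - n j) l' k) l \<mu> (i' - p)))"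
        if l': "l' < m" for l'
      proof -
        have "coef (\<lambda>z. F z $$ (j, l') * sc (i - n j) l' k z) l \<mu> =
          (\<lambda>i'. \<Sum>p\<le>i'. coef (\<lambda>z. F z $$ (j, l')) l \<mu> p * coef (sc (i - n j) l' k) l \<mu> (i' - p))"
          by (rule ext, rule coef_mult[OF _ _ open_G l_in_G]) (use F_holo sc_holomorphic j l' in auto)
        moreover have "summable (\<lambda>i'. norm (coef (\<lambda>z. F z $$ (j, l') * sc (i - n j) l' k z) l \<mu> i'))"
          by (rule s) (use F_holo sc_holomorphic j l' in \<open>auto intro!: holomorphic_on_mult\<close>)
        ultimately show ?thesis by simp
      qed
      have "act (coef (sc i j k) l \<mu>) y =
          (\<Sum>l'<m. act (\<lambda>i'. \<Sum>p\<le>i'. coef (\<lambda>z. F z $$ (j, l')) l \<mu> p * coef (sc (i - n j) l' k) l \<mu> (i' - p)) y)"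
        unfolding eq by (rule act_sum) (use sm in auto)
      also have "\<dots> = (\<Sum>l'<m. act (coef (\<lambda>z. F z $$ (j, l')) l \<mu>) (act (coef (sc (i - n j) l' k) l \<mu>) y))"
        by (intro sum.cong act_mult sF ss) (use j in auto)
      finally show ?thesis .
    qed
    show "L1c T (g k)" if "k < m" for k by (rule g[OF that])
  qed
qed

end

end

section \<open>The Cauchy problem\<close>

lemma frac_kernel_integral_eq: "frac_kernel_integral b f t = fint (1 - b) f t"
proof -
  have "fint (1 - b) f t = integral {0..t} (\<lambda>\<tau>. (1 / Gamma (1 - b)) *\<^sub>R ((1 / (t - \<tau>) powr b) *\<^sub>R f \<tau>))"
    unfolding fint_def by (simp add: kern_def powr_minus_divide mult.commute)
  then show ?thesis
    by (simp only: frac_kernel_integral_def Henstock_Kurzweil_Integration.integral_cmul)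
qed

text \<open>The common frame of both parts: \<open>n j = 1\<close> with \<open>h\<close> the common
  order, or \<open>h = 1 / p\<close> with integer multiples \<open>n j\<close>.\<close>

locale frac_problem = calculus_op A D G for A :: "'a::complex_banach \<Rightarrow> 'a" and D G +
  fixes m :: nat and \<beta> :: "nat \<Rightarrow> real" and F :: "complex \<Rightarrow> complex mat"
    and H :: "real \<Rightarrow> nat \<Rightarrow> 'a" and \<Phi> :: "nat \<Rightarrow> 'a" and n :: "nat \<Rightarrow> nat" and h :: real
  assumes F_holomorphic: "\<And>j k. j < m \<Longrightarrow> k < m \<Longrightarrow> (\<lambda>z. F z $$ (j, k)) holomorphic_on G"
    and h0: "0 < h" and n0: "\<And>j. j < m \<Longrightarrow> 0 < n j"
    and \<beta>: "\<And>j. j < m \<Longrightarrow> \<beta> j = real (n j) * h" and \<beta>_le: "\<And>j. j < m \<Longrightarrow> \<beta> j \<le> 1"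
    and initial: "\<And>j. j < m \<Longrightarrow> \<Phi> j \<in> X_AG A D G"
    and source: "admissible_source A D G m \<beta> H"
begin

sublocale analytic_symbol G m n F h
  by unfold_locales (use G F_holomorphic h0 n0 in auto)

definition src :: "nat \<Rightarrow> real \<Rightarrow> 'a" where
  "src j = RL_deriv (1 - \<beta> j) (\<lambda>s. H s j)"

lemma \<beta>_pos: "j < m \<Longrightarrow> 0 < \<beta> j"
  using \<beta> h0 n0 by simp

lemma src_XAG: "j < m \<Longrightarrow> XAG_L1_continuous A D G (src j)"
  using source by (simp add: admissible_source_def src_def)

lemma H_continuous: "j < m \<Longrightarrow> continuous_on {0..} (\<lambda>s. H s j)"
  using source by (simp add: admissible_source_def)

lemma src_1: "\<beta> j = 1 \<Longrightarrow> src j = (\<lambda>s. H s j)"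
  by (simp add: src_def RL_deriv_def fun_eq_iff)

lemma src_derivative:
  assumes j: "j < m" "\<beta> j < 1" and t: "0 < t"
  shows "(fint (\<beta> j) (\<lambda>s. H s j) has_vector_derivative src j t) (at t)"
proof -
  have e: "frac_kernel_integral (1 - \<beta> j) (\<lambda>s. H s j) = fint (\<beta> j) (\<lambda>s. H s j)"
    by (simp add: frac_kernel_integral_eq fun_eq_iff)
  have "fint (\<beta> j) (\<lambda>s. H s j) differentiable (at t)"
    using source j t e by (auto simp: admissible_source_def)
  moreover have "src j t = vector_derivative (fint (\<beta> j) (\<lambda>s. H s j)) (at t)"
    using j \<beta>_pos[OF j(1)] e by (simp add: src_def RL_deriv_def)
  ultimately show ?thesis by (simp add: vector_derivative_works)
qed

text \<open>For orders below 1, \<open>J^\<beta> H\<close> is continuous up to 0, vanishes there and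
  has derivative \<open>src\<close> at positive times. This is why the source enters the solution
  formula through its derivative of order \<open>1 - \<beta>\<close>.\<close>

lemma fint_H:
  assumes j: "j < m" and t: "0 < t"
  shows "fint (\<beta> j) (\<lambda>s. H s j) t = fint 1 (src j) t"
proof (cases "\<beta> j = 1")
  case False
  have c: "continuous_on {0..t} (\<lambda>s. H s j)"
    by (rule continuous_on_subset[OF H_continuous[OF j]]) auto
  have "fint 1 (src j) t = fint (\<beta> j) (\<lambda>s. H s j) t - fint (\<beta> j) (\<lambda>s. H s j) 0"
    by (rule fint_1_derivative[OF fint_continuous[OF c \<beta>_pos[OF j]] t order_refl])
      (use False \<beta>_le[OF j] src_derivative[OF j] in simp)
  then show ?thesis by simp
qed (simp add: src_1)

text \<open>Both sides have the same primitive, \<open>J H = J^(1-\<beta>) J^\<beta> H =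
  J^(1-\<beta>) J src = J J^(1-\<beta>) src\<close>, and an \<open>L1c\<close> function is recovered
  from its primitive by differentiation at interior points.\<close>

lemma H_eq:
  assumes j: "j < m" "\<beta> j < 1" and L: "L1c T (src j)" and t: "0 < t" "t < T"
  shows "H t j = fint (1 - \<beta> j) (src j) t"
proof -
  have a: "0 < 1 - \<beta> j" "0 < \<beta> j" using j \<beta>_pos by auto
  have LH: "L1c T (\<lambda>s. H s j)"
    by (intro L1c_continuous continuous_on_subset[OF H_continuous[OF j(1)]]) auto
  have LJ: "L1c T (fint (1 - \<beta> j) (src j))" by (rule L1c_fint[OF L a(1)])
  have eq: "fint 1 (\<lambda>s. H s j) s = fint 1 (fint (1 - \<beta> j) (src j)) s" if s: "0 < s" "s < T" for s
  proof -
    have s': "s \<le> T" using s by simp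
    have "fint 1 (\<lambda>s. H s j) s = fint (1 - \<beta> j) (fint (\<beta> j) (\<lambda>s. H s j)) s"
      using fint_fint[OF LH a s(1) s'] by simp
    also have "\<dots> = fint (1 - \<beta> j) (fint 1 (src j)) s"
      by (rule fint_cong) (rule fint_H[OF j(1)])
    also have "\<dots> = fint 1 (fint (1 - \<beta> j) (src j)) s"
      using fint_fint[OF L a(1) less_numeral_extra(1) s(1) s'] fint_fint[OF L less_numeral_extra(1) a(1) s(1) s']
      by (simp add: add.commute)
    finally show ?thesis .
  qed
  have "(fint 1 (\<lambda>s. H s j) has_vector_derivative H t j) (at t)"
    by (rule fint_1_has_vector_derivative[OF LH t])
  then have "(fint 1 (fint (1 - \<beta> j) (src j)) has_vector_derivative H t j) (at t)"
    by (rule has_vector_derivative_transform_within_open[where S="{0<..<T}"]) (use t eq in auto)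
  then show ?thesis
    using fint_1_has_vector_derivative[OF LJ t] by (rule vector_derivative_unique_at)
qed

end

section \<open>Existence and uniqueness for decomposed data on one time interval\<close>

text \<open>Initial values and source share the points and radii, so each \<open>l\<close> carries a
  system with bounded operators on sequences.\<close>

locale frac_decomposed = frac_problem +
  fixes T :: real and \<Lambda> :: "complex set" and \<mu> :: "complex \<Rightarrow> real"
    and \<phi> :: "complex \<Rightarrow> nat \<Rightarrow> nat \<Rightarrow>\<^sub>C 'a" and g :: "complex \<Rightarrow> nat \<Rightarrow> real \<Rightarrow> nat \<Rightarrow>\<^sub>C 'a"
  assumes T0: "0 < T" and rad: "radii \<Lambda> \<mu>"
    and \<phi>_mem: "\<And>l k. l \<in> \<Lambda> \<Longrightarrow> k < m \<Longrightarrow> \<phi> l k \<in> espace A D l (\<mu> l)"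
    and \<phi>_sum: "\<And>k. k < m \<Longrightarrow> \<Phi> k = (\<Sum>l\<in>\<Lambda>. evl (\<phi> l k))"
    and g_L1: "\<And>l k. l \<in> \<Lambda> \<Longrightarrow> k < m \<Longrightarrow> L1c T (g l k)"
    and g_mem: "\<And>l k t. l \<in> \<Lambda> \<Longrightarrow> k < m \<Longrightarrow> 0 < t \<Longrightarrow> t \<le> T \<Longrightarrow> g l k t \<in> espace A D l (\<mu> l)"
    and g_sum: "\<And>k t. k < m \<Longrightarrow> 0 < t \<Longrightarrow> t \<le> T \<Longrightarrow> src k t = (\<Sum>l\<in>\<Lambda>. evl (g l k t))"
begin

abbreviation Bop :: "complex \<Rightarrow> nat \<Rightarrow> nat \<Rightarrow> (nat \<Rightarrow>\<^sub>C 'a) \<Rightarrow> (nat \<Rightarrow>\<^sub>C 'a)" where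
  "Bop l j k \<equiv> act (coef (\<lambda>z. F z $$ (j, k)) l (\<mu> l))"

abbreviation Rop :: "complex \<Rightarrow> nat \<Rightarrow> nat \<Rightarrow> nat \<Rightarrow> (nat \<Rightarrow>\<^sub>C 'a) \<Rightarrow> (nat \<Rightarrow>\<^sub>C 'a)" where
  "Rop l i j k \<equiv> act (coef (sc i j k) l (\<mu> l))"

abbreviation "Sop l t j k \<equiv> act (coef (series_symbol h m n F t j k) l (\<mu> l))"

abbreviation "v l \<equiv> frac_system.v h m (Rop l) (\<phi> l) (g l)"
abbreviation "W l \<equiv> frac_system.W h m (Rop l) (\<phi> l) (g l)"
abbreviation "K l \<equiv> frac_system.volterra h n m (Bop l)"

lemma rho:
  assumes "l \<in> \<Lambda>"
  obtains \<rho> where "cball l \<rho> \<subseteq> G" "0 < \<mu> l" "\<mu> l < \<rho>"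
  using radii_cball[OF rad assms] rad assms unfolding radii_def by metis

lemma system: "l \<in> \<Lambda> \<Longrightarrow> \<exists>C M. frac_system h T n m (Bop l) (Rop l) C M (g l)"
  by (rule rho, assumption, rule frac_system_act) (auto simp: T0 g_L1)

lemma finite_\<Lambda>: "finite \<Lambda>"
  using rad by (simp add: radii_def)

lemma coef_summable: "l \<in> \<Lambda> \<Longrightarrow> f holomorphic_on G \<Longrightarrow> summable (\<lambda>i. norm (coef f l (\<mu> l) i))"
  by (rule rho, assumption, rule summable_coef'[OF _ open_G])

lemma act_mem: "l \<in> \<Lambda> \<Longrightarrow> f holomorphic_on G \<Longrightarrow> u \<in> espace A D l (\<mu> l) \<Longrightarrow> act (coef f l (\<mu> l)) u \<in> espace A D l (\<mu> l)"
  by (rule act_espace[OF coef_summable])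

context
  fixes l j assumes l: "l \<in> \<Lambda>" and j: "j < m"
begin

lemma v_L1: "L1c T (v l j)"
proof -
  \<comment> \<open>The constants depend on \<open>l\<close> and are known only to exist, so the
    locale is interpreted inside the proofs; \<open>v\<close>, \<open>W\<close> and \<open>K\<close>
    do not involve them.\<close>
  obtain C M where "frac_system h T n m (Bop l) (Rop l) C M (g l)" using system[OF l] by blast
  then interpret fs: frac_system h T n m "Bop l" "Rop l" C M "\<phi> l" "g l" .
  show ?thesis by (rule fs.L1c_v[OF j])
qed

lemma
  shows v_mem: "0 < t \<Longrightarrow> t \<le> T \<Longrightarrow> v l j t \<in> espace A D l (\<mu> l)"
    and W_mem: "0 \<le> t \<Longrightarrow> t \<le> T \<Longrightarrow> W l j t \<in> espace A D l (\<mu> l)"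
proof -
  obtain C M where "frac_system h T n m (Bop l) (Rop l) C M (g l)" using system[OF l] by blast
  then interpret fs: frac_system h T n m "Bop l" "Rop l" C M "\<phi> l" "g l" .
  note m = closed_espace subspace_espace \<phi>_mem[OF l] g_mem[OF l] act_mem[OF l sc_holomorphic] j
  show "0 < t \<Longrightarrow> t \<le> T \<Longrightarrow> v l j t \<in> espace A D l (\<mu> l)"
    by (rule fs.v_mem[OF m])
  show "0 \<le> t \<Longrightarrow> t \<le> T \<Longrightarrow> W l j t \<in> espace A D l (\<mu> l)"
    by (rule fs.W_mem[OF m])
qed

lemma
  shows W_eq: "W l j t = \<phi> l j + fint 1 (v l j) t" and W_zero: "W l j 0 = \<phi> l j"
    and W_cont: "continuous_on {0..T} (W l j)"
proof -
  obtain C M where "frac_system h T n m (Bop l) (Rop l) C M (g l)" using system[OF l] by blast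
  then interpret fs: frac_system h T n m "Bop l" "Rop l" C M "\<phi> l" "g l" .
  show "W l j t = \<phi> l j + fint 1 (v l j) t" by (rule fs.W_def)
  show "W l j 0 = \<phi> l j" by (rule fs.W_0)
  show "continuous_on {0..T} (W l j)" by (rule fs.continuous_W[OF j])
qed

lemma
  assumes t: "0 < t" "t \<le> T"
  shows v_order_1: "\<beta> j = 1 \<Longrightarrow> v l j t = g l j t + (\<Sum>k<m. Bop l j k (W l k t))"
    and v_fractional: "\<beta> j < 1 \<Longrightarrow>
      fint (1 - \<beta> j) (v l j) t = fint (1 - \<beta> j) (g l j) t + (\<Sum>k<m. Bop l j k (W l k t))"
    and W_volterra: "W l j t = \<phi> l j + fint 1 (g l j) t + K l (W l) j t"
    and W_repr: "W l j t = (\<Sum>k<m. Sop l t j k (\<phi> l k) + integral {0..t} (\<lambda>\<tau>. Sop l (t - \<tau>) j k (g l k \<tau>)))"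
    and Sop_integrable: "k < m \<Longrightarrow> (\<lambda>\<tau>. Sop l (t - \<tau>) j k (g l k \<tau>)) integrable_on {0..t}"
proof -
  obtain C M where "frac_system h T n m (Bop l) (Rop l) C M (g l)" using system[OF l] by blast
  then interpret fs: frac_system h T n m "Bop l" "Rop l" C M "\<phi> l" "g l" .
  note b = \<beta>[OF j]
  show "\<beta> j = 1 \<Longrightarrow> v l j t = g l j t + (\<Sum>k<m. Bop l j k (W l k t))"
    unfolding b by (rule fs.system_order_1[OF j _ t])
  show "\<beta> j < 1 \<Longrightarrow> fint (1 - \<beta> j) (v l j) t = fint (1 - \<beta> j) (g l j) t + (\<Sum>k<m. Bop l j k (W l k t))"
    unfolding b by (rule fs.system_fractional[OF j _ t])
  show "W l j t = \<phi> l j + fint 1 (g l j) t + K l (W l) j t"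
    using fs.W_integral_equation[OF j _ t] \<beta>_le[OF j] unfolding b fs.volterra_def by simp
  have sol: "fs.sol j k s y = Sop l s j k y" if "k < m" "0 < s" for k s y
  proof (rule rho[OF l])
    fix \<rho> assume "cball l \<rho> \<subseteq> G" "0 < \<mu> l" "\<mu> l < \<rho>"
    from act_series_symbol[OF this that(2) j that(1), of y]
    show ?thesis unfolding fs.sol_def by (rule sums_unique[symmetric])
  qed
  have int: "integral {0..t} (\<lambda>\<tau>. fs.sol j k (t - \<tau>) (g l k \<tau>)) = integral {0..t} (\<lambda>\<tau>. Sop l (t - \<tau>) j k (g l k \<tau>))"
    if "k < m" for k
    unfolding integral_open_interval_real
    by (rule Henstock_Kurzweil_Integration.integral_cong) (use sol[OF that] in auto)
  show "W l j t = (\<Sum>k<m. Sop l t j k (\<phi> l k) + integral {0..t} (\<lambda>\<tau>. Sop l (t - \<tau>) j k (g l k \<tau>)))"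
    unfolding fs.W_representation[OF j t] by (intro sum.cong) (use t in \<open>auto simp: sol int\<close>)
  show "(\<lambda>\<tau>. Sop l (t - \<tau>) j k (g l k \<tau>)) integrable_on {0..t}" if k: "k < m"
    using fs.duhamel(1)[OF j k t]
    by (rule integrable_spike_finite[of "{t}", rotated 2]) (use sol[OF k] in auto)
qed

lemma K_eq: "K l V j = fint (\<beta> j) (\<lambda>\<tau>. \<Sum>k<m. Bop l j k (V k \<tau>))"
proof -
  obtain C M where "frac_system h T n m (Bop l) (Rop l) C M (g l)" using system[OF l] by blast
  then interpret fs: frac_system h T n m "Bop l" "Rop l" C M "\<phi> l" "g l" .
  show ?thesis unfolding fs.volterra_def \<beta>[OF j] ..
qed

lemma
  assumes "\<And>j. j < m \<Longrightarrow> continuous_on {0..T} (V j)"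
  shows K_pow_cont: "continuous_on {0..T} ((K l ^^ N) V j)"
    and K_pow_tendsto: "0 < t \<Longrightarrow> t \<le> T \<Longrightarrow> (\<lambda>N. (K l ^^ N) V j t) \<longlonglongrightarrow> 0"
proof -
  obtain C M where "frac_system h T n m (Bop l) (Rop l) C M (g l)" using system[OF l] by blast
  then interpret fs: frac_system h T n m "Bop l" "Rop l" C M "\<phi> l" "g l" .
  show "continuous_on {0..T} ((K l ^^ N) V j)" by (rule fs.continuous_volterra_pow[OF assms j])
  show "0 < t \<Longrightarrow> t \<le> T \<Longrightarrow> (\<lambda>N. (K l ^^ N) V j t) \<longlonglongrightarrow> 0"
    by (rule fs.volterra_pow_tendsto_0[OF assms j])
qed

end

lemma Bop_linear: "l \<in> \<Lambda> \<Longrightarrow> j < m \<Longrightarrow> k < m \<Longrightarrow> bounded_linear (Bop l j k)"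
  by (rule bounded_linear_act[OF coef_summable[OF _ F_holo]])

lemma Bsum_cont:
  assumes "l \<in> \<Lambda>" "j < m" "\<And>k. k < m \<Longrightarrow> continuous_on {0..T} (V k)"
  shows "continuous_on {0..T} (\<lambda>\<tau>. \<Sum>k<m. Bop l j k (V k \<tau>))"
  by (intro continuous_on_sum bounded_linear.continuous_on[OF Bop_linear] assms) auto

lemma Bsum_mem:
  assumes "l \<in> \<Lambda>" "j < m" "\<And>k. k < m \<Longrightarrow> u k \<in> espace A D l (\<mu> l)"
  shows "(\<Sum>k<m. Bop l j k (u k)) \<in> espace A D l (\<mu> l)"
  by (intro subspace_sum[OF subspace_espace] act_mem F_holo) (use assms in auto)

lemma fint_evl:
  assumes "\<And>l. l \<in> \<Lambda> \<Longrightarrow> L1c T (f l)" "0 < a" "0 < t" "t \<le> T"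
  shows "fint a (\<lambda>\<tau>. \<Sum>l\<in>\<Lambda>. evl (f l \<tau>)) t = (\<Sum>l\<in>\<Lambda>. evl (fint a (f l) t))"
  using assms by (simp add: fint_sum[OF L1c_bounded_linear[OF bounded_linear_evl] assms(2-4)]
      fint_bounded_linear[OF bounded_linear_evl _ assms(2-4)])

lemma src_L1: "k < m \<Longrightarrow> L1c T (src k)"
  by (rule L1c_cong[of T "\<lambda>t. \<Sum>l\<in>\<Lambda>. evl (g l k t)"])
    (auto intro!: L1c_sum L1c_bounded_linear[OF bounded_linear_evl] g_L1 simp: g_sum)

lemma fint_src:
  assumes "k < m" "0 < a" "0 < t" "t \<le> T"
  shows "fint a (src k) t = (\<Sum>l\<in>\<Lambda>. evl (fint a (g l k) t))"
proof -
  have "fint a (src k) t = fint a (\<lambda>\<tau>. \<Sum>l\<in>\<Lambda>. evl (g l k \<tau>)) t"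
    by (rule fint_cong) (use assms in \<open>simp add: g_sum\<close>)
  then show ?thesis using assms by (simp add: fint_evl g_L1)
qed

text \<open>Bridge between \<open>F(A)\<close> on vectors and the operators on sequences. The left
  side sees only the sums of the decomposition, which is what \<open>uniqueness\<close>
  exploits.\<close>

lemma F_op:
  assumes j: "j < m" and u: "\<And>l k. l \<in> \<Lambda> \<Longrightarrow> k < m \<Longrightarrow> u l k \<in> espace A D l (\<mu> l)"
  shows "(\<Sum>k<m. op_fun A D G (\<lambda>z. F z $$ (j, k)) (\<Sum>l\<in>\<Lambda>. evl (u l k))) = (\<Sum>l\<in>\<Lambda>. evl (\<Sum>k<m. Bop l j k (u l k)))"
proof -
  have "(\<Sum>k<m. op_fun A D G (\<lambda>z. F z $$ (j, k)) (\<Sum>l\<in>\<Lambda>. evl (u l k))) = (\<Sum>k<m. \<Sum>l\<in>\<Lambda>. evl (Bop l j k (u l k)))"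
    by (intro sum.cong op_fun_eq[OF rad] u F_holo j) auto
  then show ?thesis by (subst (asm) sum.swap) (simp add: evl_sum)
qed

lemma S_op:
  assumes S: "\<And>z. z \<in> G \<Longrightarrow> f z = series_symbol h m n F t j k z" and t: "0 < t" "j < m" "k < m"
    and u: "\<And>l. l \<in> \<Lambda> \<Longrightarrow> u l \<in> espace A D l (\<mu> l)"
  shows "op_fun A D G f (\<Sum>l\<in>\<Lambda>. evl (u l)) = (\<Sum>l\<in>\<Lambda>. evl (Sop l t j k (u l)))"
proof -
  have f: "f holomorphic_on G"
    using series_symbol_holomorphic[OF t] S by (simp cong: holomorphic_cong)
  have "coef f l (\<mu> l) = coef (series_symbol h m n F t j k) l (\<mu> l)" if "l \<in> \<Lambda>" for l
    by (rule ext, rule coef_cong[OF open_G _ S]) (use rad that in \<open>auto simp: radii_def\<close>)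
  then show ?thesis
    by (simp add: op_fun_eq[OF rad u f])
qed

lemma representation:
  assumes S: "\<And>t z j k. 0 < t \<Longrightarrow> z \<in> G \<Longrightarrow> j < m \<Longrightarrow> k < m \<Longrightarrow> S t z $$ (j, k) = series_symbol h m n F t j k z"
    and j: "j < m" and t: "0 < t" "t \<le> T"
  shows "duhamel_integrand A D G m \<beta> S H t j integrable_on {0..t}"
    and "(\<Sum>k<m. op_fun A D G (\<lambda>z. S t z $$ (j, k)) (\<Phi> k)) + integral {0..t} (duhamel_integrand A D G m \<beta> S H t j)
      = (\<Sum>l\<in>\<Lambda>. evl (W l j t))"
proof -
  let ?I = "\<lambda>l k. integral {0..t} (\<lambda>\<tau>. Sop l (t - \<tau>) j k (g l k \<tau>))"
  have "((\<lambda>\<tau>. evl (Sop l (t - \<tau>) j k (g l k \<tau>))) has_integral evl (?I l k)) {0..t}" if "l \<in> \<Lambda>" "k < m" for l k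
    using has_integral_linear[OF integrable_integral[OF Sop_integrable[OF that(1) j t that(2)]] bounded_linear_evl]
    by (simp add: o_def)
  then have int: "((\<lambda>\<tau>. \<Sum>k<m. \<Sum>l\<in>\<Lambda>. evl (Sop l (t - \<tau>) j k (g l k \<tau>))) has_integral (\<Sum>k<m. \<Sum>l\<in>\<Lambda>. evl (?I l k))) {0..t}"
    by (intro has_integral_sum finite_\<Lambda>) auto
  \<comment> \<open>Excluded are \<open>\<tau> = 0\<close>, where the source is not decomposed, and
    \<open>\<tau> = t\<close>, where the symbol would be taken at time 0.\<close>
  have eq: "duhamel_integrand A D G m \<beta> S H t j \<tau> = (\<Sum>k<m. \<Sum>l\<in>\<Lambda>. evl (Sop l (t - \<tau>) j k (g l k \<tau>)))"
    if "\<tau> \<in> {0..t} - {0, t}" for \<tau>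
    unfolding duhamel_integrand_def
  proof (rule sum.cong)
    fix k assume "k \<in> {..<m}"
    then have k: "k < m" by simp
    have "RL_deriv (1 - \<beta> k) (\<lambda>s. H s k) \<tau> = (\<Sum>l\<in>\<Lambda>. evl (g l k \<tau>))"
      using g_sum[OF k, of \<tau>] that t by (simp add: src_def)
    then show "op_fun A D G (\<lambda>z. S (t - \<tau>) z $$ (j, k)) (RL_deriv (1 - \<beta> k) (\<lambda>s. H s k) \<tau>) =
        (\<Sum>l\<in>\<Lambda>. evl (Sop l (t - \<tau>) j k (g l k \<tau>)))"
      using that t by (simp add: S_op[OF S[of "t - \<tau>"]] g_mem j k)
  qed simp
  have I: "(duhamel_integrand A D G m \<beta> S H t j has_integral (\<Sum>k<m. \<Sum>l\<in>\<Lambda>. evl (?I l k))) {0..t}"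
    by (rule has_integral_spike_finite[where S="{0, t}", OF _ eq int]) auto
  then show "duhamel_integrand A D G m \<beta> S H t j integrable_on {0..t}" by blast
  have "(\<Sum>k<m. op_fun A D G (\<lambda>z. S t z $$ (j, k)) (\<Phi> k)) = (\<Sum>k<m. \<Sum>l\<in>\<Lambda>. evl (Sop l t j k (\<phi> l k)))"
    using t by (intro sum.cong) (auto simp: \<phi>_sum S_op[OF S] \<phi>_mem j)
  then show "(\<Sum>k<m. op_fun A D G (\<lambda>z. S t z $$ (j, k)) (\<Phi> k)) + integral {0..t} (duhamel_integrand A D G m \<beta> S H t j)
      = (\<Sum>l\<in>\<Lambda>. evl (W l j t))"
    unfolding integral_unique[OF I]
    by (simp add: sum.swap[of _ \<Lambda>] W_repr[OF _ j t] evl_sum evl_add sum.distrib)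
qed

text \<open>The derivative of \<open>U\<close> is the sum of the components \<open>v\<close>; the
  equations of the systems are summed over the points, and \<open>src\<close> is turned back into
  \<open>H\<close> by \<open>H_eq\<close>. Derivatives are two-sided, hence
  \<open>t < T\<close>.\<close>

lemma existence:
  assumes U0: "\<And>j. j < m \<Longrightarrow> U 0 j = \<Phi> j"
    and U: "\<And>j t. j < m \<Longrightarrow> 0 < t \<Longrightarrow> t \<le> T \<Longrightarrow> U t j = (\<Sum>l\<in>\<Lambda>. evl (W l j t))"
    and j: "j < m"
  shows "0 \<le> t \<Longrightarrow> t \<le> T \<Longrightarrow> U t j \<in> X_AG A D G"
    and "continuous_on {0..T} (\<lambda>t. U t j)"
    and "0 < t \<Longrightarrow> t < T \<Longrightarrow> ((\<lambda>s. U s j) has_vector_derivative (\<Sum>l\<in>\<Lambda>. evl (v l j t))) (at t)"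
    and "0 < t \<Longrightarrow> t < T \<Longrightarrow> caputo_deriv (\<beta> j) (\<lambda>s. U s j) t =
        (\<Sum>k<m. op_fun A D G (\<lambda>z. F z $$ (j, k)) (U t k)) + H t j"
proof -
  have U': "U t j = (\<Sum>l\<in>\<Lambda>. evl (W l j t))" if "j < m" "0 \<le> t" "t \<le> T" for j t
    using that U0 U by (cases "t = 0") (auto simp: W_zero \<phi>_sum)
  show "U t j \<in> X_AG A D G" if "0 \<le> t" "t \<le> T" for t
    unfolding U'[OF j that] by (rule X_AG_I[OF rad W_mem[OF _ j that]])
  have "continuous_on {0..T} (\<lambda>t. \<Sum>l\<in>\<Lambda>. evl (W l j t))"
    by (intro continuous_on_sum bounded_linear.continuous_on[OF bounded_linear_evl] W_cont j)
  then show "continuous_on {0..T} (\<lambda>t. U t j)"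
    by (rule continuous_on_cong[THEN iffD1, rotated 2]) (auto simp: U'[OF j])
  have der: "((\<lambda>s. U s j) has_vector_derivative (\<Sum>l\<in>\<Lambda>. evl (v l j t))) (at t)" if t: "0 < t" "t < T" for t
  proof -
    have "((\<lambda>s. evl (W l j s)) has_vector_derivative evl (v l j t)) (at t)" if l: "l \<in> \<Lambda>" for l
    proof -
      have "((\<lambda>s. \<phi> l j + fint 1 (v l j) s) has_vector_derivative 0 + v l j t) (at t)"
        by (intro has_vector_derivative_add has_vector_derivative_const
            fint_1_has_vector_derivative[OF v_L1[OF l j] t])
      then show ?thesis
        unfolding W_eq[OF l j]
        by (intro bounded_linear.has_vector_derivative[OF bounded_linear_evl]) simp
    qed
    then have "((\<lambda>s. \<Sum>l\<in>\<Lambda>. evl (W l j s)) has_vector_derivative (\<Sum>l\<in>\<Lambda>. evl (v l j t))) (at t)"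
      by (rule has_vector_derivative_sum)
    then show ?thesis
      by (rule has_vector_derivative_transform_within_open[where S="{0<..<T}"]) (use t U[OF j] in auto)
  qed
  then show "0 < t \<Longrightarrow> t < T \<Longrightarrow> ((\<lambda>s. U s j) has_vector_derivative (\<Sum>l\<in>\<Lambda>. evl (v l j t))) (at t)" .
  assume t: "0 < t" "t < T"
  then have t': "0 < t" "t \<le> T" by auto
  have FU: "(\<Sum>k<m. op_fun A D G (\<lambda>z. F z $$ (j, k)) (U t k)) = (\<Sum>l\<in>\<Lambda>. evl (\<Sum>k<m. Bop l j k (W l k t)))"
    using t' by (simp add: U F_op[OF j] W_mem)
  consider (1) "\<beta> j = 1" | (2) "\<beta> j < 1" using \<beta>_le[OF j] by linarith
  then show "caputo_deriv (\<beta> j) (\<lambda>s. U s j) t = (\<Sum>k<m. op_fun A D G (\<lambda>z. F z $$ (j, k)) (U t k)) + H t j"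
  proof cases
    case 1
    have "caputo_deriv (\<beta> j) (\<lambda>s. U s j) t = (\<Sum>l\<in>\<Lambda>. evl (v l j t))"
      using 1 vector_derivative_at[OF der[OF t]] by (simp add: caputo_deriv_def)
    also have "\<dots> = (\<Sum>l\<in>\<Lambda>. evl (\<Sum>k<m. Bop l j k (W l k t))) + (\<Sum>l\<in>\<Lambda>. evl (g l j t))"
      by (simp add: v_order_1[OF _ j t' 1] evl_add sum.distrib add.commute)
    also have "(\<Sum>l\<in>\<Lambda>. evl (g l j t)) = H t j"
      using g_sum[OF j t'] src_1[OF 1] by simp
    finally show ?thesis unfolding FU .
  next
    case 2
    have a: "0 < 1 - \<beta> j" using 2 by simp
    have "caputo_deriv (\<beta> j) (\<lambda>s. U s j) t = fint (1 - \<beta> j) (\<lambda>\<tau>. vector_derivative (\<lambda>s. U s j) (at \<tau>)) t"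
      using 2 \<beta>_pos[OF j] by (simp add: caputo_deriv_def frac_kernel_integral_eq)
    also have "\<dots> = fint (1 - \<beta> j) (\<lambda>\<tau>. \<Sum>l\<in>\<Lambda>. evl (v l j \<tau>)) t"
      by (rule fint_cong) (use t der in \<open>auto intro!: vector_derivative_at\<close>)
    also have "\<dots> = (\<Sum>l\<in>\<Lambda>. evl (\<Sum>k<m. Bop l j k (W l k t))) + (\<Sum>l\<in>\<Lambda>. evl (fint (1 - \<beta> j) (g l j) t))"
      by (simp add: fint_evl[OF v_L1[OF _ j] a t'] v_fractional[OF _ j t' 2] evl_add sum.distrib add.commute)
    also have "(\<Sum>l\<in>\<Lambda>. evl (fint (1 - \<beta> j) (g l j) t)) = H t j"
      using fint_src[OF j a t'] H_eq[OF j 2 src_L1[OF j] t] by simp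
    finally show ?thesis unfolding FU .
  qed
qed

text \<open>The family \<open>x\<close> lifts the derivative of the given solution. Its lift need
  not solve the systems point by point: only the sums over \<Lambda> are known to agree, and every
  comparison below is between such sums.\<close>

lemma uniqueness:
  assumes U: "is_solution A D G m \<beta> F H \<Phi> U"
    and x_L1: "\<And>l k. l \<in> \<Lambda> \<Longrightarrow> k < m \<Longrightarrow> L1c T (x l k)"
    and x_mem: "\<And>l k t. l \<in> \<Lambda> \<Longrightarrow> k < m \<Longrightarrow> 0 < t \<Longrightarrow> t \<le> T \<Longrightarrow> x l k t \<in> espace A D l (\<mu> l)"
    and x_sum: "\<And>k t. k < m \<Longrightarrow> 0 < t \<Longrightarrow> t \<le> T \<Longrightarrow> vector_derivative (\<lambda>s. U s k) (at t) = (\<Sum>l\<in>\<Lambda>. evl (x l k t))"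
    and j: "j < m" and t: "0 < t" "t \<le> T"
  shows "U t j = (\<Sum>l\<in>\<Lambda>. evl (W l j t))"
proof -
  \<comment> \<open>A lift of \<open>U\<close> itself, with the same initial lift as
    \<open>W\<close>.\<close>
  define Y where "Y l k s = \<phi> l k + fint 1 (x l k) s" for l k s
  have Yc: "continuous_on {0..T} (Y l k)" if "l \<in> \<Lambda>" "k < m" for l k
    unfolding Y_def[abs_def] by (intro continuous_intros continuous_on_fint_1 x_L1 that)
  have Ym: "Y l k s \<in> espace A D l (\<mu> l)" if "l \<in> \<Lambda>" "k < m" "0 \<le> s" "s \<le> T" for l k s
  proof (cases "s = 0")
    case False
    then have s: "0 < s" using that by simp
    have "fint 1 (x l k) s \<in> espace A D l (\<mu> l)"
      by (rule fint_mem_closed_subspace[OF closed_espace subspace_espace _ fint_integrable[OF x_L1[OF that(1,2)] less_numeral_extra(1) s that(4)]])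
        (use x_mem that in auto)
    then show ?thesis
      unfolding Y_def by (intro subspace_add[OF subspace_espace] \<phi>_mem that)
  qed (use \<phi>_mem that in \<open>simp add: Y_def\<close>)
  define u where "u k s = vector_derivative (\<lambda>s. U s k) (at s)" for k s
  have u1: "fint 1 (u k) s = U s k - \<Phi> k" if "k < m" "0 < s" "s \<le> T" for k s
  proof -
    have "continuous_on {0..T} (\<lambda>s. U s k)"
      using U that by (auto simp: is_solution_def intro: continuous_on_subset)
    moreover have "((\<lambda>s. U s k) has_vector_derivative u k r) (at r)" if "0 < r" for r
      using U \<open>k < m\<close> that unfolding is_solution_def u_def vector_derivative_works[symmetric] by blast
    moreover have "U 0 k = \<Phi> k" using U that by (simp add: is_solution_def)
    ultimately show ?thesis using fint_1_derivative[of T "\<lambda>s. U s k" s "u k"] that by simp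
  qed
  have ux: "fint a (u k) s = fint a (\<lambda>\<tau>. \<Sum>l\<in>\<Lambda>. evl (x l k \<tau>)) s" if "k < m" "s \<le> T" for a k s
    by (rule fint_cong) (use that in \<open>simp add: u_def x_sum\<close>)
  have UY: "U s k = (\<Sum>l\<in>\<Lambda>. evl (Y l k s))" if "k < m" "0 < s" "s \<le> T" for k s
    using u1[OF that] ux[OF that(1,3), of 1] fint_evl[OF x_L1[OF _ that(1)] less_numeral_extra(1) that(2,3)] that
    by (simp add: Y_def evl_add sum.distrib \<phi>_sum algebra_simps)
  have FU: "(\<Sum>k<m. op_fun A D G (\<lambda>z. F z $$ (j, k)) (U s k)) = (\<Sum>l\<in>\<Lambda>. evl (\<Sum>k<m. Bop l j k (Y l k s)))"
    if "j < m" "0 < s" "s \<le> T" for j s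
    using that by (simp add: UY F_op[OF that(1)] Ym)
  have BL: "L1c T (\<lambda>\<tau>. \<Sum>k<m. Bop l j k (V k \<tau>))"
    if "l \<in> \<Lambda>" "j < m" "\<And>k. k < m \<Longrightarrow> continuous_on {0..T} (V k)" for l j V
    by (rule L1c_continuous[OF Bsum_cont[OF that]])
  have eqY: "(\<Sum>l\<in>\<Lambda>. evl (Y l j s)) = (\<Sum>l\<in>\<Lambda>. evl (\<phi> l j + fint 1 (g l j) s + K l (Y l) j s))"
    if j: "j < m" and s: "0 < s" "s \<le> T" for j s
  proof -
    let ?FU = "\<lambda>\<tau>. \<Sum>l\<in>\<Lambda>. evl (\<Sum>k<m. Bop l j k (Y l k \<tau>))"
    have LF: "L1c T ?FU"
      by (intro L1c_sum L1c_bounded_linear[OF bounded_linear_evl] BL Yc j)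
    have LH: "L1c T (\<lambda>s. H s j)"
      by (intro L1c_continuous continuous_on_subset[OF H_continuous[OF j]]) auto
    have b: "0 < \<beta> j" by (rule \<beta>_pos[OF j])
    have sol: "caputo_deriv (\<beta> j) (\<lambda>s. U s j) \<tau> = ?FU \<tau> + H \<tau> j" if "0 < \<tau>" "\<tau> \<le> T" for \<tau>
      using U j that unfolding FU[OF j that, symmetric] is_solution_def by blast
    have "fint 1 (u j) s = fint (\<beta> j) (\<lambda>\<tau>. ?FU \<tau> + H \<tau> j) s"
    proof (cases "\<beta> j = 1")
      case True
      show ?thesis
        unfolding True by (rule fint_cong) (use sol True s in \<open>simp add: caputo_deriv_def u_def\<close>)
    next
      case False
      then have a: "0 < 1 - \<beta> j" using \<beta>_le[OF j] by simp
      let ?x = "\<lambda>\<tau>. \<Sum>l\<in>\<Lambda>. evl (x l j \<tau>)"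
      have Lx: "L1c T ?x" by (intro L1c_sum L1c_bounded_linear[OF bounded_linear_evl] x_L1 j)
      have "fint 1 (u j) s = fint (\<beta> j) (fint (1 - \<beta> j) ?x) s"
        using fint_fint[OF Lx b a s] ux[OF j s(2), of 1] by simp
      also have "\<dots> = fint (\<beta> j) (\<lambda>\<tau>. ?FU \<tau> + H \<tau> j) s"
      proof (rule fint_cong)
        fix \<tau> assume \<tau>: "0 < \<tau>" "\<tau> < s"
        have "caputo_deriv (\<beta> j) (\<lambda>s. U s j) \<tau> = fint (1 - \<beta> j) (u j) \<tau>"
          using False b by (simp add: caputo_deriv_def frac_kernel_integral_eq u_def[abs_def])
        then show "fint (1 - \<beta> j) ?x \<tau> = ?FU \<tau> + H \<tau> j"
          using sol[of \<tau>] ux[OF j, of \<tau> "1 - \<beta> j"] \<tau> s by simp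
      qed
      finally show ?thesis .
    qed
    also have "\<dots> = fint (\<beta> j) ?FU s + fint (\<beta> j) (\<lambda>s. H s j) s"
      by (rule fint_add[OF LF LH b s])
    also have "fint (\<beta> j) ?FU s = (\<Sum>l\<in>\<Lambda>. evl (K l (Y l) j s))"
      using fint_evl[OF BL[OF _ j Yc] b s] by (simp add: K_eq[OF _ j])
    also have "fint (\<beta> j) (\<lambda>s. H s j) s = (\<Sum>l\<in>\<Lambda>. evl (fint 1 (g l j) s))"
      by (simp add: fint_H[OF j s(1)] fint_src[OF j less_numeral_extra(1) s])
    finally show ?thesis
      using u1[OF j s] UY[OF j s] by (simp add: evl_add sum.distrib \<phi>_sum[OF j] algebra_simps)
  qed
  define V where "V l k s = Y l k s - W l k s" for l k s
  have Vc: "continuous_on {0..T} (V l k)" if "l \<in> \<Lambda>" "k < m" for l k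
    unfolding V_def[abs_def] by (intro continuous_intros Yc W_cont that)
  have Vm: "V l k s \<in> espace A D l (\<mu> l)" if "l \<in> \<Lambda>" "k < m" "0 \<le> s" "s \<le> T" for l k s
    unfolding V_def by (intro subspace_diff[OF subspace_espace] Ym W_mem that)
  have KV: "K l (V l) j s = K l (Y l) j s - K l (W l) j s" if "l \<in> \<Lambda>" "j < m" "0 < s" "s \<le> T" for l j s
  proof -
    have "(\<Sum>k<m. Bop l j k (V l k \<tau>)) = (\<Sum>k<m. Bop l j k (Y l k \<tau>)) - (\<Sum>k<m. Bop l j k (W l k \<tau>))" for \<tau>
      unfolding V_def using that
      by (simp add: linear_diff[OF bounded_linear.linear[OF Bop_linear]] sum_subtractf)
    then show ?thesis
      unfolding K_eq[OF that(1,2)]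
      using fint_diff[OF BL[OF that(1,2) Yc] BL[OF that(1,2) W_cont] \<beta>_pos[OF that(2)] that(3,4)] that(1)
      by simp
  qed
  have KVm: "(K l ^^ N) (V l) k s \<in> espace A D l (\<mu> l)" if "l \<in> \<Lambda>" "k < m" "0 \<le> s" "s \<le> T" for l k s N
    using that(2-)
  proof (induction N arbitrary: k s)
    case (Suc N)
    show ?case
    proof (cases "s = 0")
      case False
      then have s: "0 < s" using Suc by simp
      have "fint (\<beta> k) (\<lambda>\<tau>. \<Sum>i<m. Bop l k i ((K l ^^ N) (V l) i \<tau>)) s \<in> espace A D l (\<mu> l)"
        by (rule fint_mem_closed_subspace[OF closed_espace subspace_espace _
            fint_integrable[OF BL[OF that(1) Suc.prems(1) K_pow_cont[OF that(1) _ Vc[OF that(1)]]] \<beta>_pos[OF Suc.prems(1)] s Suc.prems(3)]])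
          (use Suc that(1) in \<open>auto intro!: Bsum_mem\<close>)
      then show ?thesis by (simp add: K_eq[OF that(1) Suc.prems(1)])
    qed (use subspace_0[OF subspace_espace] in \<open>simp add: K_eq[OF that(1) Suc.prems(1)]\<close>)
  qed (use Vm that(1) in simp)
  have iter: "(\<Sum>l\<in>\<Lambda>. evl (V l k s)) = (\<Sum>l\<in>\<Lambda>. evl ((K l ^^ N) (V l) k s))" if "k < m" "0 < s" "s \<le> T" for k s N
    using that
  proof (induction N arbitrary: k s)
    case (Suc N)
    note k = Suc.prems(1) and s = Suc.prems(2,3)
    have "(\<Sum>l\<in>\<Lambda>. evl (V l k s)) = (\<Sum>l\<in>\<Lambda>. evl (Y l k s)) - (\<Sum>l\<in>\<Lambda>. evl (W l k s))"
      by (simp add: V_def evl_diff sum_subtractf)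
    also have "\<dots> = (\<Sum>l\<in>\<Lambda>. evl (K l (V l) k s))"
      unfolding eqY[OF k s]
      by (simp add: W_volterra[OF _ k s] KV[OF _ k s] evl_diff evl_add sum.distrib sum_subtractf)
    also have "\<dots> = fint (\<beta> k) (\<lambda>\<tau>. \<Sum>l\<in>\<Lambda>. evl (\<Sum>i<m. Bop l k i (V l i \<tau>))) s"
      using fint_evl[OF BL[OF _ k Vc] \<beta>_pos[OF k] s] by (simp add: K_eq[OF _ k])
    also have "\<dots> = fint (\<beta> k) (\<lambda>\<tau>. \<Sum>l\<in>\<Lambda>. evl (\<Sum>i<m. Bop l k i ((K l ^^ N) (V l) i \<tau>))) s"
    proof (rule fint_cong)
      fix \<tau> assume \<tau>: "0 < \<tau>" "\<tau> < s"
      \<comment> \<open>By the induction hypothesis \<open>V\<close> and its \<open>N\<close>-th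
        iterate decompose the same vectors, so \<open>F(A)\<close> has the same value on both,
        although the two decompositions may differ.\<close>
      have "(\<Sum>i<m. op_fun A D G (\<lambda>z. F z $$ (k, i)) (\<Sum>l\<in>\<Lambda>. evl (V l i \<tau>))) =
          (\<Sum>i<m. op_fun A D G (\<lambda>z. F z $$ (k, i)) (\<Sum>l\<in>\<Lambda>. evl ((K l ^^ N) (V l) i \<tau>)))"
        using Suc.IH \<tau> s by (intro sum.cong) auto
      then show "(\<Sum>l\<in>\<Lambda>. evl (\<Sum>i<m. Bop l k i (V l i \<tau>))) =
          (\<Sum>l\<in>\<Lambda>. evl (\<Sum>i<m. Bop l k i ((K l ^^ N) (V l) i \<tau>)))"
        using \<tau> s by (simp add: F_op[OF k] Vm KVm)
    qed
    also have "\<dots> = (\<Sum>l\<in>\<Lambda>. evl ((K l ^^ Suc N) (V l) k s))"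
      using fint_evl[OF BL[OF _ k K_pow_cont[OF _ _ Vc]] \<beta>_pos[OF k] s] by (simp add: K_eq[OF _ k])
    finally show ?case .
  qed simp
  have "(\<lambda>N. \<Sum>l\<in>\<Lambda>. evl ((K l ^^ N) (V l) j t)) \<longlonglongrightarrow> (\<Sum>l\<in>\<Lambda>. evl 0)"
    by (intro tendsto_sum bounded_linear.tendsto[OF bounded_linear_evl] K_pow_tendsto Vc j t)
  then have "(\<lambda>N::nat. \<Sum>l\<in>\<Lambda>. evl (V l j t)) \<longlonglongrightarrow> 0"
    unfolding iter[OF j t, symmetric] by (simp add: evl_0)
  then have "(\<Sum>l\<in>\<Lambda>. evl (V l j t)) = 0"
    by (simp add: LIMSEQ_const_iff)
  then show ?thesis
    unfolding UY[OF j t] by (simp add: V_def evl_diff sum_subtractf)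
qed

end

section \<open>From decomposed data to the Cauchy problem on the half-line\<close>

context frac_problem
begin

text \<open>The further family \<open>X\<close> will be the derivative of a given solution, which
  must live over the same points and radii as the data.\<close>

lemma decompose:
  assumes T: "0 < T" and X: "\<And>k. k < m \<Longrightarrow> XAG_L1_continuous A D G (X k)"
  obtains \<Lambda> \<mu> \<phi> g x where "frac_decomposed A D G m \<beta> F H \<Phi> n h T \<Lambda> \<mu> \<phi> g"
    "\<And>l k. l \<in> \<Lambda> \<Longrightarrow> k < m \<Longrightarrow> L1c T (x l k)"
    "\<And>l k t. l \<in> \<Lambda> \<Longrightarrow> k < m \<Longrightarrow> 0 < t \<Longrightarrow> t \<le> T \<Longrightarrow> x l k t \<in> espace A D l (\<mu> l)"
    "\<And>k t. k < m \<Longrightarrow> 0 < t \<Longrightarrow> t \<le> T \<Longrightarrow> X k t = (\<Sum>l\<in>\<Lambda>. evl (x l k t))"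
proof -
  define f where "f i = (if snd i = 0 then (\<lambda>_. \<Phi> (fst i)) else if snd i = 1 then src (fst i) else X (fst i))"
    for i :: "nat \<times> nat"
  let ?I = "{..<m} \<times> {..<3::nat}"
  have "XAG_L1_continuous A D G (f i)" if "i \<in> ?I" for i
    using that XAG_L1_const[OF initial] src_XAG X by (auto simp: f_def)
  then show thesis
  proof (rule XAG_L1_common[of ?I f T, rotated])
    fix \<Lambda> \<mu> d
    assume d: "radii \<Lambda> \<mu>" "\<And>i l. i \<in> ?I \<Longrightarrow> l \<in> \<Lambda> \<Longrightarrow> L1c T (d i l)"
    "\<And>i l t. i \<in> ?I \<Longrightarrow> l \<in> \<Lambda> \<Longrightarrow> 0 < t \<Longrightarrow> t \<le> T \<Longrightarrow> d i l t \<in> espace A D l (\<mu> l)"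
    "\<And>i t. i \<in> ?I \<Longrightarrow> 0 < t \<Longrightarrow> t \<le> T \<Longrightarrow> f i t = (\<Sum>l\<in>\<Lambda>. evl (d i l t))"
    show thesis
  \<comment> \<open>The initial values enter as constant functions whose decompositions may still
    vary with time; the one at time \<open>T\<close> is kept.\<close>
  proof (rule that[of \<Lambda> \<mu> "\<lambda>l k. d (k, 0) l T" "\<lambda>l k. d (k, 1) l" "\<lambda>l k. d (k, 2) l"])
    show "frac_decomposed A D G m \<beta> F H \<Phi> n h T \<Lambda> \<mu> (\<lambda>l k. d (k, 0) l T) (\<lambda>l k. d (k, 1) l)"
    proof (intro frac_decomposed.intro frac_decomposed_axioms.intro frac_problem_axioms T d(1))
      show "\<Phi> k = (\<Sum>l\<in>\<Lambda>. evl (d (k, 0) l T))" if "k < m" for k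
        using d(4)[of "(k, 0)" T] that T by (simp add: f_def)
      show "src k t = (\<Sum>l\<in>\<Lambda>. evl (d (k, 1) l t))" if "k < m" "0 < t" "t \<le> T" for k t
        using d(4)[of "(k, 1)" t] that by (simp add: f_def)
    qed (use d T in auto)
    show "X k t = (\<Sum>l\<in>\<Lambda>. evl (d (k, 2) l t))" if "k < m" "0 < t" "t \<le> T" for k t
      using d(4)[of "(k, 2)" t] that by (simp add: f_def)
  qed (use d in auto)
  qed (use T in auto)
qed

lemma decompose':
  assumes T: "0 < T"
  shows "\<exists>\<Lambda> \<mu> \<phi> g. frac_decomposed A D G m \<beta> F H \<Phi> n h T \<Lambda> \<mu> \<phi> g"
  by (rule decompose[OF T, of src]) (auto intro: src_XAG)

text \<open>Decompositions depend on the time interval, the right side of the formula does not. So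
  the result on each bounded interval can be used with a decomposition of its own, and the local
  conclusions fit together.\<close>

theorem solution_series_symbol:
  assumes S: "\<And>t z j k. 0 < t \<Longrightarrow> z \<in> G \<Longrightarrow> j < m \<Longrightarrow> k < m \<Longrightarrow> S t z $$ (j, k) = series_symbol h m n F t j k z"
  shows "solution_represented_by A D G m \<beta> F H \<Phi> S"
  unfolding solution_represented_by_def
proof (intro conjI allI impI)
  show "(\<lambda>z. S t z $$ (j, k)) holomorphic_on G" if "0 < t" "j < m" "k < m" for t j k
    using series_symbol_holomorphic[OF that] S that by (simp cong: holomorphic_cong)
  show "duhamel_integrand A D G m \<beta> S H t j integrable_on {0..t}" if t: "0 < t" and j: "j < m" for t j
  proof -
    obtain \<Lambda> \<mu> \<phi> g where "frac_decomposed A D G m \<beta> F H \<Phi> n h t \<Lambda> \<mu> \<phi> g"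
      using decompose'[OF t] by blast
    then interpret d: frac_decomposed A D G m \<beta> F H \<Phi> n h t \<Lambda> \<mu> \<phi> g .
    show ?thesis by (rule d.representation(1)[OF S j t order_refl])
  qed
  fix U
  let ?f = "\<lambda>t j. (\<Sum>k<m. op_fun A D G (\<lambda>z. S t z $$ (j, k)) (\<Phi> k)) + integral {0..t} (duhamel_integrand A D G m \<beta> S H t j)"
  show "is_solution A D G m \<beta> F H \<Phi> U \<longleftrightarrow> (\<forall>j<m. U 0 j = \<Phi> j \<and> (\<forall>t>0. U t j = ?f t j))"
  proof
    assume U: "is_solution A D G m \<beta> F H \<Phi> U"
    have "U t j = ?f t j" if j: "j < m" and t: "0 < t" for t j
    proof -
      have "XAG_L1_continuous A D G (\<lambda>t. vector_derivative (\<lambda>s. U s k) (at t))" if "k < m" for k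
        using U that by (simp add: is_solution_def)
      then show ?thesis
      proof (rule decompose[OF t, of "\<lambda>k t. vector_derivative (\<lambda>s. U s k) (at t)"])
        fix \<Lambda> \<mu> \<phi> g x
        assume "frac_decomposed A D G m \<beta> F H \<Phi> n h t \<Lambda> \<mu> \<phi> g"
          and x: "\<And>l k. l \<in> \<Lambda> \<Longrightarrow> k < m \<Longrightarrow> L1c t (x l k)"
            "\<And>l k s. l \<in> \<Lambda> \<Longrightarrow> k < m \<Longrightarrow> 0 < s \<Longrightarrow> s \<le> t \<Longrightarrow> x l k s \<in> espace A D l (\<mu> l)"
            "\<And>k s. k < m \<Longrightarrow> 0 < s \<Longrightarrow> s \<le> t \<Longrightarrow> vector_derivative (\<lambda>s. U s k) (at s) = (\<Sum>l\<in>\<Lambda>. evl (x l k s))"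
        then interpret d: frac_decomposed A D G m \<beta> F H \<Phi> n h t \<Lambda> \<mu> \<phi> g by simp
        show ?thesis
          using d.uniqueness[OF U x j t order_refl] d.representation(2)[OF S j t order_refl] by simp
      qed
    qed
    then show "\<forall>j<m. U 0 j = \<Phi> j \<and> (\<forall>t>0. U t j = ?f t j)"
      using U by (simp add: is_solution_def)
  next
    assume "\<forall>j<m. U 0 j = \<Phi> j \<and> (\<forall>t>0. U t j = ?f t j)"
    then have U0: "\<And>j. j < m \<Longrightarrow> U 0 j = \<Phi> j" and Uf: "\<And>j t. j < m \<Longrightarrow> 0 < t \<Longrightarrow> U t j = ?f t j"
      by auto
    have ex: "(\<forall>t. 0 \<le> t \<longrightarrow> t \<le> T \<longrightarrow> U t j \<in> X_AG A D G) \<and> continuous_on {0..T} (\<lambda>t. U t j) \<and>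
       (\<exists>\<Lambda> \<mu> d. radii \<Lambda> \<mu> \<and> (\<forall>l\<in>\<Lambda>. L1c T (d l) \<and> (\<forall>t\<in>{0<..T}. d l t \<in> espace A D l (\<mu> l))) \<and>
         (\<forall>t. 0 < t \<longrightarrow> t < T \<longrightarrow> ((\<lambda>s. U s j) has_vector_derivative (\<Sum>l\<in>\<Lambda>. evl (d l t))) (at t))) \<and>
       (\<forall>t. 0 < t \<longrightarrow> t < T \<longrightarrow> caputo_deriv (\<beta> j) (\<lambda>s. U s j) t =
          (\<Sum>k<m. op_fun A D G (\<lambda>z. F z $$ (j, k)) (U t k)) + H t j)" if j: "j < m" and T: "0 < T" for j T
    proof -
      obtain \<Lambda> \<mu> \<phi> g where "frac_decomposed A D G m \<beta> F H \<Phi> n h T \<Lambda> \<mu> \<phi> g"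
        using decompose'[OF T] by blast
      then interpret d: frac_decomposed A D G m \<beta> F H \<Phi> n h T \<Lambda> \<mu> \<phi> g .
      have W: "U t j = (\<Sum>l\<in>\<Lambda>. evl (d.W l j t))" if "j < m" "0 < t" "t \<le> T" for j t
        using Uf[OF that(1,2)] d.representation(2)[OF S that] by simp
      note e = d.existence[OF U0 W j]
      show ?thesis
      proof (intro conjI allI impI)
        show "\<exists>\<Lambda> \<mu> d. radii \<Lambda> \<mu> \<and> (\<forall>l\<in>\<Lambda>. L1c T (d l) \<and> (\<forall>t\<in>{0<..T}. d l t \<in> espace A D l (\<mu> l))) \<and>
         (\<forall>t. 0 < t \<longrightarrow> t < T \<longrightarrow> ((\<lambda>s. U s j) has_vector_derivative (\<Sum>l\<in>\<Lambda>. evl (d l t))) (at t))"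
          by (intro exI[of _ \<Lambda>] exI[of _ \<mu>] exI[of _ "\<lambda>l. d.v l j"] conjI ballI allI impI d.rad e(3))
            (auto intro: d.v_L1 d.v_mem j)
      qed (use e in auto)
    qed
    show "is_solution A D G m \<beta> F H \<Phi> U"
      unfolding is_solution_def
    proof (intro allI impI conjI)
      fix j assume j: "j < m"
      show "U t j \<in> X_AG A D G" if "0 \<le> t" for t
        using ex[OF j, of "t + 1"] that by simp
      show "continuous_on {0..} (\<lambda>t. U t j)"
        unfolding continuous_on_eq_continuous_within
      proof
        fix t :: real assume t: "t \<in> {0..}"
        then have "continuous (at t within {0..t + 1}) (\<lambda>t. U t j)"
          using ex[OF j, of "t + 1"] unfolding continuous_on_eq_continuous_within by auto
        moreover have "at t within {0..t + 1} = at t within {0..}"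
          by (rule at_within_nhd[of t "{..<t + 1}"]) (use t in auto)
        ultimately show "continuous (at t within {0..}) (\<lambda>t. U t j)" by simp
      qed
      \<comment> \<open>The interval up to \<open>t + 1\<close> has \<open>t\<close> in its
        interior.\<close>
      show "(\<lambda>s. U s j) differentiable (at t)" if t: "0 < t" for t
      proof -
        from ex[OF j, of "t + 1"] t obtain y where "((\<lambda>s. U s j) has_vector_derivative y) (at t)"
          by auto
        then show ?thesis by (rule differentiableI_vector)
      qed
      show "XAG_L1_continuous A D G (\<lambda>t. vector_derivative (\<lambda>s. U s j) (at t))"
      proof (rule XAG_L1_I)
        fix T :: real assume T: "0 < T"
        from ex[OF j, of "T + 1"] T
        have "\<exists>\<Lambda> \<mu> d. radii \<Lambda> \<mu> \<and> (\<forall>l\<in>\<Lambda>. L1c (T + 1) (d l) \<and> (\<forall>t\<in>{0<..T + 1}. d l t \<in> espace A D l (\<mu> l))) \<and>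
         (\<forall>t. 0 < t \<longrightarrow> t < T + 1 \<longrightarrow> ((\<lambda>s. U s j) has_vector_derivative (\<Sum>l\<in>\<Lambda>. evl (d l t))) (at t))"
          by simp
        then obtain \<Lambda> \<mu> d where r: "radii \<Lambda> \<mu>"
          and d: "\<forall>l\<in>\<Lambda>. L1c (T + 1) (d l) \<and> (\<forall>t\<in>{0<..T + 1}. d l t \<in> espace A D l (\<mu> l))"
          and der: "\<forall>t. 0 < t \<longrightarrow> t < T + 1 \<longrightarrow> ((\<lambda>s. U s j) has_vector_derivative (\<Sum>l\<in>\<Lambda>. evl (d l t))) (at t)"
          by (elim exE conjE)
        show "\<exists>\<Lambda> \<mu> d. radii \<Lambda> \<mu> \<and> (\<forall>l\<in>\<Lambda>. L1c T (d l) \<and> (\<forall>t\<in>{0<..T}. d l t \<in> espace A D l (\<mu> l))) \<and>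
            (\<forall>t\<in>{0<..T}. vector_derivative (\<lambda>s. U s j) (at t) = (\<Sum>l\<in>\<Lambda>. evl (d l t)))"
        proof (intro exI[of _ \<Lambda>] exI[of _ \<mu>] exI[of _ d] conjI ballI r)
          show "L1c T (d l)" if "l \<in> \<Lambda>" for l by (rule L1c_subset[of "T + 1"]) (use d that in auto)
        qed (use d der in \<open>auto intro!: vector_derivative_at\<close>)
      qed
      show "U 0 j = \<Phi> j" by (rule U0[OF j])
      show "caputo_deriv (\<beta> j) (\<lambda>s. U s j) t = (\<Sum>k<m. op_fun A D G (\<lambda>z. F z $$ (j, k)) (U t k)) + H t j"
        if "0 < t" for t
        using ex[OF j, of "t + 1"] that by simp
    qed
  qed
qed

end

section \<open>Mittag-Leffler functions\<close>

text \<open>The factor is \<open>(r + q)! / r!\<close>, written with a binomial coefficient to match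
  powers of Jordan blocks and poles.\<close>

lemma funpow_diffs:
  fixes c :: "nat \<Rightarrow> 'b::field_char_0"
  shows "(diffs ^^ q) c r = fact q * of_nat ((r + q) choose q) * c (r + q)"
proof (induction q arbitrary: r)
  case (Suc q)
  have 1: "(diffs ^^ Suc q) c r = of_nat (Suc r) * (fact q * of_nat ((Suc r + q) choose q) * c (Suc r + q))"
    by (simp add: diffs_def Suc.IH del: of_nat_Suc)
  have 2: "of_nat (Suc r) * (fact q * of_nat ((Suc r + q) choose q)) = (fact (Suc q) * of_nat ((r + Suc q) choose Suc q) :: 'b)"
  proof -
    have "Suc q * ((Suc r + q) choose Suc q) = Suc r * ((Suc r + q) choose q)"
      using binomial_absorb_comp[of "Suc r + q" q] by (metis Suc_times_binomial_add add.commute add_Suc_right)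
    then have "of_nat (Suc q) * of_nat ((Suc r + q) choose Suc q) = (of_nat (Suc r) * of_nat ((Suc r + q) choose q) :: 'b)"
      by (metis of_nat_mult)
    then show ?thesis by (simp add: algebra_simps del: of_nat_Suc binomial_Suc_Suc)
  qed
  show ?case
    unfolding 1 mult.assoc[of "fact q", symmetric] 2[symmetric] by (simp add: mult.assoc del: of_nat_Suc)
qed simp

lemma higher_deriv_powser:
  fixes c :: "nat \<Rightarrow> complex"
  assumes "\<And>z. summable (\<lambda>n. c n * z ^ n)"
  shows "(deriv ^^ q) (\<lambda>z. \<Sum>n. c n * z ^ n) = (\<lambda>z. \<Sum>n. (diffs ^^ q) c n * z ^ n)"
    and "summable (\<lambda>n. (diffs ^^ q) c n * z ^ n)"
proof -
  have s: "summable (\<lambda>n. (diffs ^^ q) c n * z ^ n)" for q z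
    by (induction q arbitrary: z) (use assms in \<open>auto intro: termdiff_converges_all\<close>)
  then show "summable (\<lambda>n. (diffs ^^ q) c n * z ^ n)" .
  show "(deriv ^^ q) (\<lambda>z. \<Sum>n. c n * z ^ n) = (\<lambda>z. \<Sum>n. (diffs ^^ q) c n * z ^ n)"
  proof (induction q)
    case (Suc q)
    show ?case
    proof
      fix z
      have "((\<lambda>z. \<Sum>n. (diffs ^^ q) c n * z ^ n) has_field_derivative (\<Sum>n. diffs ((diffs ^^ q) c) n * z ^ n)) (at z)"
        by (rule termdiffs_strong_converges_everywhere[OF s])
      then show "(deriv ^^ Suc q) (\<lambda>z. \<Sum>n. c n * z ^ n) z = (\<Sum>n. (diffs ^^ Suc q) c n * z ^ n)"
        using Suc.IH by (simp add: DERIV_imp_deriv)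
    qed
  qed simp
qed

text \<open>The estimate of \<open>kern_geometric_bound\<close> for a general second parameter,
  which may be smaller than 1.\<close>

lemma mittag_leffler_summable:
  assumes b: "0 < b" and \<nu>: "0 < \<nu>"
  shows "summable (\<lambda>n. (1 / complex_of_real (Gamma (b * real n + \<nu>))) * z ^ n)"
proof -
  define M where "M = norm z"
  define w where "w = (4 * (M + 1)) powr (1 / b)"
  have M: "0 \<le> M" by (simp add: M_def)
  have w: "0 < w" unfolding w_def using M by simp
  have "w powr - b = inverse (4 * (M + 1))"
    unfolding w_def using b M by (simp add: powr_powr powr_minus)
  then have "w powr - b * (4 * (M + 1)) = 1" using M by simp
  then have "4 * (M * w powr - b) + 4 * w powr - b = 1" by (simp add: algebra_simps)
  then have Mw: "M * w powr - b \<le> 1/4" "0 \<le> M * w powr - b"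
    using M powr_ge_zero[of w "- b"] by (linarith, simp)
  define K where "K = (b + \<nu>) * exp w * w powr - \<nu>"
  have K: "0 \<le> K" unfolding K_def using b \<nu> by simp
  have "norm ((1 / complex_of_real (Gamma (b * real n + \<nu>))) * z ^ n) \<le> K * (1/2) ^ n" for n
  proof -
    define a where "a = b * real n + \<nu>"
    have a: "0 < a" unfolding a_def using b \<nu> by (intro add_nonneg_pos) auto
    have G: "0 < Gamma a" by (rule Gamma_real_pos[OF a])
    have "Gamma (a + 1) = a * Gamma a"
      using a by (subst Gamma_plus1) (auto elim!: nonpos_Ints_cases)
    \<comment> \<open>One step of the functional equation moves the argument above 1, where the
      kernel estimate applies; the factor \<open>a\<close> grows at most like
      \<open>2^n\<close>.\<close>
    then have "1 / Gamma a = a * kern (a + 1) 1"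
      using a G by (simp add: kern_def)
    also have "\<dots> \<le> a * (exp (w * 1) * w powr - a)"
      by (intro mult_left_mono kern_le_exp w) (use a in auto)
    finally have 1: "1 / Gamma a \<le> a * (exp w * w powr - a)" by simp
    have "a \<le> (b + \<nu>) * 2 ^ n"
    proof -
      have "a \<le> (b + \<nu>) * (real n + 1)" unfolding a_def using b \<nu> by (simp add: algebra_simps)
      also have "real n + 1 \<le> 2 ^ n"
        using less_exp[of n] by (metis Suc_eq_plus1 Suc_leI of_nat_1 of_nat_add of_nat_le_iff of_nat_numeral of_nat_power)
      finally show ?thesis using b \<nu> by simp
    qed
    then have "a * (exp w * w powr - a) \<le> (b + \<nu>) * 2 ^ n * (exp w * w powr - a)"
      by (rule mult_right_mono) simp
    with 1 have 2: "1 / Gamma a \<le> (b + \<nu>) * 2 ^ n * (exp w * w powr - a)" by linarith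
    have 3: "w powr - a = w powr - \<nu> * (w powr - b) ^ n"
    proof -
      have "- a = - \<nu> + (- b) * real n" by (simp add: a_def)
      then have "w powr - a = w powr - \<nu> * (w powr - b) powr real n"
        by (simp only: powr_add powr_powr)
      then show ?thesis using w by (simp add: powr_realpow)
    qed
    have 4: "(b + \<nu>) * 2 ^ n * (exp w * (w powr - \<nu> * (w powr - b) ^ n)) = K * (2 ^ n * (w powr - b) ^ n)"
      by (simp add: K_def)
    have 2: "1 / Gamma a \<le> K * (2 ^ n * (w powr - b) ^ n)"
      by (rule ord_le_eq_trans[OF 2[unfolded 3] 4])
    have "norm ((1 / complex_of_real (Gamma a)) * z ^ n) = 1 / Gamma a * M ^ n"
      using G by (simp add: norm_mult norm_divide norm_power M_def)
    also have "\<dots> \<le> K * (2 ^ n * (w powr - b) ^ n) * M ^ n"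
      by (rule mult_right_mono[OF 2]) (simp add: M)
    also have "\<dots> = K * (2 * (M * w powr - b)) ^ n"
      by (simp add: power_mult_distrib mult_ac)
    also have "\<dots> \<le> K * (1/2) ^ n"
      by (intro mult_left_mono power_mono K) (use Mw in auto)
    finally show ?thesis by (simp add: a_def)
  qed
  then show ?thesis
    by (intro summable_comparison_test'[OF summable_mult[OF summable_geometric[of "1/2"]], where N=0 and c1=K]) auto
qed

text \<open>Indexed from 0 rather than \<open>q\<close>: for \<open>r < q\<close> the binomial
  coefficient vanishes, so the truncated exponent is harmless.\<close>

lemma mittag_leffler_deriv_sums:
  assumes b: "0 < b" and \<nu>: "0 < \<nu>"
  shows "(\<lambda>r. of_nat (r choose q) * z ^ (r - q) / complex_of_real (Gamma (b * real r + \<nu>))) sums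
    ((deriv ^^ q) (mittag_leffler b \<nu>) z / fact q)"
proof -
  define c where "c n = 1 / complex_of_real (Gamma (b * real n + \<nu>))" for n
  have s: "summable (\<lambda>n. c n * z ^ n)" for z
    unfolding c_def by (rule mittag_leffler_summable[OF b \<nu>])
  have "mittag_leffler b \<nu> = (\<lambda>z. \<Sum>n. c n * z ^ n)"
    by (simp add: mittag_leffler_def[abs_def] c_def)
  then have "(deriv ^^ q) (mittag_leffler b \<nu>) z = (\<Sum>n. (diffs ^^ q) c n * z ^ n)"
    using higher_deriv_powser(1)[OF s, of q] by simp
  then have "(\<lambda>n. (diffs ^^ q) c n * z ^ n) sums (deriv ^^ q) (mittag_leffler b \<nu>) z"
    using summable_sums[OF higher_deriv_powser(2)[OF s, of q z]] by simp
  then have "(\<lambda>n. (diffs ^^ q) c n * z ^ n / fact q) sums ((deriv ^^ q) (mittag_leffler b \<nu>) z / fact q)"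
    by (rule sums_divide)
  then have "(\<lambda>r. of_nat ((r + q) choose q) * z ^ (r + q - q) / complex_of_real (Gamma (b * real (r + q) + \<nu>))) sums
    ((deriv ^^ q) (mittag_leffler b \<nu>) z / fact q)"
    by (simp add: funpow_diffs c_def)
  then show ?thesis
    by (subst (asm) sums_zero_iff_shift[where f="\<lambda>r. of_nat (r choose q) * z ^ (r - q) / complex_of_real (Gamma (b * real r + \<nu>))"])
      auto
qed

section \<open>Equal orders\<close>

lemma mult_mat_entry:
  assumes "A \<in> carrier_mat m m" "B \<in> carrier_mat m m" "i < m" "j < m"
  shows "(A * B) $$ (i, j) = (\<Sum>l<m. A $$ (i, l) * B $$ (l, j))"
  using assms by (simp add: scalar_prod_def lessThan_atLeast0)

lemma pow_mat_Suc_left: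
  assumes "(A :: 'b::comm_ring_1 mat) \<in> carrier_mat m m"
  shows "A ^\<^sub>m Suc i = A * A ^\<^sub>m i"
proof (induction i)
  case (Suc i)
  have "A ^\<^sub>m Suc (Suc i) = (A * A ^\<^sub>m i) * A"
    using Suc by simp
  also have "\<dots> = A * (A ^\<^sub>m i * A)"
    by (rule assoc_mult_mat) (use assms in auto)
  finally show ?case by simp
qed (use assms in simp)

text \<open>When all \<open>n j\<close> are 1 the recursion multiplies by \<open>F z\<close> from
  the left.\<close>

lemma symbol_coeff_power:
  assumes "F z \<in> carrier_mat m m" "j < m" "k < m"
  shows "symbol_coeff m (\<lambda>_. 1) F i j k z = (F z ^\<^sub>m i) $$ (j, k)"
  using assms(2)
proof (induction i arbitrary: j)
  case 0
  then show ?case using assms by (simp add: symbol_coeff.simps)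
next
  case (Suc i)
  have "F z ^\<^sub>m i \<in> carrier_mat m m" using assms(1) by simp
  then show ?case
    unfolding pow_mat_Suc_left[OF assms(1)]
    by (subst mult_mat_entry[OF assms(1) _ Suc.prems assms(3)], assumption, subst symbol_coeff.simps)
      (simp add: Suc del: One_nat_def)
qed

lemma ml_matrix_series_symbol:
  assumes "F z \<in> carrier_mat m m" "j < m" "k < m"
  shows "ml_matrix m b F t z $$ (j, k) = series_symbol b m (\<lambda>_. 1) F t j k z"
  using assms by (simp add: ml_matrix_def series_symbol_def symbol_coeff_power kern_def del: One_nat_def)

lemma diag_block_mat_sums:
  fixes f :: "nat \<Rightarrow> nat \<times> complex \<Rightarrow> complex mat" and c :: "nat \<Rightarrow> complex"
  assumes "\<And>r x. x \<in> set bs \<Longrightarrow> f r x \<in> carrier_mat (fst x) (fst x)"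
    and "\<And>x. x \<in> set bs \<Longrightarrow> Y x \<in> carrier_mat (fst x) (fst x)"
    and "\<And>x i j. x \<in> set bs \<Longrightarrow> i < fst x \<Longrightarrow> j < fst x \<Longrightarrow> (\<lambda>r. c r * f r x $$ (i, j)) sums Y x $$ (i, j)"
    and "i < sum_list (map fst bs)" "j < sum_list (map fst bs)"
  shows "(\<lambda>r. c r * diag_block_mat (map (f r) bs) $$ (i, j)) sums diag_block_mat (map Y bs) $$ (i, j)"
  using assms
proof (induction bs arbitrary: i j)
  case (Cons x bs)
  let ?d = "fst x"
  have dims: "dim_row (diag_block_mat (map g bs)) = sum_list (map fst bs)"
    "dim_col (diag_block_mat (map g bs)) = sum_list (map fst bs)"
    if "\<And>y. y \<in> set bs \<Longrightarrow> g y \<in> carrier_mat (fst y) (fst y)" for g :: "nat \<times> complex \<Rightarrow> complex mat"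
  proof -
    have "map dim_row (map g bs) = map fst bs" "map dim_col (map g bs) = map fst bs" using that by auto
    then show "dim_row (diag_block_mat (map g bs)) = sum_list (map fst bs)"
      "dim_col (diag_block_mat (map g bs)) = sum_list (map fst bs)"
      by (simp_all only: dim_diag_block_mat)
  qed
  have E: "diag_block_mat (map g (x # bs)) $$ (i, j) =
      (if i < ?d then if j < ?d then g x $$ (i, j) else 0
       else if j < ?d then 0 else diag_block_mat (map g bs) $$ (i - ?d, j - ?d))"
    if g: "\<And>y. y \<in> set (x # bs) \<Longrightarrow> g y \<in> carrier_mat (fst y) (fst y)" for g :: "nat \<times> complex \<Rightarrow> complex mat"
  proof -
    have gx: "dim_row (g x) = ?d" "dim_col (g x) = ?d" using g[of x] by auto
    have ds: "dim_row (diag_block_mat (map g bs)) = sum_list (map fst bs)"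
      "dim_col (diag_block_mat (map g bs)) = sum_list (map fst bs)"
      by (rule dims, use g in simp)+
    show ?thesis
      using Cons.prems(4,5) by (simp add: Let_def gx ds)
  qed
  have IH: "(\<lambda>r. c r * diag_block_mat (map (f r) bs) $$ (i - ?d, j - ?d)) sums diag_block_mat (map Y bs) $$ (i - ?d, j - ?d)"
    if "\<not> i < ?d" "\<not> j < ?d"
    by (rule Cons.IH) (use Cons.prems that in auto)
  have "diag_block_mat (map (f r) (x # bs)) $$ (i, j) =
      (if i < ?d then if j < ?d then f r x $$ (i, j) else 0
       else if j < ?d then 0 else diag_block_mat (map (f r) bs) $$ (i - ?d, j - ?d))" for r
    by (rule E[OF Cons.prems(1)])
  moreover have "diag_block_mat (map Y (x # bs)) $$ (i, j) =
      (if i < ?d then if j < ?d then Y x $$ (i, j) else 0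
       else if j < ?d then 0 else diag_block_mat (map Y bs) $$ (i - ?d, j - ?d))"
    by (rule E[OF Cons.prems(2)])
  moreover have "(\<lambda>r. c r * f r x $$ (i, j)) sums Y x $$ (i, j)" if "i < ?d" "j < ?d"
    by (rule Cons.prems(3)) (use that in auto)
  ultimately show ?case
    using IH by (simp only: split: if_split) auto
qed simp

text \<open>The superdiagonal \<open>q\<close> of the \<open>r\<close>-th power of a Jordan block is
  \<open>(r choose q) * a^(r - q)\<close>, which is also the coefficient pattern of the
  \<open>q\<close>-th derivative divided by \<open>q!\<close>.\<close>

lemma ml_block_sums:
  assumes b: "0 < b" and t: "0 < t" and ij: "i < d" "j < d"
  shows "(\<lambda>r. complex_of_real (t powr (real r * b) / Gamma (real r * b + 1)) * (jordan_block d a ^\<^sub>m r) $$ (i, j)) sums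
    ml_block b t d a $$ (i, j)"
proof (cases "i \<le> j")
  case True
  define q where "q = j - i"
  define z where "z = a * complex_of_real (t powr b)"
  have "(\<lambda>r. complex_of_real (t powr (real q * b)) *
      (of_nat (r choose q) * z ^ (r - q) / complex_of_real (Gamma (b * real r + 1)))) sums
      (complex_of_real (t powr (real q * b)) * ((deriv ^^ q) (mittag_leffler b 1) z / fact q))"
    by (intro sums_mult mittag_leffler_deriv_sums b) simp
  moreover have "complex_of_real (t powr (real q * b)) *
      (of_nat (r choose q) * z ^ (r - q) / complex_of_real (Gamma (b * real r + 1))) =
      complex_of_real (t powr (real r * b) / Gamma (real r * b + 1)) * (jordan_block d a ^\<^sub>m r) $$ (i, j)" for r
  proof (cases "q \<le> r")
    case qr: True
    have "t powr (real q * b) * (t powr b) ^ (r - q) = t powr (real r * b)"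
      using t qr by (simp add: powr_realpow[symmetric] powr_powr powr_add[symmetric] of_nat_diff algebra_simps)
    then have *: "complex_of_real (t powr (real q * b)) * z ^ (r - q) = complex_of_real (t powr (real r * b)) * a ^ (r - q)"
      by (simp add: z_def power_mult_distrib mult_ac flip: of_real_mult of_real_power)
    have "r + i - j = r - q" using True by (simp add: q_def)
    then show ?thesis
      using True ij * by (simp add: jordan_block_pow q_def[symmetric] mult.commute[of b] mult.left_commute)
  next
    case False
    then have 0: "r choose q = 0" by (simp add: binomial_eq_0)
    have "(jordan_block d a ^\<^sub>m r) $$ (i, j) = of_nat (r choose q) * a ^ (r + i - j)"
      using True ij by (simp add: jordan_block_pow q_def)
    then show ?thesis by (simp add: 0)
  qed
  ultimately show ?thesis
    using True ij by (simp add: ml_block_def q_def z_def)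
next
  case False
  then show ?thesis using ij by (simp add: jordan_block_pow ml_block_def)
qed

lemma ml_matrix_jordan:
  assumes b: "0 < b" and t: "0 < t" and bs: "sum_list (map fst bs) = m"
    and M: "M \<in> carrier_mat m m" "Minv \<in> carrier_mat m m" "M * Minv = 1\<^sub>m m" "Minv * M = 1\<^sub>m m"
    and F: "F z = M * jordan_matrix bs * Minv"
  shows "ml_matrix m b F t z = M * ml_jordan_matrix b t bs * Minv"
proof -
  define c where "c r = complex_of_real (t powr (real r * b) / Gamma (real r * b + 1))" for r
  define J where "J r = jordan_matrix bs ^\<^sub>m r" for r
  have J1: "jordan_matrix bs \<in> carrier_mat m m"
    using bs by (intro carrier_matI) auto
  then have J: "J r \<in> carrier_mat m m" for r by (simp add: J_def)
  have Fc: "F z \<in> carrier_mat m m" unfolding F using M J1 by auto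
  have "similar_mat_wit (F z) (jordan_matrix bs) M Minv"
    unfolding similar_mat_wit_def Let_def using M J1 F Fc by auto
  then have Fp: "F z ^\<^sub>m r = M * J r * Minv" for r
    unfolding J_def by (rule similar_mat_wit_pow_id)
  let ?E = "ml_jordan_matrix b t bs"
  have bc: "ml_block b t d a \<in> carrier_mat d d" for d a by (simp add: ml_block_def)
  have "map dim_row (map (\<lambda>(d, a). ml_block b t d a) bs) = map fst bs"
    "map dim_col (map (\<lambda>(d, a). ml_block b t d a) bs) = map fst bs"
    by (auto simp: ml_block_def)
  then have E: "?E \<in> carrier_mat m m"
    unfolding ml_jordan_matrix_def using bs by (intro carrier_matI) (simp_all only: dim_diag_block_mat)
  have JE: "(\<lambda>r. c r * J r $$ (i, j)) sums ?E $$ (i, j)" if "i < m" "j < m" for i j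
    unfolding J_def jordan_matrix_pow ml_jordan_matrix_def
  proof (rule diag_block_mat_sums)
    fix x :: "nat \<times> complex" and i j
    assume "i < fst x" "j < fst x"
    then show "(\<lambda>r. c r * (case x of (d, a) \<Rightarrow> jordan_block d a ^\<^sub>m r) $$ (i, j)) sums
        (case x of (d, a) \<Rightarrow> ml_block b t d a) $$ (i, j)"
      unfolding c_def case_prod_unfold by (rule ml_block_sums[OF b t])
  qed (use that bs bc in \<open>auto simp: case_prod_unfold\<close>)
  have "(\<lambda>r. c r * (F z ^\<^sub>m r) $$ (i, j)) sums (M * ?E * Minv) $$ (i, j)" if ij: "i < m" "j < m" for i j
  proof -
    have e: "(M * X * Minv) $$ (i, j) = (\<Sum>q<m. (\<Sum>p<m. M $$ (i, p) * X $$ (p, q)) * Minv $$ (q, j))"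
      if X: "X \<in> carrier_mat m m" for X
    proof -
      have "(M * X * Minv) $$ (i, j) = (\<Sum>q<m. (M * X) $$ (i, q) * Minv $$ (q, j))"
        by (rule mult_mat_entry) (use M X ij in auto)
      moreover have "(M * X) $$ (i, q) = (\<Sum>p<m. M $$ (i, p) * X $$ (p, q))" if "q < m" for q
        by (rule mult_mat_entry[OF M(1) X ij(1) that])
      ultimately show ?thesis by simp
    qed
    have "(\<lambda>r. \<Sum>q<m. (\<Sum>p<m. M $$ (i, p) * (c r * J r $$ (p, q))) * Minv $$ (q, j)) sums
        (\<Sum>q<m. (\<Sum>p<m. M $$ (i, p) * ?E $$ (p, q)) * Minv $$ (q, j))"
      by (intro sums_sum sums_mult2 sums_mult JE) auto
    moreover have "(\<Sum>q<m. (\<Sum>p<m. M $$ (i, p) * (c r * J r $$ (p, q))) * Minv $$ (q, j)) = c r * (F z ^\<^sub>m r) $$ (i, j)" for r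
      unfolding Fp e[OF J] by (simp add: sum_distrib_left mult_ac)
    ultimately show ?thesis by (simp add: e[OF E])
  qed
  then have "ml_matrix m b F t z $$ (i, j) = (M * ?E * Minv) $$ (i, j)" if "i < m" "j < m" for i j
    using that by (simp add: ml_matrix_def c_def sums_iff)
  then show ?thesis
    by (intro eq_matI) (use M E in \<open>auto simp: ml_matrix_def\<close>)
qed

section \<open>Rational orders\<close>

text \<open>The quotients of determinants are the entries of column \<open>k\<close> of the inverse
  matrix; the adjugate supplies that column and Cramer's lemma identifies its entries.\<close>

lemma cramer_system:
  fixes A :: "complex mat"
  assumes A: "A \<in> carrier_mat m m" and d: "Determinant.det A \<noteq> 0" and k: "k < m" and i: "i < m"
  shows "(\<Sum>l<m. A $$ (i, l) * (Determinant.det (Matrix.mat m m (\<lambda>(r, c). if c = l then (if r = k then 1 else 0) else A $$ (r, c)))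
      / Determinant.det A)) = (if i = k then 1 else 0)"
proof -
  let ?d = "Determinant.det A"
  define x where "x = Matrix.vec m (\<lambda>l. adj_mat A $$ (l, k) / ?d)"
  have x: "x \<in> carrier_vec m" by (simp add: x_def)
  note adj = adj_mat[OF A]
  have Ax: "(\<Sum>l<m. A $$ (r, l) * (adj_mat A $$ (l, k) / ?d)) = (if r = k then 1 else 0)" if r: "r < m" for r
  proof -
    have "(\<Sum>l<m. A $$ (r, l) * adj_mat A $$ (l, k)) = (A * adj_mat A) $$ (r, k)"
      by (rule mult_mat_entry[OF A adj(1) r k, symmetric])
    also have "\<dots> = ?d * (if r = k then 1 else 0)"
      unfolding adj(2) using r k by simp
    finally have "(\<Sum>l<m. A $$ (r, l) * adj_mat A $$ (l, k)) / ?d = (if r = k then 1 else 0)"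
      using d by simp
    then show ?thesis by (simp add: sum_divide_distrib)
  qed
  have "Matrix.vec_index (A *\<^sub>v x) r = (if r = k then 1 else 0)" if r: "r < m" for r
    using Ax[OF r] A r by (simp add: x_def scalar_prod_def lessThan_atLeast0)
  then have "replace_col A (A *\<^sub>v x) l = Matrix.mat m m (\<lambda>(r, c). if c = l then (if r = k then 1 else 0) else A $$ (r, c))" for l
    using A by (intro eq_matI) (auto simp: replace_col_def)
  then have "Determinant.det (Matrix.mat m m (\<lambda>(r, c). if c = l then (if r = k then 1 else 0) else A $$ (r, c))) = Matrix.vec_index x l * ?d"
    if "l < m" for l
    using cramer_lemma_mat[OF A x that] by simp
  then show ?thesis
    using Ax[OF i] d by (simp add: x_def)
qed

section \<open>Expansion of partial fractions at infinity\<close>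

text \<open>The coefficient of \<open>y^i\<close> in \<open>(y / (1 - a * y))^(q + 1)\<close>, the
  expansion of a pole of order \<open>q + 1\<close> in \<open>y = 1 / x\<close>. The index 0 is
  separate because truncated subtraction would give 1 there for \<open>q = 0\<close>.\<close>

definition pole_coeff :: "nat \<Rightarrow> complex \<Rightarrow> nat \<Rightarrow> complex" where
  "pole_coeff q a i = (if i = 0 then 0 else of_nat ((i - 1) choose q) * a ^ (i - 1 - q))"

lemma norm_pole_coeff_le:
  assumes "norm a \<le> K" "1 \<le> K"
  shows "norm (pole_coeff q a i) \<le> (2 * K) ^ i"
proof (cases "i = 0 \<or> i - 1 < q")
  case True
  then show ?thesis using assms by (auto simp: pole_coeff_def binomial_eq_0)
next
  case False
  have "norm (pole_coeff q a i) = real ((i - 1) choose q) * norm a ^ (i - 1 - q)"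
    using False by (simp add: pole_coeff_def norm_mult norm_power)
  also have "\<dots> \<le> 2 ^ i * K ^ i"
  proof (rule mult_mono)
    have "(i - 1) choose q \<le> 2 ^ (i - 1)" by (rule binomial_le_pow2)
    also have "\<dots> \<le> (2::nat) ^ i" by (rule power_increasing) auto
    finally show "real ((i - 1) choose q) \<le> 2 ^ i" by (metis of_nat_le_iff of_nat_numeral of_nat_power)
    have "norm a ^ (i - 1 - q) \<le> K ^ (i - 1 - q)" using assms by (intro power_mono) auto
    also have "\<dots> \<le> K ^ i" using assms by (intro power_increasing) auto
    finally show "norm a ^ (i - 1 - q) \<le> K ^ i" .
  qed (use assms in auto)
  finally show ?thesis by (simp add: power_mult_distrib)
qed

lemma pole_coeff_summable:
  fixes y :: complex
  assumes "norm a \<le> K" "1 \<le> K" "norm y * (2 * K) < 1"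
  shows "summable (\<lambda>i. pole_coeff q a i * y ^ i)"
proof (rule summable_comparison_test'[where N=0])
  show "summable (\<lambda>i. (norm y * (2 * K)) ^ i)"
    by (rule summable_geometric) (use assms in auto)
  show "norm (pole_coeff q a i * y ^ i) \<le> (norm y * (2 * K)) ^ i" for i
    using mult_right_mono[OF norm_pole_coeff_le[OF assms(1,2), of q i], of "norm y ^ i"]
    by (simp add: norm_mult norm_power power_mult_distrib mult_ac)
qed

lemma pole_coeff_sums:
  fixes y :: complex
  assumes K: "norm a \<le> K" "1 \<le> K" "norm y * (2 * K) < 1" and y: "y \<noteq> 0"
  shows "(\<lambda>i. pole_coeff q a i * y ^ i) sums (1 / (1 / y - a) ^ Suc q)"
proof -
  have "norm (a * y) \<le> norm y * (2 * K) * (1/2)"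
    using mult_right_mono[OF K(1), of "norm y"] by (simp add: norm_mult mult_ac)
  then have "norm (a * y) < 1" using K(3) by linarith
  then have ay: "1 - a * y \<noteq> 0" by auto
  have e: "1 / (1 / y - a) = y / (1 - a * y)"
    using y by (simp add: field_simps)
  note s = summable_sums[OF pole_coeff_summable[OF K]]
  define S where "S q = (\<Sum>i. pole_coeff q a i * y ^ i)" for q
  have shift: "(\<lambda>i. pole_coeff q a (Suc i) * y ^ Suc i) sums S q" for q
    using s[of q] sums_Suc_iff[of "\<lambda>i. pole_coeff q a i * y ^ i"] by (simp add: S_def pole_coeff_def)
  have "S q = (y / (1 - a * y)) ^ Suc q"
  proof (induction q)
    case 0
    have "(\<lambda>i. y * (a * y) ^ i) sums (y * (1 / (1 - a * y)))"
      by (intro sums_mult geometric_sums) fact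
    moreover have "y * (a * y) ^ i = pole_coeff 0 a (Suc i) * y ^ Suc i" for i
      by (simp add: pole_coeff_def power_mult_distrib)
    ultimately show ?case using sums_unique2[OF shift[of 0]] by simp
  next
    case (Suc q)
    \<comment> \<open>Pascal's rule; summed against powers of \<open>y\<close> it says
      \<open>(1 - a * y) * S (Suc q) = y * S q\<close>.\<close>
    have pc: "pole_coeff (Suc q) a (Suc i) = a * pole_coeff (Suc q) a i + pole_coeff q a i" for i
    proof (cases i)
      case (Suc i')
      consider "i' < q" | "i' = q" | "q < i'" by linarith
      then show ?thesis
      proof cases
        case 3
        then obtain d where "i' = Suc q + d" using less_iff_Suc_add by auto
        then show ?thesis by (simp add: pole_coeff_def Suc algebra_simps)
      qed (auto simp: pole_coeff_def Suc binomial_eq_0)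
    qed (simp add: pole_coeff_def)
    have "(\<lambda>i. a * y * (pole_coeff (Suc q) a i * y ^ i) + y * (pole_coeff q a i * y ^ i)) sums (a * y * S (Suc q) + y * S q)"
      unfolding S_def by (intro sums_add sums_mult s)
    moreover have eq: "a * y * (pole_coeff (Suc q) a i * y ^ i) + y * (pole_coeff q a i * y ^ i) = pole_coeff (Suc q) a (Suc i) * y ^ Suc i" for i
      by (simp add: pc algebra_simps)
    ultimately have "(\<lambda>i. pole_coeff (Suc q) a (Suc i) * y ^ Suc i) sums (a * y * S (Suc q) + y * S q)"
      by (simp only: eq)
    then have "S (Suc q) = a * y * S (Suc q) + y * S q"
      by (rule sums_unique2[OF shift])
    then have "(1 - a * y) * S (Suc q) = y * S q" by (simp add: algebra_simps)
    then have "S (Suc q) = y / (1 - a * y) * S q" using ay by (simp add: field_simps)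
    then show ?case by (simp add: Suc.IH)
  qed
  moreover have "1 / (1 / y - a) ^ Suc q = (y / (1 - a * y)) ^ Suc q"
    unfolding e[symmetric] by (simp only: power_one_over)
  ultimately show ?thesis
    using s[of q] unfolding S_def by metis
qed

lemma power_series_eq_0:
  fixes d :: "nat \<Rightarrow> complex"
  assumes r: "0 < r" and s: "\<And>y. norm y < r \<Longrightarrow> summable (\<lambda>i. d i * y ^ i)"
    and z: "\<And>y :: real. 0 < y \<Longrightarrow> y < r \<Longrightarrow> (\<Sum>i. d i * complex_of_real y ^ i) = 0"
  shows "d m = 0"
proof (rule ccontr)
  assume d: "d m \<noteq> 0"
  \<comment> \<open>An extra factor \<open>y\<close> makes the function vanish at 0 and moves
    \<open>d m\<close> to a positive index, as the theorem on isolated zeros of power series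
    asks.\<close>
  define a where "a i = (case i of 0 \<Rightarrow> 0 | Suc i' \<Rightarrow> d i')" for i
  define f where "f y = y * (\<Sum>i. d i * y ^ i)" for y
  have sm: "(\<lambda>i. a i * (y - 0) ^ i) sums f y" if "norm (y - 0) < r" for y
  proof -
    have "(\<lambda>i. y * (d i * y ^ i)) sums f y"
      unfolding f_def by (intro sums_mult summable_sums s) (use that in simp)
    then have "(\<lambda>i. a (Suc i) * y ^ Suc i) sums f y"
      by (simp add: a_def mult.left_commute)
    then show ?thesis
      by (subst (asm) sums_Suc_iff) (simp add: a_def)
  qed
  obtain e where e: "0 < e" "\<And>y. y \<in> cball 0 e - {0} \<Longrightarrow> f y \<noteq> 0"
    by (rule powser_0_nonzero[OF r sm, of "Suc m"]) (use d in \<open>auto simp: f_def a_def\<close>)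
  define y where "y = min e (r / 2)"
  have "f (complex_of_real y) = 0"
    using z[of y] e(1) r by (simp add: f_def y_def)
  moreover have "complex_of_real y \<in> cball 0 e - {0}"
    using e(1) r by (auto simp: y_def)
  ultimately show False using e(2) by blast
qed

text \<open>Expanding \<open>W = (diag(x ^ n j) - F)\<^sup>-\<^sup>1 e_k\<close> in powers of \<open>1 / x\<close> gives the same recursion as for
  the coefficients of the series symbol, with the index shifted by \<open>n k\<close>.\<close>

lemma resolvent_coeff_recursion:
  fixes F :: "nat \<Rightarrow> nat \<Rightarrow> complex" and c :: "nat \<Rightarrow> nat \<Rightarrow> complex" and W :: "nat \<Rightarrow> real \<Rightarrow> complex"
  assumes r: "0 < r" and c0: "\<And>j. j < m \<Longrightarrow> c j 0 = 0"
    and s: "\<And>j y. j < m \<Longrightarrow> norm y < r \<Longrightarrow> summable (\<lambda>i. c j i * y ^ i)"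
    and eq: "\<And>j y :: real. j < m \<Longrightarrow> 0 < y \<Longrightarrow> y < r \<Longrightarrow>
      (1 / complex_of_real y) ^ n j * (\<Sum>i. c j i * complex_of_real y ^ i) -
      (\<Sum>l<m. F j l * (\<Sum>i. c l i * complex_of_real y ^ i)) = (if j = k then 1 else 0)"
    and j: "j < m"
  shows "c j i = (if j = k \<and> i = n k then 1 else 0) + (if n j \<le> i then \<Sum>l<m. F j l * c l (i - n j) else 0)"
proof -
  \<comment> \<open>The coefficients of row \<open>j\<close> of the equation after multiplication by
    \<open>y ^ n j\<close>.\<close>
  define d where "d i = c j i - (if n j \<le> i then \<Sum>l<m. F j l * c l (i - n j) else 0) - (if j = k \<and> i = n k then 1 else 0)" for i
  have sums: "(\<lambda>i. d i * y ^ i) sums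
      ((\<Sum>i. c j i * y ^ i) - y ^ n j * (\<Sum>l<m. F j l * (\<Sum>i. c l i * y ^ i)) - (if j = k then y ^ n k else 0))"
    if y: "norm y < r" for y
  proof -
    have "(\<lambda>i. y ^ n j * (\<Sum>l<m. F j l * (c l i * y ^ i))) sums (y ^ n j * (\<Sum>l<m. F j l * (\<Sum>i. c l i * y ^ i)))"
      using s[OF _ y] by (intro sums_mult sums_sum summable_sums) auto
    then have "(\<lambda>i. (if n j \<le> i + n j then \<Sum>l<m. F j l * c l (i + n j - n j) else 0) * y ^ (i + n j)) sums
        (y ^ n j * (\<Sum>l<m. F j l * (\<Sum>i. c l i * y ^ i)))"
      by (simp add: sum_distrib_left sum_distrib_right power_add mult_ac)
    then have 1: "(\<lambda>i. (if n j \<le> i then \<Sum>l<m. F j l * c l (i - n j) else 0) * y ^ i) sums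
        (y ^ n j * (\<Sum>l<m. F j l * (\<Sum>i. c l i * y ^ i)))"
      by (subst (asm) sums_zero_iff_shift[where f="\<lambda>i. (if n j \<le> i then \<Sum>l<m. F j l * c l (i - n j) else 0) * y ^ i"]) auto
    have "(\<lambda>i. if i = n k then (if j = k then y ^ n k else 0) else 0) sums (if j = k then y ^ n k else 0)"
      by (rule sums_single)
    then have 2: "(\<lambda>i. (if j = k \<and> i = n k then 1 else 0) * y ^ i) sums (if j = k then y ^ n k else 0)"
      by (rule back_subst[where P="\<lambda>f. f sums _"]) auto
    show ?thesis
      unfolding d_def left_diff_distrib by (intro sums_diff 1 2 summable_sums s[OF j y])
  qed
  have "d i = 0"
  proof (rule power_series_eq_0[OF r])
    show "summable (\<lambda>i. d i * y ^ i)" if "norm y < r" for y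
      using sums[OF that] by (rule sums_summable)
    fix y :: real assume y: "0 < y" "y < r"
    let ?y = "complex_of_real y"
    have y0: "?y \<noteq> 0" using y by simp
    have "?y ^ n j * ((1 / ?y) ^ n j * (\<Sum>i. c j i * ?y ^ i) - (\<Sum>l<m. F j l * (\<Sum>i. c l i * ?y ^ i))) =
        ?y ^ n j * (if j = k then 1 else 0)"
      unfolding eq[OF j y] ..
    then have "(\<Sum>i. c j i * ?y ^ i) - ?y ^ n j * (\<Sum>l<m. F j l * (\<Sum>i. c l i * ?y ^ i)) - (if j = k then ?y ^ n k else 0) = 0"
      using y0 by (auto simp: right_diff_distrib power_one_over mult.assoc[symmetric] split: if_splits)
    then show "(\<Sum>i. d i * ?y ^ i) = 0"
      using sums_unique[OF sums[of ?y]] y by simp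
  qed
  moreover have "u = w + v" if "u - v - w = 0" for u v w :: complex
    using that by (simp add: algebra_simps)
  ultimately show ?thesis unfolding d_def by blast
qed

text \<open>The inhomogeneity sits at index \<open>n k\<close>, so nothing happens before it; from
  there on both sequences obey the same recursion, which determines them by strong
  induction.\<close>

lemma coeff_eq_symbol_coeff:
  assumes n: "\<And>j. j < m \<Longrightarrow> 0 < n j"
    and rec: "\<And>j i. j < m \<Longrightarrow> c j i = (if j = k \<and> i = n k then 1 else 0) +
       (if n j \<le> i then \<Sum>l<m. F z $$ (j, l) * c l (i - n j) else 0)"
    and k: "k < m"
  shows "j < m \<Longrightarrow> i < n k \<Longrightarrow> c j i = 0"
    and "j < m \<Longrightarrow> c j (i + n k) = symbol_coeff m n F i j k z"
proof -
  have z: "c j i = 0" if "j < m" "i < n k" for j i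
    using that
  proof (induction i arbitrary: j rule: less_induct)
    case (less i)
    have "c l (i - n j) = 0" if "l < m" "n j \<le> i" for l
      using less that n[OF less.prems(1)] by (intro less.IH) auto
    then show ?case using less.prems by (subst rec) auto
  qed
  then show "j < m \<Longrightarrow> i < n k \<Longrightarrow> c j i = 0" .
  show "j < m \<Longrightarrow> c j (i + n k) = symbol_coeff m n F i j k z"
  proof (induction i arbitrary: j rule: less_induct)
    case (less i)
    note j = less.prems and nj = n[OF less.prems]
    consider "i = 0" | "0 < i" "i < n j" | "0 < i" "n j \<le> i" by linarith
    then show ?case
    proof cases
      case 1
      have "(if n j \<le> n k then \<Sum>l<m. F z $$ (j, l) * c l (n k - n j) else 0) = 0"
        using nj by (auto simp: z)
      then show ?thesis using 1 rec[OF j, of "n k"] by (simp add: symbol_coeff.simps)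
    next
      case 2
      have "(if n j \<le> i + n k then \<Sum>l<m. F z $$ (j, l) * c l (i + n k - n j) else 0) = 0"
        using 2 by (auto simp: z)
      then show ?thesis using 2 rec[OF j, of "i + n k"] by (simp add: symbol_coeff.simps)
    next
      case 3
      have "c l (i + n k - n j) = symbol_coeff m n F (i - n j) l k z" if "l < m" for l
        using less.IH[of "i - n j" l] that 3 nj by (simp add: add.commute)
      then show ?thesis using 3 rec[OF j, of "i + n k"] nj by (simp add: symbol_coeff.simps)
    qed
  qed
qed

lemma poly_P_N0:
  assumes s: "x = s powr (1 / real p)" "0 < s" "0 < p" and \<beta>: "\<And>j. j < m \<Longrightarrow> \<beta> j = real (n j) / real p"
  shows "poly (P_N0 m n F z) (complex_of_real x) = Determinant.det (pencil m \<beta> F s z)"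
    and "i < m \<Longrightarrow> s powr \<beta> i = x ^ n i"
proof -
  show pw: "s powr \<beta> i = x ^ n i" if "i < m" for i
  proof -
    have "x ^ n i = x powr real (n i)" using s by (simp add: powr_realpow)
    also have "\<dots> = s powr (1 / real p * real (n i))" unfolding s(1) by (simp add: powr_powr)
    finally show ?thesis by (simp add: \<beta>[OF that])
  qed
  show "poly (P_N0 m n F z) (complex_of_real x) = Determinant.det (pencil m \<beta> F s z)"
    unfolding P_N0_def
    by (rule poly_det_cong[of _ m]) (auto simp: pencil_def pw poly_monom)
qed

lemma resolvent_system:
  assumes s: "x = s powr (1 / real p)" "0 < s" "0 < p" and \<beta>: "\<And>j. j < m \<Longrightarrow> \<beta> j = real (n j) / real p"
    and P: "\<And>j \<phi>. j < m \<Longrightarrow> Determinant.det (cramer_matrix m \<beta> F \<phi> j s z) =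
       (\<Sum>k<m. poly (P j k) (complex_of_real (s powr (1 / real p))) * complex_of_real (s powr (\<beta> k - 1)) * \<phi> k)"
    and d: "poly (P_N0 m n F z) (complex_of_real x) \<noteq> 0" and j: "j < m" and k: "k < m"
  shows "complex_of_real x ^ n j * (poly (P j k) (complex_of_real x) / poly (P_N0 m n F z) (complex_of_real x)) -
     (\<Sum>l<m. F z $$ (j, l) * (poly (P l k) (complex_of_real x) / poly (P_N0 m n F z) (complex_of_real x))) =
     (if j = k then 1 else 0)"
proof -
  let ?A = "pencil m \<beta> F s z" and ?x = "complex_of_real x"
  have A: "?A \<in> carrier_mat m m" by (simp add: pencil_def)
  have dA: "poly (P_N0 m n F z) ?x = Determinant.det ?A"
    by (rule poly_P_N0(1)[OF s]) (rule \<beta>)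
  have xn: "s powr \<beta> i = x ^ n i" if "i < m" for i
    by (rule poly_P_N0(2)[OF s _ that]) (rule \<beta>)
  \<comment> \<open>This choice cancels the weight \<open>s powr (\<beta> k - 1)\<close>, so the
    replaced column is the unit vector \<open>k\<close> and the determinant reduces to the single
    polynomial \<open>P l k\<close>.\<close>
  define \<phi> where "\<phi> i = (if i = k then complex_of_real (s powr (1 - \<beta> k)) else 0)" for i
  have one: "complex_of_real (s powr (\<beta> k - 1)) * complex_of_real (s powr (1 - \<beta> k)) = 1"
    using s(2) by (simp flip: of_real_mult powr_add)
  have D: "Determinant.det (Matrix.mat m m (\<lambda>(r, c). if c = l then (if r = k then 1 else 0) else ?A $$ (r, c))) = poly (P l k) ?x"
    if l: "l < m" for l
  proof -
    have "Matrix.mat m m (\<lambda>(r, c). if c = l then (if r = k then 1 else 0) else ?A $$ (r, c)) = cramer_matrix m \<beta> F \<phi> l s z"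
      unfolding cramer_matrix_def by (rule cong_mat) (auto simp: \<phi>_def one)
    moreover have "(\<Sum>k'<m. poly (P l k') ?x * complex_of_real (s powr (\<beta> k' - 1)) * \<phi> k') =
        (\<Sum>k'<m. if k' = k then poly (P l k) ?x else 0)"
      by (rule sum.cong) (auto simp: \<phi>_def one mult.assoc)
    ultimately show ?thesis
      using P[OF l, of \<phi>] k by (simp flip: s(1))
  qed
  have "(if j = k then 1 else 0) = (\<Sum>l<m. ?A $$ (j, l) * (poly (P l k) ?x / Determinant.det ?A))"
    using cramer_system[OF A _ k j] d dA by (simp add: D)
  also have "\<dots> = (\<Sum>l<m. (if l = j then ?x ^ n j * (poly (P j k) ?x / Determinant.det ?A) else 0) -
      F z $$ (j, l) * (poly (P l k) ?x / Determinant.det ?A))"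
    using j by (intro sum.cong) (auto simp: pencil_def xn left_diff_distrib diff_divide_distrib)
  also have "\<dots> = ?x ^ n j * (poly (P j k) ?x / Determinant.det ?A) - (\<Sum>l<m. F z $$ (j, l) * (poly (P l k) ?x / Determinant.det ?A))"
    using j by (simp add: sum_subtractf)
  finally show ?thesis unfolding dA by simp
qed

text \<open>With \<open>x = s powr (1 / p)\<close>, the inverse Laplace transform formally sends
  \<open>s powr (\<beta> k - 1) / x^(r + 1)\<close> to the kernel of order
  \<open>(r + 1) / p - \<beta> k + 1\<close>. Applied termwise to the expansion at infinity, it
  yields the Mittag-Leffler derivatives pole by pole, and the series symbol after the coefficients
  are identified by their recursion.\<close>

lemma partial_fraction_series_symbol:
  fixes P :: "nat \<Rightarrow> nat \<Rightarrow> complex poly"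
  assumes p: "0 < p" and n: "\<And>j. j < m \<Longrightarrow> 0 < n j" "\<And>j. j < m \<Longrightarrow> n j \<le> p"
    and \<beta>: "\<And>j. j < m \<Longrightarrow> \<beta> j = real (n j) / real p"
    and N0: "P_N0 m n F z = (\<Prod>l<Lh. [:- lamh l z, 1:] ^ mu l)"
    and P: "\<And>j \<phi> s. j < m \<Longrightarrow> 0 < s \<Longrightarrow> Determinant.det (cramer_matrix m \<beta> F \<phi> j s z) =
       (\<Sum>k<m. poly (P j k) (complex_of_real (s powr (1 / real p))) * complex_of_real (s powr (\<beta> k - 1)) * \<phi> k)"
    and C: "\<And>j k x. j < m \<Longrightarrow> k < m \<Longrightarrow> (\<forall>l<Lh. x \<noteq> lamh l z) \<Longrightarrow>
       poly (P j k) x / (\<Prod>l<Lh. (x - lamh l z) ^ mu l) = (\<Sum>l<Lh. \<Sum>\<nu>=1..mu l. C j k l \<nu> z / (x - lamh l z) ^ \<nu>)"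
    and j: "j < m" and k: "k < m" and t: "0 < t"
  shows "partial_fraction_symbol m \<beta> p Lh lamh mu C t z $$ (j, k) = series_symbol (1 / real p) m n F t j k z"
proof -
  \<comment> \<open>Bounds every root and is at least 1; all poles then expand for
    \<open>norm y < 1 / (2 * K)\<close>.\<close>
  define K where "K = 1 + (\<Sum>l<Lh. norm (lamh l z))"
  have K1: "1 \<le> K" unfolding K_def by (simp add: sum_nonneg)
  have lK: "norm (lamh l z) \<le> K" if "l < Lh" for l
    using member_le_sum[of l "{..<Lh}" "\<lambda>l. norm (lamh l z)"] that by (simp add: K_def)
  define r where "r = 1 / (2 * K)"
  have r: "0 < r" using K1 by (simp add: r_def)
  have yr: "norm y * (2 * K) < 1" if "norm y < r" for y :: complex
    using that K1 by (simp add: r_def field_simps)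
  define c where "c j i = (\<Sum>l<Lh. \<Sum>\<nu>=1..mu l. C j k l \<nu> z * pole_coeff (\<nu> - 1) (lamh l z) i)" for j i
  have csum: "(\<lambda>i. c j i * y ^ i) sums (\<Sum>l<Lh. \<Sum>\<nu>=1..mu l. C j k l \<nu> z * (\<Sum>i. pole_coeff (\<nu> - 1) (lamh l z) i * y ^ i))"
    if "norm y < r" for j y
    unfolding c_def sum_distrib_right mult.assoc
    by (intro sums_sum sums_mult summable_sums pole_coeff_summable[OF lK K1 yr[OF that]]) auto
  have Wc: "poly (P j k) (1 / complex_of_real y) / poly (P_N0 m n F z) (1 / complex_of_real y) = (\<Sum>i. c j i * complex_of_real y ^ i)"
    and nz: "poly (P_N0 m n F z) (1 / complex_of_real y) \<noteq> 0"
    if j: "j < m" and y: "0 < y" "y < r" for j y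
  proof -
    let ?y = "complex_of_real y"
    have ny: "norm ?y < r" "?y \<noteq> 0" using y by auto
    have ne: "1 / ?y \<noteq> lamh l z" if "l < Lh" for l
    proof
      assume e: "1 / ?y = lamh l z"
      have "1 / y = norm (1 / ?y)" using y by (simp add: norm_divide)
      also have "\<dots> \<le> K" unfolding e by (rule lK[OF that])
      finally have "1 \<le> K * y" using y by (simp add: field_simps)
      moreover have "2 * (K * y) < 1" using yr[OF ny(1)] y by (simp add: mult_ac)
      ultimately show False by simp
    qed
    have N: "poly (P_N0 m n F z) (1 / ?y) = (\<Prod>l<Lh. (1 / ?y - lamh l z) ^ mu l)"
      unfolding N0 by (simp add: poly_prod poly_power)
    show "poly (P_N0 m n F z) (1 / ?y) \<noteq> 0"
      unfolding N using ne by (simp add: prod_zero_iff)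
    have "poly (P j k) (1 / ?y) / poly (P_N0 m n F z) (1 / ?y) =
        (\<Sum>l<Lh. \<Sum>\<nu>=1..mu l. C j k l \<nu> z / (1 / ?y - lamh l z) ^ \<nu>)"
      unfolding N by (rule C[OF j k]) (use ne in auto)
    also have "\<dots> = (\<Sum>l<Lh. \<Sum>\<nu>=1..mu l. C j k l \<nu> z * (\<Sum>i. pole_coeff (\<nu> - 1) (lamh l z) i * ?y ^ i))"
    proof (intro sum.cong refl)
      fix l \<nu> assume l: "l \<in> {..<Lh}" and \<nu>: "\<nu> \<in> {1..mu l}"
      have e: "Suc (\<nu> - 1) = \<nu>" using \<nu> by simp
      have "(\<lambda>i. pole_coeff (\<nu> - 1) (lamh l z) i * ?y ^ i) sums (1 / (1 / ?y - lamh l z) ^ Suc (\<nu> - 1))"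
        by (rule pole_coeff_sums[OF lK K1 yr[OF ny(1)] ny(2)]) (use l in simp)
      then have "(\<Sum>i. pole_coeff (\<nu> - 1) (lamh l z) i * ?y ^ i) = 1 / (1 / ?y - lamh l z) ^ \<nu>"
        unfolding e by (rule sums_unique[symmetric])
      then show "C j k l \<nu> z / (1 / ?y - lamh l z) ^ \<nu> = C j k l \<nu> z * (\<Sum>i. pole_coeff (\<nu> - 1) (lamh l z) i * ?y ^ i)"
        using \<nu> by simp
    qed
    also have "\<dots> = (\<Sum>i. c j i * ?y ^ i)"
      by (rule sums_unique[OF csum[OF ny(1)]])
    finally show "poly (P j k) (1 / ?y) / poly (P_N0 m n F z) (1 / ?y) = (\<Sum>i. c j i * ?y ^ i)" .
  qed
  have rec: "c j i = (if j = k \<and> i = n k then 1 else 0) + (if n j \<le> i then \<Sum>l<m. F z $$ (j, l) * c l (i - n j) else 0)"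
    if j: "j < m" for j i
  proof (rule resolvent_coeff_recursion[OF r _ _ _ j])
    show "c j 0 = 0" for j by (simp add: c_def pole_coeff_def)
    show "summable (\<lambda>i. c j i * y ^ i)" if "norm y < r" for j y
      using csum[OF that] by (rule sums_summable)
    fix j and y :: real assume j: "j < m" and y: "0 < y" "y < r"
    define x where "x = 1 / y"
    \<comment> \<open>The time frequency for which \<open>s powr (1 / p)\<close> is the given
      \<open>1 / y\<close>.\<close>
    define s where "s = x powr real p"
    have x: "0 < x" using y by (simp add: x_def)
    have s: "x = s powr (1 / real p)" "0 < s" using x p by (simp_all add: s_def powr_powr)
    have xy: "complex_of_real x = 1 / complex_of_real y" by (simp add: x_def)
    show "(1 / complex_of_real y) ^ n j * (\<Sum>i. c j i * complex_of_real y ^ i) -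
        (\<Sum>l<m. F z $$ (j, l) * (\<Sum>i. c l i * complex_of_real y ^ i)) = (if j = k then 1 else 0)"
      using resolvent_system[OF s p \<beta> P[OF _ s(2)] _ j k] nz[OF j y] Wc[OF _ y] j unfolding xy by simp
  qed
  have ce0: "c j i = 0" if "i < n k" for i
    by (rule coeff_eq_symbol_coeff(1)[where c=c and n=n and m=m and k=k and F=F and z=z])
      (use n(1) rec k j that in auto)
  have ce: "c j (i + n k) = symbol_coeff m n F i j k z" for i
    by (rule coeff_eq_symbol_coeff(2)[where c=c and n=n and m=m and k=k and F=F and z=z])
      (use n(1) rec k j in auto)
  \<comment> \<open>The kernel order belonging to coefficient \<open>r + 1\<close>. As
    \<open>\<beta> k = n k / p\<close>, coefficient \<open>i + n k\<close> receives the order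
    \<open>i / p + 1\<close> of the series symbol.\<close>
  let ?E = "\<lambda>r. real (Suc r) / real p - \<beta> k + 1"
  have pos: "0 < 1 / real p - \<beta> k + 1"
  proof -
    have "\<beta> k \<le> 1" using n(2)[OF k] p by (simp add: \<beta>[OF k])
    moreover have "0 < 1 / real p" using p by simp
    ultimately show ?thesis by linarith
  qed
  have term_sums: "(\<lambda>r. C j k l \<nu> z * pole_coeff (\<nu> - 1) (lamh l z) (Suc r) * complex_of_real (kern (?E r) t)) sums
      (C j k l \<nu> z * complex_of_real (t powr (real \<nu> / real p - \<beta> k)) / fact (\<nu> - 1) *
       (deriv ^^ (\<nu> - 1)) (mittag_leffler (1 / real p) (1 / real p - \<beta> k + 1)) (complex_of_real (t powr (1 / real p)) * lamh l z))"
    if "\<nu> \<in> {1..mu l}" for l \<nu>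
  proof -
    define q where "q = \<nu> - 1"
    have \<nu>: "\<nu> = Suc q" using that by (simp add: q_def)
    let ?w = "complex_of_real (t powr (1 / real p)) * lamh l z"
    let ?a = "C j k l \<nu> z * complex_of_real (t powr (real \<nu> / real p - \<beta> k))"
    have "(\<lambda>r. ?a * (of_nat (r choose q) * ?w ^ (r - q) / complex_of_real (Gamma (1 / real p * real r + (1 / real p - \<beta> k + 1))))) sums
        (?a * ((deriv ^^ q) (mittag_leffler (1 / real p) (1 / real p - \<beta> k + 1)) ?w / fact q))"
      by (intro sums_mult mittag_leffler_deriv_sums pos) (use p in simp)
    moreover have "?a * (of_nat (r choose q) * ?w ^ (r - q) / complex_of_real (Gamma (1 / real p * real r + (1 / real p - \<beta> k + 1)))) =
        C j k l \<nu> z * pole_coeff (\<nu> - 1) (lamh l z) (Suc r) * complex_of_real (kern (?E r) t)" for r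
    proof (cases "q \<le> r")
      case True
      have G: "1 / real p * real r + (1 / real p - \<beta> k + 1) = ?E r"
        by (simp add: add_divide_distrib)
      have e: "real \<nu> / real p - \<beta> k + 1 / real p * real (r - q) = ?E r - 1"
        using True by (simp add: \<nu> of_nat_diff add_divide_distrib diff_divide_distrib)
      have "(t powr (1 / real p)) ^ (r - q) = t powr (1 / real p * real (r - q))"
        using t by (simp add: powr_realpow[symmetric] powr_powr)
      then have "t powr (real \<nu> / real p - \<beta> k) * (t powr (1 / real p)) ^ (r - q) = t powr (?E r - 1)"
        by (simp only: powr_add[symmetric] e)
      then have *: "complex_of_real (t powr (real \<nu> / real p - \<beta> k)) * complex_of_real (t powr (1 / real p)) ^ (r - q) = complex_of_real (t powr (?E r - 1))"
        by (simp flip: of_real_mult of_real_power)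
      have "?a * (of_nat (r choose q) * ?w ^ (r - q) / complex_of_real (Gamma (?E r))) =
          C j k l \<nu> z * (of_nat (r choose q) * lamh l z ^ (r - q)) *
          ((complex_of_real (t powr (real \<nu> / real p - \<beta> k)) * complex_of_real (t powr (1 / real p)) ^ (r - q)) / complex_of_real (Gamma (?E r)))"
        by (simp add: power_mult_distrib mult_ac)
      then show ?thesis
        unfolding G * by (simp add: kern_def pole_coeff_def q_def)
    next
      case False
      then show ?thesis by (simp add: pole_coeff_def binomial_eq_0 q_def)
    qed
    ultimately show ?thesis by (simp add: q_def)
  qed
  have "(\<lambda>r. c j (Suc r) * complex_of_real (kern (?E r) t)) sums partial_fraction_symbol m \<beta> p Lh lamh mu C t z $$ (j, k)"
    using j k unfolding partial_fraction_symbol_def c_def sum_distrib_right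
    by (simp only: index_mat case_prod_conv) (intro sums_sum term_sums)
  \<comment> \<open>Coefficients below \<open>n k\<close> vanish; because the series runs over
    \<open>Suc r\<close>, the first \<open>n k - 1\<close> terms are dropped.\<close>
  moreover obtain N where N: "n k = Suc N" using n(1)[OF k] gr0_implies_Suc by blast
  ultimately have "(\<lambda>i. c j (Suc (i + N)) * complex_of_real (kern (?E (i + N)) t)) sums partial_fraction_symbol m \<beta> p Lh lamh mu C t z $$ (j, k)"
    using ce0 by (subst sums_zero_iff_shift[where f="\<lambda>r. c j (Suc r) * complex_of_real (kern (?E r) t)"]) auto
  moreover have "c j (Suc (i + N)) = symbol_coeff m n F i j k z" for i
    using ce[of i] N by simp
  moreover have "?E (i + N) = real i * (1 / real p) + 1" for i
    using N p by (simp add: \<beta>[OF k] add_divide_distrib)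
  ultimately have "(\<lambda>i. symbol_coeff m n F i j k z * complex_of_real (kern (real i * (1 / real p) + 1) t)) sums
      partial_fraction_symbol m \<beta> p Lh lamh mu C t z $$ (j, k)"
    by (simp only:)
  then show ?thesis
    by (simp add: series_symbol_def sums_iff mult.commute)
qed

text \<open>By \<open>solution_series_symbol\<close> each part needs only the agreement of its
  symbol with the series symbol on \<open>G\<close>; the Jordan form in the first part is a separate
  matrix identity.\<close>

theorem theorem3p7:
  fixes A :: "'a::complex_banach \<Rightarrow> 'a" and D :: "'a set" and G :: "complex set"
    and m :: nat and \<beta> :: "nat \<Rightarrow> real" and F :: "complex \<Rightarrow> complex mat"
    and H :: "real \<Rightarrow> nat \<Rightarrow> 'a" and \<Phi> :: "nat \<Rightarrow> 'a"
    and L :: nat and lam :: "nat \<Rightarrow> complex \<Rightarrow> complex" and ml :: "nat \<Rightarrow> nat"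
  assumes reflexive: "reflexive_space TYPE('a)"
    and op: "closed_dense_operator A D"
    and spec: "op_spectrum A D \<noteq> {}"
    and G: "open G"
    and calculus: "calculus_well_defined A D G"
    and F_dim: "\<And>z. z \<in> G \<Longrightarrow> F z \<in> carrier_mat m m"
    and F_analytic: "\<And>j k. j < m \<Longrightarrow> k < m \<Longrightarrow> (\<lambda>z. F z $$ (j, k)) holomorphic_on G"
    and Q0: "G \<inter> Q0 m \<beta> F = {}"
    and initial: "\<And>j. j < m \<Longrightarrow> \<Phi> j \<in> X_AG A D G"
    and source: "admissible_source A D G m \<beta> H"
    and mult_pos: "\<And>l. l < L \<Longrightarrow> 0 < ml l"
    and mult_sum: "(\<Sum>l<L. ml l) = m"
    and eigenvalues: "\<And>z. z \<in> G \<Longrightarrow> char_poly (F z) = (\<Prod>l<L. [:- lam l z, 1:] ^ ml l)"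
  shows
    "(\<forall>b. 0 < b \<and> b \<le> 1 \<and> (\<forall>j<m. \<beta> j = b) \<longrightarrow>
        solution_represented_by A D G m \<beta> F H \<Phi> (ml_matrix m b F) \<and>
        (\<forall>M Minv.
           (\<forall>z\<in>G. M z \<in> carrier_mat m m \<and> Minv z \<in> carrier_mat m m \<and>
              M z * Minv z = 1\<^sub>m m \<and> Minv z * M z = 1\<^sub>m m \<and>
              F z = M z * jordan_matrix (map (\<lambda>l. (ml l, lam l z)) [0..<L]) * Minv z) \<longrightarrow>
           (\<forall>t>0. \<forall>z\<in>G. ml_matrix m b F t z =
              M z * ml_jordan_matrix b t (map (\<lambda>l. (ml l, lam l z)) [0..<L]) * Minv z)))
     \<and>
     (\<forall>(q :: nat \<Rightarrow> nat) (pd :: nat \<Rightarrow> nat) p n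
        Lh (lamh :: nat \<Rightarrow> complex \<Rightarrow> complex) mu
        (P :: nat \<Rightarrow> nat \<Rightarrow> complex \<Rightarrow> complex poly)
        (C :: nat \<Rightarrow> nat \<Rightarrow> nat \<Rightarrow> nat \<Rightarrow> complex \<Rightarrow> complex).
        (\<forall>j<m. 0 < q j \<and> 0 < pd j \<and> coprime (pd j) (q j) \<and>
           \<beta> j = real (q j) / real (pd j) \<and> \<beta> j \<le> 1) \<and>
        p = Lcm (pd ` {..<m}) \<and>
        (\<forall>j<m. n j = q j * p div pd j) \<and>
        (\<forall>l<Lh. 0 < mu l) \<and>
        (\<forall>z\<in>G. inj_on (\<lambda>l. lamh l z) {..<Lh} \<and>
           P_N0 m n F z = (\<Prod>l<Lh. [:- lamh l z, 1:] ^ mu l)) \<and>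
        (\<forall>z\<in>G. \<forall>j<m. \<forall>\<phi>. \<forall>s>0.
           Determinant.det (cramer_matrix m \<beta> F \<phi> j s z) =
             (\<Sum>k<m. poly (P j k z) (complex_of_real (s powr (1 / real p))) *
                complex_of_real (s powr (\<beta> k - 1)) * \<phi> k)) \<and>
        (\<forall>z\<in>G. \<forall>j<m. \<forall>k<m. \<forall>x. (\<forall>l<Lh. x \<noteq> lamh l z) \<longrightarrow>
           poly (P j k z) x / (\<Prod>l<Lh. (x - lamh l z) ^ mu l) =
             (\<Sum>l<Lh. \<Sum>\<nu>=1..mu l. C j k l \<nu> z / (x - lamh l z) ^ \<nu>)) \<longrightarrow>
        solution_represented_by A D G m \<beta> F H \<Phi>
          (partial_fraction_symbol m \<beta> p Lh lamh mu C))"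
proof (intro conjI allI impI)
  fix b :: real
  assume b: "0 < b \<and> b \<le> 1 \<and> (\<forall>j<m. \<beta> j = b)"
  interpret frac_problem A D G m \<beta> F H \<Phi> "\<lambda>_. 1" b
    by unfold_locales (use op G calculus F_analytic initial source b in auto)
  show "solution_represented_by A D G m \<beta> F H \<Phi> (ml_matrix m b F)"
    by (rule solution_series_symbol) (rule ml_matrix_series_symbol[OF F_dim])
  fix M Minv :: "complex \<Rightarrow> complex mat" and t :: real and z
  assume M: "\<forall>z\<in>G. M z \<in> carrier_mat m m \<and> Minv z \<in> carrier_mat m m \<and>
      M z * Minv z = 1\<^sub>m m \<and> Minv z * M z = 1\<^sub>m m \<and>
      F z = M z * jordan_matrix (map (\<lambda>l. (ml l, lam l z)) [0..<L]) * Minv z"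
    and t: "0 < t"
  show "\<forall>z\<in>G. ml_matrix m b F t z = M z * ml_jordan_matrix b t (map (\<lambda>l. (ml l, lam l z)) [0..<L]) * Minv z"
  proof
    fix z assume z: "z \<in> G"
    have "sum_list (map fst (map (\<lambda>l. (ml l, lam l z)) [0..<L])) = m"
      using mult_sum by (simp add: o_def interv_sum_list_conv_sum_set_nat lessThan_atLeast0)
    then show "ml_matrix m b F t z = M z * ml_jordan_matrix b t (map (\<lambda>l. (ml l, lam l z)) [0..<L]) * Minv z"
      using M z b t by (intro ml_matrix_jordan) auto
  qed
next
  fix q pd :: "nat \<Rightarrow> nat" and p n Lh
    and lamh :: "nat \<Rightarrow> complex \<Rightarrow> complex" and mu
    and P :: "nat \<Rightarrow> nat \<Rightarrow> complex \<Rightarrow> complex poly"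
    and C :: "nat \<Rightarrow> nat \<Rightarrow> nat \<Rightarrow> nat \<Rightarrow> complex \<Rightarrow> complex"
  assume *: "(\<forall>j<m. 0 < q j \<and> 0 < pd j \<and> coprime (pd j) (q j) \<and>
           \<beta> j = real (q j) / real (pd j) \<and> \<beta> j \<le> 1) \<and>
        p = Lcm (pd ` {..<m}) \<and>
        (\<forall>j<m. n j = q j * p div pd j) \<and>
        (\<forall>l<Lh. 0 < mu l) \<and>
        (\<forall>z\<in>G. inj_on (\<lambda>l. lamh l z) {..<Lh} \<and>
           P_N0 m n F z = (\<Prod>l<Lh. [:- lamh l z, 1:] ^ mu l)) \<and>
        (\<forall>z\<in>G. \<forall>j<m. \<forall>\<phi>. \<forall>s>0.
           Determinant.det (cramer_matrix m \<beta> F \<phi> j s z) =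
             (\<Sum>k<m. poly (P j k z) (complex_of_real (s powr (1 / real p))) *
                complex_of_real (s powr (\<beta> k - 1)) * \<phi> k)) \<and>
        (\<forall>z\<in>G. \<forall>j<m. \<forall>k<m. \<forall>x. (\<forall>l<Lh. x \<noteq> lamh l z) \<longrightarrow>
           poly (P j k z) x / (\<Prod>l<Lh. (x - lamh l z) ^ mu l) =
             (\<Sum>l<Lh. \<Sum>\<nu>=1..mu l. C j k l \<nu> z / (x - lamh l z) ^ \<nu>))"
  then have p: "p = Lcm (pd ` {..<m})" and q: "\<And>j. j < m \<Longrightarrow> 0 < q j" and pd: "\<And>j. j < m \<Longrightarrow> 0 < pd j"
    and \<beta>q: "\<And>j. j < m \<Longrightarrow> \<beta> j = real (q j) / real (pd j)" and \<beta>1: "\<And>j. j < m \<Longrightarrow> \<beta> j \<le> 1"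
    and n: "\<And>j. j < m \<Longrightarrow> n j = q j * p div pd j"
    and N0: "\<And>z. z \<in> G \<Longrightarrow> P_N0 m n F z = (\<Prod>l<Lh. [:- lamh l z, 1:] ^ mu l)"
    by blast+
  have p0: "0 < p"
  proof -
    \<comment> \<open>A least common multiple of finitely many numbers is 0 only if one of them is;
      for \<open>m = 0\<close> it is 1.\<close>
    have "0 \<notin> pd ` {..<m}" using pd by (metis imageE lessThan_iff less_irrefl)
    then show ?thesis unfolding p by (intro gr0I) (simp add: Lcm_0_iff)
  qed
  have \<beta>n: "\<beta> j = real (n j) / real p" if j: "j < m" for j
  proof -
    have "pd j dvd p" unfolding p by (rule dvd_Lcm) (use j in simp)
    then have "real (n j) = real (q j) * real p / real (pd j)"
      using real_of_nat_div[of "pd j" "q j * p"] by (simp add: n[OF j])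
    then show ?thesis using p0 pd[OF j] by (simp add: \<beta>q[OF j])
  qed
  have n0: "0 < n j" if j: "j < m" for j
  proof -
    have "0 < real (n j) / real p" unfolding \<beta>n[OF j, symmetric] \<beta>q[OF j] using q[OF j] pd[OF j] by simp
    then show ?thesis by (simp add: zero_less_divide_iff)
  qed
  have np: "n j \<le> p" if j: "j < m" for j
    using \<beta>1[OF j] p0 by (simp add: \<beta>n[OF j])
  interpret frac_problem A D G m \<beta> F H \<Phi> n "1 / real p"
    by unfold_locales (use op G calculus F_analytic initial source p0 n0 \<beta>n \<beta>1 in auto)
  show "solution_represented_by A D G m \<beta> F H \<Phi> (partial_fraction_symbol m \<beta> p Lh lamh mu C)"
  proof (rule solution_series_symbol)
    fix t :: real and z and j k
    assume a: "0 < t" "z \<in> G" "j < m" "k < m"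
    show "partial_fraction_symbol m \<beta> p Lh lamh mu C t z $$ (j, k) = series_symbol (1 / real p) m n F t j k z"
    proof (rule partial_fraction_series_symbol[where P="\<lambda>j k. P j k z"])
      show "Determinant.det (cramer_matrix m \<beta> F \<phi> j s z) =
         (\<Sum>k<m. poly (P j k z) (complex_of_real (s powr (1 / real p))) * complex_of_real (s powr (\<beta> k - 1)) * \<phi> k)"
        if "j < m" "0 < s" for j \<phi> s
        using * a that by blast
      show "poly (P j k z) x / (\<Prod>l<Lh. (x - lamh l z) ^ mu l) =
          (\<Sum>l<Lh. \<Sum>\<nu>=1..mu l. C j k l \<nu> z / (x - lamh l z) ^ \<nu>)"
        if "j < m" "k < m" "\<forall>l<Lh. x \<noteq> lamh l z" for j k x
        using * a that by blast
    qed (use a p0 n0 np \<beta>n N0 in auto)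
  qed
qed

end
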